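(* Let $n\ge 1$. Call a triple $(V,c,\nu)$ admissible if $c>0$; $V\in C^2(\mathbb{R}^n)$ is radial, satisfies $\nabla^2V(x)-cI_n\ge 0$ for all $x\in\mathbb{R}^n$, and $\mathrm{d}\mu_V=e^{-V}\,\mathrm{d}x$ is a probability measure on $\mathbb{R}^n$; and $\nu\ll\mu_V$ is a probability measure on $\mathbb{R}^n$ with radial density. For such a triple let $g:\mathbb{R}^n\to\mathbb{R}$ be such that $T(x):=x+\frac1c\nabla g(x)$ is the Brenier map pushing $\mu_V$ forward to $\nu$, and let $Lg$ be the inf-convolution of $g$ with the cost $c(x,y)=\frac c2|x-y|^2$. (i) (Stability) There exists a constant $C_n>0$ depending only on $n$ such that for every admissible triple $(V,c,\nu)$, $$\int_{\mathbb{R}^n}\left|1-\frac{e^{Lg(x)}}{\int_{\mathbb{R}^n}e^{Lg}\,\mathrm{d}\mu_V}\right|\,\mathrm{d}\mu_V(x)\le C_n\cdot\left(\delta^{\sf Tal}_{\mu_V}(\nu)\right)^{\frac12}.$$ (ii) (Optimality) The exponent $\frac12$ in (i) cannot be replaced by a larger absolute constant: there do not exist an absolute constant $\eta>\frac12$ and a constant $C_n>0$ depending only on $n$ such that $$\int_{\mathbb{R}^n}\left|1-\frac{e^{Lg(x)}}{\int_{\mathbb{R}^n}e^{Lg}\,\mathrm{d}\mu_V}\right|\,\mathrm{d}\mu_V(x)\le C_n\cdot\left(\delta^{\sf Tal}_{\mu_V}(\nu)\right)^{\eta}$$ for every admissible triple $(V,c,\nu)$.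
   Context: $I_n$ is the $n\times n$ identity matrix, $\nabla^2V$ is the Hessian of $V$, and $A\ge 0$ means that the symmetric matrix $A$ is positive semi-definite. A function $h$ on $\mathbb{R}^n$ is radial if $h(\tau x)=h(x)$ for all $x\in\mathbb{R}^n$ and all $\tau\in O(n)$. For a probability measure $\nu\ll\mu_V$, the relative entropy is $D(\nu\|\mu_V)=\int_{\mathbb{R}^n}\frac{\mathrm{d}\nu}{\mathrm{d}\mu_V}\log\frac{\mathrm{d}\nu}{\mathrm{d}\mu_V}\,\mathrm{d}\mu_V$, and the Wasserstein distance is $W_2(\nu,\mu_V)=\inf_\pi\left(\int_{\mathbb{R}^n}\int_{\mathbb{R}^n}|x-y|^2\,\mathrm{d}\pi(x,y)\right)^{1/2}$, the infimum being over all probability measures $\pi$ on $\mathbb{R}^n\times\mathbb{R}^n$ with marginals $\nu$ and $\mu_V$. The Talagrand deficit is $$\delta^{\sf Tal}_{\mu_V}(\nu)=D(\nu\|\mu_V)-\frac c2W_2^2(\nu,\mu_V),$$ understood as $+\infty$ if $D(\nu\|\mu_V)=+\infty$ (in which case the estimates above are regarded as trivially satisfied); it is nonnegative by the Talagrand transport inequality $W_2^2(\nu,\mu_V)\le\frac2cD(\nu\|\mu_V)$. By Brenier--McCann theory there is a function $g:\mathbb{R}^n\to\mathbb{R}$ such that $x\mapsto\frac c2|x|^2+g(x)$ is convex and $T(x)=x+\frac1c\nabla g(x)$ (defined a.e.) pushes $\mu_V$ forward to $\nu$; $T$ is the Brenier map. The inf-convolution is $Lg(y)=\inf_{x\in\mathbb{R}^n}\left[g(x)+\frac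 c2|x-y|^2\right]$, with $e^{Lg(y)}:=0$ where the infimum is $-\infty$. *)

theory Defs
  imports "HOL-Probability.Probability"
begin

section \<open>Radial functions and second-order calculus\<close>

definition radial :: "(real^'n \<Rightarrow> real) \<Rightarrow> bool" where
  "radial h \<longleftrightarrow> (\<forall>\<tau> x. orthogonal_transformation \<tau> \<longrightarrow> h (\<tau> x) = h x)"

definition grad :: "(real^'n \<Rightarrow> real) \<Rightarrow> real^'n \<Rightarrow> real^'n" where
  "grad f x = (\<chi> i. frechet_derivative f (at x) (axis i 1))"

definition hessian :: "(real^'n \<Rightarrow> real) \<Rightarrow> real^'n \<Rightarrow> real^'n^'n" where
  "hessian f x = jacobian (grad f) (at x)"

definition C2 :: "(real^'n \<Rightarrow> real) \<Rightarrow> bool" where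
  "C2 f \<longleftrightarrow> (\<forall>x. f differentiable (at x)) \<and> (\<forall>x. grad f differentiable (at x)) \<and>
     continuous_on UNIV (hessian f)"

definition psd :: "real^'n^'n \<Rightarrow> bool" where
  "psd A \<longleftrightarrow> transpose A = A \<and> (\<forall>h. 0 \<le> h \<bullet> (A *v h))"


section \<open>Admissible triples\<close>

definition mu :: "(real^'n \<Rightarrow> real) \<Rightarrow> (real^'n) measure" where
  "mu V = density lborel (\<lambda>x. ennreal (exp (- V x)))"

text \<open>A density is only determined almost everywhere, so the last clause asks for a radial version
  of it. As \<^term>\<open>V\<close> is radial, it does not matter whether the density is taken with respect to
  \<^term>\<open>mu V\<close> or to Lebesgue measure.\<close>

definition admissible :: "(real^'n \<Rightarrow> real) \<Rightarrow> real \<Rightarrow> (real^'n) measure \<Rightarrow> bool" where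
  "admissible V c \<nu> \<longleftrightarrow>
     c > 0 \<and>
     C2 V \<and> radial V \<and> (\<forall>x. psd (hessian V x - c *\<^sub>R mat 1)) \<and> prob_space (mu V) \<and>
     prob_space \<nu> \<and> sets \<nu> = sets borel \<and> absolutely_continuous (mu V) \<nu> \<and>
     (\<exists>f\<in>borel_measurable borel. (\<forall>x. f x \<ge> 0) \<and> radial f \<and>
        \<nu> = density (mu V) (\<lambda>x. ennreal (f x)))"


section \<open>Relative entropy, Wasserstein distance and the Talagrand deficit\<close>

text \<open>For \<open>t \<ge> 0\<close> the function \<open>t log t\<close> is bounded below (with \<open>0 log 0 = 0\<close>, which holds in the
  library), so against a probability measure the only way for the integrand to fail to be integrable
  is that its integral equals \<open>+\<infinity>\<close>.\<close>

definition rel_entropy :: "'a measure \<Rightarrow> 'a measure \<Rightarrow> ereal" where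
  "rel_entropy \<nu> \<mu> =
     (let r = (\<lambda>x. enn2real (RN_deriv \<mu> \<nu> x)) in
      if integrable \<mu> (\<lambda>x. r x * ln (r x)) then ereal (\<integral>x. r x * ln (r x) \<partial>\<mu>) else \<infinity>)"

definition couplings :: "(real^'n) measure \<Rightarrow> (real^'n) measure \<Rightarrow> ((real^'n) \<times> (real^'n)) measure set" where
  "couplings \<nu> \<mu> = {\<pi>. prob_space \<pi> \<and> sets \<pi> = sets (borel \<Otimes>\<^sub>M borel) \<and>
     distr \<pi> borel fst = \<nu> \<and> distr \<pi> borel snd = \<mu>}"

text \<open>Powers on \<open>[0, \<infinity>]\<close> with exponent \<open>p > 0\<close>; in particular \<open>0\<close> is sent to \<open>0\<close>.\<close>

definition ennpowr :: "ennreal \<Rightarrow> real \<Rightarrow> ennreal" where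
  "ennpowr t p = (if t = \<infinity> then \<infinity> else ennreal (enn2real t powr p))"

definition W2 :: "(real^'n) measure \<Rightarrow> (real^'n) measure \<Rightarrow> ennreal" where
  "W2 \<nu> \<mu> = (INF \<pi>\<in>couplings \<nu> \<mu>.
     ennpowr (\<integral>\<^sup>+p. ennreal ((norm (fst p - snd p))\<^sup>2) \<partial>\<pi>) (1/2))"

definition tal_deficit :: "real \<Rightarrow> (real^'n) measure \<Rightarrow> (real^'n) measure \<Rightarrow> ereal" where
  "tal_deficit c \<mu> \<nu> =
     (if rel_entropy \<nu> \<mu> = \<infinity> then \<infinity>
      else rel_entropy \<nu> \<mu> - ereal (c / 2) * enn2ereal ((W2 \<nu> \<mu>)\<^sup>2))"


section \<open>Brenier map and inf-convolution\<close>

text \<open>The map \<open>x + (1/c) \<nabla>g(x)\<close> is only defined where \<^term>\<open>g\<close> is differentiable; \<^term>\<open>T\<close> is a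
  Borel version of it.\<close>

definition brenier_potential ::
    "real \<Rightarrow> (real^'n) measure \<Rightarrow> (real^'n) measure \<Rightarrow> (real^'n \<Rightarrow> real) \<Rightarrow> bool" where
  "brenier_potential c \<mu> \<nu> g \<longleftrightarrow>
     convex_on UNIV (\<lambda>x. c / 2 * (norm x)\<^sup>2 + g x) \<and>
     (\<exists>T\<in>borel_measurable borel.
        (AE x in \<mu>. g differentiable (at x) \<and> T x = x + (1 / c) *\<^sub>R grad g x) \<and>
        distr \<mu> borel T = \<nu>)"

definition inf_conv :: "real \<Rightarrow> (real^'n \<Rightarrow> real) \<Rightarrow> real^'n \<Rightarrow> ereal" where
  "inf_conv c g y = (INF x. ereal (g x + c / 2 * (norm (x - y))\<^sup>2))"

text \<open>The infimum of a nonempty family of reals is never \<open>+\<infinity>\<close>, so \<open>-\<infinity>\<close> is the only infinite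
  value to be handled.\<close>

definition exp_inf_conv :: "real \<Rightarrow> (real^'n \<Rightarrow> real) \<Rightarrow> real^'n \<Rightarrow> real" where
  "exp_inf_conv c g y =
     (if inf_conv c g y = -\<infinity> then 0 else exp (real_of_ereal (inf_conv c g y)))"

text \<open>The left-hand side of the stability estimate. If the normalising integral diverges, its value
  in Isabelle is \<open>0\<close> and the quotient is \<open>0\<close>, in agreement with the convention \<open>a / \<infinity> = 0\<close>; this can
  only happen when the relative entropy, hence the deficit, is infinite.\<close>

definition L1_discrepancy :: "real \<Rightarrow> (real^'n) measure \<Rightarrow> (real^'n \<Rightarrow> real) \<Rightarrow> ennreal" where
  "L1_discrepancy c \<mu> g =
     (\<integral>\<^sup>+x. ennreal \<bar>1 - exp_inf_conv c g x / (\<integral>y. exp_inf_conv c g y \<partial>\<mu>)\<bar> \<partial>\<mu>)"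

text \<open>The deficit is nonnegative by Talagrand's inequality, so \<^term>\<open>e2ennreal\<close> only changes its
  type. If it is \<open>+\<infinity>\<close>, so is the right-hand side (for \<open>C > 0\<close>).\<close>

definition stability_estimate ::
    "real \<Rightarrow> real \<Rightarrow> real \<Rightarrow> (real^'n) measure \<Rightarrow> (real^'n) measure \<Rightarrow> (real^'n \<Rightarrow> real) \<Rightarrow> bool" where
  "stability_estimate C \<eta> c \<mu> \<nu> g \<longleftrightarrow>
     L1_discrepancy c \<mu> g \<le> ennreal C * ennpowr (e2ennreal (tal_deficit c \<mu> \<nu>)) \<eta>"

end

theory Submission
  imports Defs
begin

text \<open>
  Write \<open>\<mu>\<close> for the measure with density \<open>exp (- V)\<close>, \<open>L g\<close> for the inf-convolution of \<open>g\<close> and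
  \<open>Z = \<integral> exp (L g) d\<mu>\<close>. Almost every \<open>x\<close> minimises \<open>z \<mapsto> g z + c/2 |z - T x|\<^sup>2\<close>, so that
  \<open>L g (T x) = g x + c/2 |x - T x|\<^sup>2\<close>. The Gibbs inequality \<open>D(\<nu>|\<mu>) \<ge> \<integral> L g d\<nu> - ln Z\<close>, together with
  the coupling of \<open>\<nu>\<close> and \<open>\<mu>\<close> given by \<open>T\<close>, shows that the Talagrand deficit is at least
  \<open>\<delta> = \<integral> g d\<mu> - ln Z\<close> (\<open>deficit_ge\<close>). It remains to bound the \<open>L\<^sup>1(\<mu>)\<close> distance between \<open>1\<close> and
  \<open>exp (L g) / Z\<close> by a multiple of the square root of \<open>\<delta>\<close>, a statement in which \<open>\<nu>\<close> no longer occurs.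

  For every rotation \<open>\<tau>\<close> the function \<open>g \<circ> \<tau>\<close> is an equally good dual potential for the same pair of
  measures. Hence the convex functions attached to \<open>g\<close> and to \<open>g \<circ> \<tau>\<close> share the subgradient \<open>c T x\<close> at
  almost every point, which forces them to differ by a constant
  (\<open>common_subgradients_imp_diff_const\<close>). So \<open>g\<close> is radial (\<open>g_orthogonal_invariant\<close>), and everything
  reduces to the half-line with the density \<open>m r = N r\<^sup>d exp (- v r)\<close>, where \<open>d = n - 1\<close>.

  On the half-line let \<open>s\<close> be the increasing map that transports \<open>m\<close> to \<open>exp l m / Z\<close>, with \<open>l\<close> the
  profile of \<open>L g\<close> (restricted to a bounded interval, to be exhausted at the end). The logarithm
  of the change of variables formula, the defining inequality \<open>l (s r) \<le> \<gamma> r + c/2 (s r - r)\<^sup>2\<close>, the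
  strong convexity of \<open>v\<close> and an integration by parts give \<open>\<integral> \<Phi> m \<le> \<delta>\<close> (\<open>\<Phi>_integral\<close>), where \<open>\<Phi>\<close>
  is the sum of \<open>\<lambda> - 1 - ln \<lambda>\<close> over the eigenvalues \<open>\<lambda>\<close> of the differential of the radial map:
  \<open>s' r\<close> once and \<open>s r / r\<close> with multiplicity \<open>d\<close>. As \<open>|\<lambda> - 1| \<le> \<epsilon> + 2 (\<lambda> - 1 - ln \<lambda>) / \<epsilon>\<close>, this
  controls \<open>\<integral> \<Psi> m\<close>, where \<open>\<Psi>\<close> is the sum of \<open>|\<lambda> - 1|\<close>, and the choice \<open>\<epsilon> = sqrt \<delta>\<close> produces
  the exponent \<open>1/2\<close>.

  Finally the distance in question is \<open>2 \<integral> (m r - m (s r) s' r)\<^sub>+ dr\<close>, and it is at most \<open>4 \<integral> \<Psi> m\<close>.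
  Where \<open>s r \<le> r\<close> this is a pointwise bound, because \<open>v\<close> is increasing. Where \<open>s r > r\<close>, the difference
  \<open>exp (- v r) - exp (- v (s r))\<close> can be large even though \<open>\<Psi>\<close> is small, but up to a multiple of
  \<open>\<Psi> m\<close> it is minus the derivative of \<open>h r = N r\<^sup>d \<integral>\<^bsub>r\<^esub>\<^bsup>s r\<^esup> exp (- v)\<close>, whose positive part starts at \<open>0\<close>
  and therefore contributes with a favourable sign (\<open>q_integral\<close>).

  The exponent is optimal because of Gaussian dilations: for \<open>T x = K x\<close> the deficit is
  at most \<open>n (K - 1)\<^sup>2\<close>, while the discrepancy is at least a constant times \<open>K - 1\<close>.
\<close>

section \<open>Calculus on the half-line\<close>

text \<open>The function \<open>x - 1 - ln x\<close> is quadratic near \<open>1\<close> and linear at infinity; the parameter \<open>\<epsilon>\<close>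
  interpolates between the two regimes and replaces an application of Jensen's inequality. The bound
  comes from \<open>x - 1 - ln x \<ge> (sqrt x - 1)\<^sup>2\<close>.\<close>
lemma abs_minus_one_le_entropy:
  fixes x \<epsilon> :: real
  assumes "x > 0" "0 < \<epsilon>" "\<epsilon> \<le> 1"
  shows "\<bar>x - 1\<bar> \<le> \<epsilon> + 2 * (x - 1 - ln x) / \<epsilon>"
proof -
  define q where "q = sqrt x - 1"
  define p where "p = x - 1 - ln x"
  have sx: "sqrt x > 0" "x = (sqrt x)\<^sup>2" using assms by auto
  have "ln x = 2 * ln (sqrt x)" using assms by (simp add: ln_sqrt)
  also have "\<dots> \<le> 2 * (sqrt x - 1)" using ln_le_minus_one[OF sx(1)] by simp
  finally have p1: "q\<^sup>2 \<le> p" unfolding p_def q_def using sx(2)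
    by (simp add: power2_eq_square algebra_simps)
  have "x - 1 = q * q + 2 * q" using sx(2) unfolding q_def by (simp add: power2_eq_square algebra_simps)
  hence 1: "\<bar>x - 1\<bar> \<le> q\<^sup>2 + 2 * \<bar>q\<bar>"
    by (metis abs_mult abs_numeral abs_triangle_ineq abs_of_nonneg zero_le_power2 power2_eq_square)
  have "0 \<le> (\<epsilon> - \<bar>q\<bar>)\<^sup>2" by simp
  hence "2 * \<bar>q\<bar> * \<epsilon> \<le> \<epsilon> * \<epsilon> + q\<^sup>2" by (simp add: power2_eq_square algebra_simps)
  hence 2: "2 * \<bar>q\<bar> \<le> \<epsilon> + q\<^sup>2 / \<epsilon>" using assms(2) by (simp add: field_simps)
  have "q\<^sup>2 * \<epsilon> \<le> p * 1" using p1 assms by (intro mult_mono) (auto intro: order_trans[OF _ p1])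
  hence 3: "q\<^sup>2 \<le> p / \<epsilon>" using assms by (simp add: field_simps)
  have 4: "q\<^sup>2 / \<epsilon> \<le> p / \<epsilon>" using p1 assms by (simp add: divide_right_mono)
  have "2 * p / \<epsilon> = p / \<epsilon> + p / \<epsilon>" by simp
  thus ?thesis using 1 2 3 4 unfolding p_def[symmetric] by linarith
qed

text \<open>The fundamental theorem of calculus for the positive part of \<open>h\<close>. The weight is \<open>1\<close> where
  \<open>h > 0\<close>, \<open>0\<close> where \<open>h < 0\<close> and \<open>1/2\<close> on the zero set, since it is the limit of the derivatives of
  the smooth approximations \<open>(x + sqrt (x\<^sup>2 + e)) / 2\<close> of \<open>max x 0\<close>.\<close>
lemma FTC_positive_part:
  fixes h h' :: "real \<Rightarrow> real"
  assumes ab: "a \<le> b"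
    and der: "\<And>x. a \<le> x \<Longrightarrow> x \<le> b \<Longrightarrow> (h has_real_derivative h' x) (at x)"
    and cont: "continuous_on {a..b} h'"
  shows "(LINT x:{a..b}|lborel. (1 + sgn (h x)) / 2 * h' x) = max (h b) 0 - max (h a) 0"
    and "set_integrable lborel {a..b} (\<lambda>x. (1 + sgn (h x)) / 2 * h' x)"
proof -
  define e where "e j = inverse (real (Suc j))" for j
  have e: "e j > 0" for j unfolding e_def by simp
  define \<psi> where "\<psi> j x = (x + sqrt (x\<^sup>2 + e j)) / 2" for j x
  define w where "w j x = (1 + x / sqrt (x\<^sup>2 + e j)) / 2" for j x
  have pos: "x\<^sup>2 + e j > 0" for x j using e[of j] by (simp add: add_nonneg_pos)
  have d\<psi>: "(\<psi> j has_real_derivative w j x) (at x)" for j x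
    unfolding \<psi>_def w_def using pos[of x j]
    by (auto intro!: derivative_eq_intros simp: field_simps)
  have conth: "continuous_on {a..b} h"
    by (intro continuous_at_imp_continuous_on ballI) (auto intro!: DERIV_isCont der)
  have contw: "continuous_on {a..b} (\<lambda>x. w j (h x) * h' x)" for j
    unfolding w_def using pos[of _ j]
    by (intro continuous_intros conth cont) (auto simp: less_imp_neq[symmetric])
  have FTC: "(LINT x:{a..b}|lborel. w j (h x) * h' x) = \<psi> j (h b) - \<psi> j (h a)" for j
    unfolding set_lebesgue_integral_def
  proof (rule integral_FTC_atLeastAtMost[OF ab _ contw])
    fix x assume "a \<le> x" "x \<le> b"
    hence "((\<lambda>x. \<psi> j (h x)) has_real_derivative w j (h x) * h' x) (at x)"
      using DERIV_chain2[OF d\<psi> der] by blast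
    thus "((\<lambda>x. \<psi> j (h x)) has_vector_derivative w j (h x) * h' x) (at x within {a..b})"
      by (simp add: has_real_derivative_iff_has_vector_derivative has_vector_derivative_at_within)
  qed
  have e0: "e \<longlonglongrightarrow> 0" unfolding e_def by (rule LIMSEQ_inverse_real_of_nat)
  have \<psi>lim: "(\<lambda>j. \<psi> j x) \<longlonglongrightarrow> max x 0" for x
  proof -
    have "(\<lambda>j. \<psi> j x) \<longlonglongrightarrow> (x + sqrt (x\<^sup>2 + 0)) / 2"
      unfolding \<psi>_def by (intro tendsto_intros e0) auto
    moreover have "(x + sqrt (x\<^sup>2 + 0)) / 2 = max x 0" by (simp add: max_def abs_if)
    ultimately show ?thesis by simp
  qed
  have wlim: "(\<lambda>j. w j x) \<longlonglongrightarrow> (1 + sgn x) / 2" for x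
  proof (cases "x = 0")
    case False
    have "(\<lambda>j. w j x) \<longlonglongrightarrow> (1 + x / sqrt (x\<^sup>2 + 0)) / 2"
      unfolding w_def using False by (intro tendsto_intros e0) auto
    thus ?thesis using False by (simp add: sgn_if abs_if split: if_splits)
  qed (simp add: w_def)
  have w1: "\<bar>w j x\<bar> \<le> 1" for j x
  proof -
    have "\<bar>x\<bar> \<le> sqrt (x\<^sup>2 + e j)" by (rule real_le_rsqrt) (use e[of j] in auto)
    hence "\<bar>x / sqrt (x\<^sup>2 + e j)\<bar> \<le> 1" using pos[of x j] by (simp add: abs_divide divide_le_eq_1)
    moreover have "\<bar>(1 + y) / 2\<bar> \<le> 1" if "\<bar>y\<bar> \<le> 1" for y :: real using that by (simp add: abs_le_iff)
    ultimately show ?thesis unfolding w_def by blast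
  qed
  have meas: "(\<lambda>x. indicator {a..b} x *\<^sub>R (w j (h x) * h' x)) \<in> borel_measurable lborel" for j
    using borel_integrable_atLeastAtMost'[OF contw[of j]] unfolding set_integrable_def by auto
  have lim: "(\<lambda>j. indicator {a..b} x *\<^sub>R (w j (h x) * h' x)) \<longlonglongrightarrow> indicator {a..b} x *\<^sub>R ((1 + sgn (h x)) / 2 * h' x)" for x
    by (intro tendsto_intros wlim)
  have dom: "integrable lborel (\<lambda>x. indicator {a..b} x *\<^sub>R \<bar>h' x\<bar>)"
    using borel_integrable_atLeastAtMost'[of a b "\<lambda>x. \<bar>h' x\<bar>"] cont
    unfolding set_integrable_def by (auto intro: continuous_intros)
  have bd: "norm (indicator {a..b} x *\<^sub>R (w j (h x) * h' x)) \<le> indicator {a..b} x *\<^sub>R \<bar>h' x\<bar>" for j x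
    using mult_right_mono[OF w1[of j "h x"], of "\<bar>h' x\<bar>"] by (auto simp: indicator_def abs_mult)
  have meas': "(\<lambda>x. indicator {a..b} x *\<^sub>R ((1 + sgn (h x)) / 2 * h' x)) \<in> borel_measurable lborel"
    by (rule borel_measurable_LIMSEQ_real[OF lim meas])
  show "set_integrable lborel {a..b} (\<lambda>x. (1 + sgn (h x)) / 2 * h' x)"
    unfolding set_integrable_def by (rule integrable_dominated_convergence[where s="\<lambda>j x. indicator {a..b} x *\<^sub>R (w j (h x) * h' x)", OF meas' meas dom]) (use lim bd in auto)
  have "(\<lambda>j. LINT x:{a..b}|lborel. w j (h x) * h' x) \<longlonglongrightarrow> (LINT x:{a..b}|lborel. (1 + sgn (h x)) / 2 * h' x)"
    unfolding set_lebesgue_integral_def by (rule integral_dominated_convergence[where s="\<lambda>j x. indicator {a..b} x *\<^sub>R (w j (h x) * h' x)", OF meas' meas dom]) (use lim bd in auto)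
  moreover have "(\<lambda>j. LINT x:{a..b}|lborel. w j (h x) * h' x) \<longlonglongrightarrow> max (h b) 0 - max (h a) 0"
    unfolding FTC by (intro tendsto_intros \<psi>lim)
  ultimately show "(LINT x:{a..b}|lborel. (1 + sgn (h x)) / 2 * h' x) = max (h b) 0 - max (h a) 0"
    by (rule LIMSEQ_unique)
qed

lemma exhausting_intervals:
  fixes x :: real
  shows "(x > 0) \<longleftrightarrow> (\<exists>k. x \<in> {inverse (Suc k)..Suc k})"
    and "incseq (\<lambda>k::nat. {inverse (Suc k)..real (Suc k)})"
proof
  assume "x > 0"
  obtain k1 :: nat where k1: "inverse (Suc k1) < x" using reals_Archimedean[OF \<open>x > 0\<close>] by auto
  obtain k2 :: nat where k2: "x < k2" using reals_Archimedean2 by auto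
  have "inverse (Suc (max k1 k2)) \<le> inverse (real (Suc k1))" by (intro le_imp_inverse_le) auto
  hence "inverse (Suc (max k1 k2)) \<le> x" using k1 by linarith
  moreover have "x \<le> Suc (max k1 k2)" using k2 by linarith
  ultimately have "x \<in> {inverse (Suc (max k1 k2))..Suc (max k1 k2)}" by simp
  thus "\<exists>k. x \<in> {inverse (Suc k)..Suc k}" by blast
next
  assume "\<exists>k. x \<in> {inverse (Suc k)..Suc k}"
  then obtain k :: nat where "inverse (Suc k) \<le> x" by auto
  moreover have "inverse (real (Suc k)) > 0" by simp
  ultimately show "x > 0" by linarith
next
  show "incseq (\<lambda>k::nat. {inverse (Suc k)..real (Suc k)})"
  proof (rule incseq_SucI)
    fix k :: nat
    have "inverse (real (Suc (Suc k))) \<le> inverse (real (Suc k))" by (intro le_imp_inverse_le) auto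
    thus "{inverse (Suc k)..real (Suc k)} \<subseteq> {inverse (Suc (Suc k))..real (Suc (Suc k))}" by auto
  qed
qed

text \<open>A bound on compact intervals, up to a boundary term that converges, passes to the half-line
  without knowing in advance that \<open>f\<close> is integrable. It serves to integrate by parts.\<close>
lemma nn_integral_halfline_le:
  fixes f u :: "real \<Rightarrow> real"
  assumes f: "\<And>x. x > 0 \<Longrightarrow> f x \<ge> 0"
    and fint: "\<And>k. set_integrable lborel {inverse (Suc k)..Suc k} f"
    and u: "set_integrable lborel {0<..} u"
    and \<beta>: "\<beta> \<longlonglongrightarrow> L"
    and le: "\<forall>\<^sub>F k in sequentially. (LINT x:{inverse (Suc k)..Suc k}|lborel. f x)
         \<le> (LINT x:{inverse (Suc k)..Suc k}|lborel. u x) + \<beta> k"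
  shows "(\<integral>\<^sup>+x. ennreal (f x * indicator {0<..} x) \<partial>lborel) \<le> ennreal ((LINT x:{0<..}|lborel. u x) + L)"
    and "0 \<le> (LINT x:{0<..}|lborel. u x) + L"
proof -
  define A where "A k = {inverse (real (Suc k))..real (Suc k)}" for k :: nat
  have A: "incseq A" "x > 0 \<longleftrightarrow> (\<exists>k. x \<in> A k)" for x
    using exhausting_intervals(1)[of x] exhausting_intervals(2) unfolding A_def by auto
  have Un: "(\<Union>k. A k) = {0<..}" using A(2) by auto
  have fA: "integrable lborel (\<lambda>x. f x * indicator (A k) x)" for k
    using fint[of k] unfolding set_integrable_def A_def by (simp add: mult.commute)
  have nnfA: "f x * indicator (A k) x \<ge> 0" for x k
    using f[of x] A(2)[of x] by (auto simp: indicator_def)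
  have ulim: "(\<lambda>k. LINT x:A k|lborel. u x) \<longlonglongrightarrow> (LINT x:{0<..}|lborel. u x)"
    using set_integral_cont_up[where A=A and M=lborel and f=u] A(1) u Un unfolding A_def by simp
  have rlim: "(\<lambda>k. (LINT x:A k|lborel. u x) + \<beta> k) \<longlonglongrightarrow> (LINT x:{0<..}|lborel. u x) + L"
    by (intro tendsto_add ulim \<beta>)
  have f_nn: "0 \<le> (LINT x:A k|lborel. f x)" for k
    unfolding set_lebesgue_integral_def
    by (rule Bochner_Integration.integral_nonneg) (use nnfA in \<open>auto simp: mult.commute\<close>)
  show "0 \<le> (LINT x:{0<..}|lborel. u x) + L"
  proof (rule tendsto_lowerbound[OF rlim _ sequentially_bot])
    show "\<forall>\<^sub>F k in sequentially. 0 \<le> (LINT x:A k|lborel. u x) + \<beta> k"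
      using le
    proof eventually_elim
      case (elim k)
      thus ?case using f_nn[of k] unfolding A_def by linarith
    qed
  qed
  have "(\<lambda>k. \<integral>\<^sup>+x. ennreal (f x * indicator (A k) x) \<partial>lborel) \<longlonglongrightarrow> (\<integral>\<^sup>+x. ennreal (f x * indicator {0<..} x) \<partial>lborel)"
  proof (rule nn_integral_LIMSEQ)
    show "incseq (\<lambda>k x. ennreal (f x * indicator (A k) x))"
    proof (rule incseq_SucI, rule le_funI)
      fix k x show "ennreal (f x * indicator (A k) x) \<le> ennreal (f x * indicator (A (Suc k)) x)"
        using incseq_SucD[OF A(1), of k] f[of x] A(2)[of x] by (auto simp: indicator_def)
    qed
    show "(\<lambda>x. ennreal (f x * indicator (A k) x)) \<in> borel_measurable lborel" for k
      using fA[of k] by auto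
    show "(\<lambda>k. ennreal (f x * indicator (A k) x)) \<longlonglongrightarrow> ennreal (f x * indicator {0<..} x)" for x
    proof (cases "x > 0")
      case True
      then obtain k0 where k0: "x \<in> A k0" using A(2) by auto
      have "\<forall>\<^sub>F k in sequentially. ennreal (f x * indicator (A k) x) = ennreal (f x * indicator {0<..} x)"
        using eventually_ge_at_top[of k0]
        by eventually_elim (use k0 True incseqD[OF A(1)] in \<open>auto simp: indicator_def\<close>)
      thus ?thesis by (rule tendsto_eventually)
    next
      case False
      hence "x \<notin> A k" for k using A(2) by auto
      thus ?thesis using False by simp
    qed
  qed
  moreover have "(\<lambda>k. ennreal ((LINT x:A k|lborel. u x) + \<beta> k)) \<longlonglongrightarrow> ennreal ((LINT x:{0<..}|lborel. u x) + L)"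
    by (intro tendsto_ennrealI rlim)
  moreover have "\<forall>\<^sub>F k in sequentially. (\<integral>\<^sup>+x. ennreal (f x * indicator (A k) x) \<partial>lborel) \<le> ennreal ((LINT x:A k|lborel. u x) + \<beta> k)"
    using le
  proof eventually_elim
    case (elim k)
    have "(\<integral>\<^sup>+x. ennreal (f x * indicator (A k) x) \<partial>lborel) = ennreal (\<integral>x. f x * indicator (A k) x \<partial>lborel)"
      by (rule nn_integral_eq_integral[OF fA]) (use nnfA in auto)
    also have "(\<integral>x. f x * indicator (A k) x \<partial>lborel) = (LINT x:A k|lborel. f x)"
      unfolding set_lebesgue_integral_def by (simp add: mult.commute)
    finally show ?case using elim unfolding A_def by (simp add: ennreal_leI)
  qed
  ultimately show "(\<integral>\<^sup>+x. ennreal (f x * indicator {0<..} x) \<partial>lborel) \<le> ennreal ((LINT x:{0<..}|lborel. u x) + L)"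
    by (intro tendsto_le[OF sequentially_bot])
qed

lemma primitive_on_interval:
  fixes k :: "real \<Rightarrow> real"
  assumes cont: "continuous_on {0..B} k" and pos: "\<And>t. 0 < t \<Longrightarrow> t < B \<Longrightarrow> k t > 0"
    and K_def: "K = (\<lambda>t. integral {0..t} k)"
  shows "continuous_on {0..B} K"
    and "\<And>t. 0 < t \<Longrightarrow> t < B \<Longrightarrow> (K has_real_derivative k t) (at t)"
    and "\<And>x y. 0 \<le> x \<Longrightarrow> x < y \<Longrightarrow> y \<le> B \<Longrightarrow> K x < K y"
    and "K 0 = 0"
    and "\<And>t. 0 \<le> t \<Longrightarrow> t \<le> B \<Longrightarrow> K t = (LINT x:{0..t}|lborel. k x)"
proof -
  have d: "(K has_real_derivative k t) (at t within {0..B})" if "0 \<le> t" "t \<le> B" for t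
    unfolding K_def by (rule integral_has_real_derivative[OF cont]) (use that in auto)
  show c: "continuous_on {0..B} K"
    unfolding continuous_on_eq_continuous_within
    by (intro ballI DERIV_continuous[OF d]) auto
  show d': "(K has_real_derivative k t) (at t)" if "0 < t" "t < B" for t
    using d[of t] that at_within_Icc_at[of 0 t B] by simp
  show "K x < K y" if "0 \<le> x" "x < y" "y \<le> B" for x y
  proof (rule DERIV_pos_imp_increasing_open[OF that(2)])
    fix t assume "x < t" "t < y"
    hence t: "0 < t" "t < B" using that by auto
    show "\<exists>D. (K has_real_derivative D) (at t) \<and> D > 0" using d'[OF t] pos[OF t] by blast
  qed (use that in \<open>auto intro: continuous_on_subset[OF c]\<close>)
  show "K 0 = 0" unfolding K_def by simp
  show "K t = (LINT x:{0..t}|lborel. k x)" if "0 \<le> t" "t \<le> B" for t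
    unfolding K_def
    by (intro set_borel_integral_eq_integral(2)[symmetric] borel_integrable_atLeastAtMost' continuous_on_subset[OF cont])
       (use that in auto)
qed

text \<open>With \<open>F\<close> and \<open>G\<close> the primitives of \<open>a\<close> and \<open>b\<close>, the transport is \<open>s = G\<^sup>-\<^sup>1 \<circ> F\<close>; positivity and
  continuity of the densities make it a \<open>C\<^sup>1\<close> diffeomorphism.\<close>
lemma monotone_transport_exists:
  fixes a b :: "real \<Rightarrow> real"
  assumes R: "R > 0"
    and a: "continuous_on {0..} a" "\<And>r. r > 0 \<Longrightarrow> a r > 0" "set_integrable lborel {0..} a"
    and b: "continuous_on {0..R} b" "\<And>t. 0 < t \<Longrightarrow> t < R \<Longrightarrow> b t > 0"
    and mass: "(LINT r:{0..}|lborel. a r) = (LINT t:{0..R}|lborel. b t)"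
  obtains s s' where "\<And>r. r > 0 \<Longrightarrow> 0 < s r" "\<And>r. r > 0 \<Longrightarrow> s r < R"
    "\<And>r. r > 0 \<Longrightarrow> (s has_real_derivative s' r) (at r)"
    "\<And>r. r > 0 \<Longrightarrow> s' r > 0"
    "\<And>r. r > 0 \<Longrightarrow> b (s r) * s' r = a r"
    "(s \<longlongrightarrow> 0) (at_right 0)"
    "s ` {0<..} = {0<..<R}" "inj_on s {0<..}"
proof -
  define F where "F = (\<lambda>r. integral {0..r} a)"
  define G where "G = (\<lambda>t. integral {0..t} b)"
  define I where "I = (LINT r:{0..}|lborel. a r)"
  have aB: "continuous_on {0..B} a" for B by (rule continuous_on_subset[OF a(1)]) auto
  have F0: "F 0 = 0" and G0: "G 0 = 0" unfolding F_def G_def by simp_all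
  have F_mono: "F x < F y" if "0 \<le> x" "x < y" for x y
    by (rule primitive_on_interval(3)[where k=a and B=y]) (use aB a(2) F_def that in auto)
  have F_int: "F r = (LINT x:{0..r}|lborel. a x)" if "0 \<le> r" for r
    by (rule primitive_on_interval(5)[where B=r]) (use aB a(2) F_def that in auto)
  have F_der: "(F has_real_derivative a r) (at r)" if "0 < r" for r
    by (rule primitive_on_interval(2)[where B="r+1"]) (use aB a(2) F_def that in auto)
  have F_cont: "continuous_on {0..B} F" for B
    by (rule primitive_on_interval(1)[where k=a]) (use aB a(2) F_def in auto)
  have G_mono: "G x < G y" if "0 \<le> x" "x < y" "y \<le> R" for x y
    by (rule primitive_on_interval(3)[where k=b and B=R]) (use b G_def that in auto)
  have G_der: "(G has_real_derivative b r) (at r)" if "0 < r" "r < R" for r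
    by (rule primitive_on_interval(2)[where B=R]) (use b G_def that in auto)
  have G_cont: "continuous_on {0..R} G"
    by (rule primitive_on_interval(1)[where k=b]) (use b G_def in auto)
  have "G R = (LINT x:{0..R}|lborel. b x)"
    by (rule primitive_on_interval(5)[where B=R]) (use b G_def R in auto)
  hence GR: "G R = I" using mass I_def by simp
  have Fpos: "F r > 0" if "r > 0" for r using F_mono[of 0 r] F0 that by simp
  have FI: "F r < I" if "r \<ge> 0" for r
  proof -
    have "F r < F (r+1)" using F_mono[of r "r+1"] that by simp
    also have "F (r+1) = (LINT x:{0..r+1}|lborel. a x)" using F_int[of "r+1"] that by simp
    also have "\<dots> \<le> I" unfolding I_def set_lebesgue_integral_def
    proof (rule integral_mono_AE)
      show "integrable lborel (\<lambda>x. indicator {0..r + 1} x *\<^sub>R a x)"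
        using borel_integrable_atLeastAtMost'[OF aB] unfolding set_integrable_def .
      show "integrable lborel (\<lambda>x. indicator {0..} x *\<^sub>R a x)"
        using a(3) unfolding set_integrable_def .
      show "AE x in lborel. indicator {0..r + 1} x *\<^sub>R a x \<le> indicator {0..} x *\<^sub>R a x"
        using AE_lborel_singleton[of 0]
        by eventually_elim (use a(2) in \<open>auto simp: indicator_def order_less_le\<close>)
    qed
    finally show ?thesis .
  qed
  have Flim: "(F \<longlongrightarrow> I) at_top"
  proof -
    have "((\<lambda>x. LINT x:{0..x}|lborel. a x) \<longlongrightarrow> I) at_top"
      unfolding I_def by (rule tendsto_set_lebesgue_integral_at_top) (use a(3) in auto)
    moreover have "\<forall>\<^sub>F x in at_top. (LINT x:{0..x}|lborel. a x) = F x"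
      using eventually_ge_at_top[of 0] by eventually_elim (use F_int in auto)
    ultimately show ?thesis by (rule Lim_transform_eventually)
  qed
  have ex: "\<exists>t. 0 < t \<and> t < R \<and> G t = F r" if "r > 0" for r
  proof -
    have "\<exists>t\<ge>0. t \<le> R \<and> G t = F r"
      by (rule IVT') (use G_cont G0 R Fpos[OF that] FI[of r] GR that in auto)
    then obtain t where t: "t \<ge> 0" "t \<le> R" "G t = F r" by blast
    moreover have "t \<noteq> 0" "t \<noteq> R" using t(3) G0 GR Fpos[OF that] FI[of r] that by auto
    ultimately show ?thesis by (intro exI[of _ t]) auto
  qed
  then obtain s where s: "\<And>r. r > 0 \<Longrightarrow> 0 < s r" "\<And>r. r > 0 \<Longrightarrow> s r < R" "\<And>r. r > 0 \<Longrightarrow> G (s r) = F r"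
    by metis
  have Ginj: "x = y" if "G x = G y" "0 \<le> x" "x \<le> R" "0 \<le> y" "y \<le> R" for x y
    using G_mono[of x y] G_mono[of y x] that by (cases x y rule: linorder_cases) auto
  have Finj: "x = y" if "F x = F y" "0 \<le> x" "0 \<le> y" for x y
    using F_mono[of x y] F_mono[of y x] that by (cases x y rule: linorder_cases) auto
  have inj: "inj_on s {0<..}"
  proof (rule inj_onI)
    fix x y assume "x \<in> {0<..}" "y \<in> {0<..}" "s x = s y"
    thus "x = y" using s(3)[of x] s(3)[of y] Finj[of x y] by auto
  qed
  have img: "s ` {0<..} = {0<..<R}"
  proof
    show "s ` {0<..} \<subseteq> {0<..<R}" using s by auto
    show "{0<..<R} \<subseteq> s ` {0<..}"
    proof
      fix t assume t: "t \<in> {0<..<R}"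
      have Gt: "0 < G t" "G t < I" using G_mono[of 0 t] G_mono[of t R] G0 GR t by auto
      have "\<forall>\<^sub>F x in at_top. F x > G t" using order_tendstoD(1)[OF Flim Gt(2)] .
      then obtain B0 where B0: "\<And>x. x \<ge> B0 \<Longrightarrow> F x > G t" unfolding eventually_at_top_linorder by auto
      define B where "B = max 1 B0"
      have B: "B > 0" "F B > G t" using B0[of B] unfolding B_def by auto
      have "\<exists>r\<ge>0. r \<le> B \<and> F r = G t"
        by (rule IVT') (use F_cont[of B] F0 Gt B in auto)
      then obtain r where r: "r \<ge> 0" "F r = G t" by blast
      hence "r > 0" using F0 Gt by (cases "r = 0") auto
      hence "s r = t" using s[of r] r(2) Ginj[of "s r" t] t by auto
      thus "t \<in> s ` {0<..}" using \<open>r > 0\<close> by auto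
    qed
  qed
  have mono: "s x < s y" if "0 < x" "x < y" for x y
  proof (rule ccontr)
    assume "\<not> s x < s y"
    hence "G (s y) \<le> G (s x)" using G_mono[of "s y" "s x"] s[of x] s[of y] that
      by (cases "s y = s x") auto
    thus False using F_mono[of x y] s(3)[of x] s(3)[of y] that by simp
  qed
  define s' where "s' r = a r / b (s r)" for r
  have der: "(s has_real_derivative s' r) (at r)" if r: "r > 0" for r
  proof -
    define t where "t = s r"
    have t: "0 < t" "t < R" "G t = F r" using s r t_def by auto
    define \<delta> where "\<delta> = min t (R - t) / 2"
    have \<delta>: "\<delta> > 0" unfolding \<delta>_def using t by auto
    have in_int: "0 < z \<and> z < R" if "\<bar>z - t\<bar> \<le> \<delta>" for z
    proof -
      have "\<bar>z - t\<bar> \<le> t / 2" "\<bar>z - t\<bar> \<le> (R - t) / 2" using that unfolding \<delta>_def by auto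
      hence "t - z \<le> t / 2" "z - t \<le> (R - t) / 2" by linarith+
      hence "t - z < t" "z - t < R - t" using t(1,2) by auto
      thus ?thesis by auto
    qed
    define g where "g y = (THE z. 0 \<le> z \<and> z \<le> R \<and> G z = y)" for y
    have gG: "g (G z) = z" if "0 \<le> z" "z \<le> R" for z
      unfolding g_def by (rule the_equality) (use that Ginj in auto)
    have "isCont g (G t)"
    proof (rule isCont_inverse_function[where f=G and x=t, OF \<delta>])
      fix z assume "\<bar>z - t\<bar> \<le> \<delta>"
      hence z: "0 < z" "z < R" using in_int by auto
      show "g (G z) = z" using gG z by simp
      show "isCont G z" using DERIV_isCont[OF G_der[OF z]] .
    qed
    have GR0: "G (g y) = y" if "0 < y" "y < I" for y
    proof -
      have "\<exists>t\<ge>0. t \<le> R \<and> G t = y"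
        by (rule IVT') (use G_cont G0 R GR that in auto)
      then obtain z where "0 \<le> z" "z \<le> R" "G z = y" by blast
      thus ?thesis using gG by auto
    qed
    have "DERIV g (G t) :> inverse (b t)"
    proof (rule DERIV_inverse_function[where a=0 and b=I])
      show "(G has_real_derivative b t) (at (g (G t)))" using G_der[of t] gG[of t] t by simp
      show "b t \<noteq> 0" using b(2)[of t] t by simp
      show "0 < G t" "G t < I" using Fpos[OF r] FI[of r] r t(3) by auto
    qed (use GR0 \<open>isCont g (G t)\<close> in auto)
    hence "DERIV g (F r) :> inverse (b (s r))" using t t_def by simp
    hence d1: "((\<lambda>x. g (F x)) has_real_derivative inverse (b (s r)) * a r) (at r)"
      using DERIV_chain2[OF _ F_der[of r]] r by simp
    have ev: "\<forall>\<^sub>F x in nhds r. g (F x) = s x"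
    proof -
      have "\<forall>\<^sub>F x in nhds r. x > 0" using r by (intro eventually_nhds_in_open[of "{0<..}" r, simplified]) auto
      thus ?thesis
      proof eventually_elim
        case (elim x) thus ?case using gG[of "s x"] s[OF elim] by simp
      qed
    qed
    have "(s has_real_derivative inverse (b (s r)) * a r) (at r)"
      using DERIV_cong_ev[THEN iffD1, OF refl ev refl d1] .
    thus ?thesis unfolding s'_def by (simp add: field_simps)
  qed
  have lim: "(s \<longlongrightarrow> 0) (at_right 0)"
  proof (rule order_tendstoI)
    fix y :: real assume "y < 0"
    show "\<forall>\<^sub>F x in at_right 0. y < s x"
    proof (rule eventually_at_rightI[of 0 1])
      fix x :: real assume "x \<in> {0<..<1}"
      thus "y < s x" using s(1)[of x] \<open>y < 0\<close> by simp
    qed simp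
  next
    fix y :: real assume y: "0 < y"
    define t where "t = min y (R/2)"
    have t: "t \<in> {0<..<R}" "t \<le> y" using y R unfolding t_def by auto
    then obtain r0 where r0: "r0 > 0" "s r0 = t" using img by (metis greaterThan_iff imageE)
    show "\<forall>\<^sub>F x in at_right 0. s x < y"
    proof (rule eventually_at_rightI[of 0 r0])
      fix x assume "x \<in> {0<..<r0}"
      thus "s x < y" using mono[of x r0] r0 t by simp
    qed (use r0 in simp)
  qed
  have bs: "b (s r) > 0" if "r > 0" for r using b(2) s(1,2) that by simp
  have s'_pos: "s' r > 0" if "r > 0" for r using bs a(2) that by (simp add: s'_def)
  have push: "b (s r) * s' r = a r" if "r > 0" for r using bs[OF that] by (simp add: s'_def)
  show ?thesis by (rule that[OF s(1,2) der s'_pos push lim img inj])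
qed

lemma set_integral_open_closed_halfline:
  fixes f :: "real \<Rightarrow> real"
  assumes "f \<in> borel_measurable borel"
  shows "set_integrable lborel {0..} f \<longleftrightarrow> set_integrable lborel {0<..} f"
    and "(LINT x:{0..}|lborel. f x) = (LINT x:{0<..}|lborel. f x)"
proof -
  have ae: "AE x in lborel. indicator {0..} x *\<^sub>R f x = indicator {0<..} x *\<^sub>R f x"
    using AE_lborel_singleton[of 0] by eventually_elim (auto simp: indicator_def)
  have [measurable]: "f \<in> borel_measurable borel" by fact
  show "set_integrable lborel {0..} f \<longleftrightarrow> set_integrable lborel {0<..} f"
    unfolding set_integrable_def by (intro integrable_cong_AE ae) measurable
  show "(LINT x:{0..}|lborel. f x) = (LINT x:{0<..}|lborel. f x)"
    unfolding set_lebesgue_integral_def by (intro integral_cong_AE ae) measurable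
qed

lemma nn_integral_eq_set_integral:
  fixes f :: "real \<Rightarrow> real"
  assumes "set_integrable lborel A f" "\<And>x. x \<in> A \<Longrightarrow> f x \<ge> 0"
  shows "(\<integral>\<^sup>+x. ennreal (f x * indicator A x) \<partial>lborel) = ennreal (LINT x:A|lborel. f x)"
proof -
  have "integrable lborel (\<lambda>x. f x * indicator A x)"
    using assms(1) unfolding set_integrable_def by (simp add: mult.commute)
  hence "(\<integral>\<^sup>+x. ennreal (f x * indicator A x) \<partial>lborel) = ennreal (\<integral>x. f x * indicator A x \<partial>lborel)"
    by (rule nn_integral_eq_integral) (use assms(2) in \<open>auto simp: indicator_def\<close>)
  thus ?thesis unfolding set_lebesgue_integral_def by (simp add: mult.commute)
qed

lemma set_integrable_of_nn_integral_le:
  fixes f :: "real \<Rightarrow> real"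
  assumes "continuous_on A f" "A \<in> sets borel" "\<And>x. x \<in> A \<Longrightarrow> f x \<ge> 0"
    and "(\<integral>\<^sup>+x. ennreal (f x * indicator A x) \<partial>lborel) \<le> ennreal B"
  shows "set_integrable lborel A f"
  unfolding set_integrable_def
proof (rule integrableI_nonneg)
  show "(\<lambda>x. indicator A x *\<^sub>R f x) \<in> borel_measurable lborel"
    using borel_measurable_continuous_on_indicator[OF assms(2,1)] by simp
  show "AE x in lborel. 0 \<le> indicator A x *\<^sub>R f x" using assms(3) by (auto simp: indicator_def)
  have "(\<integral>\<^sup>+x. ennreal (indicator A x *\<^sub>R f x) \<partial>lborel) \<le> ennreal B"
    using assms(4) by (simp add: mult.commute)
  thus "(\<integral>\<^sup>+x. ennreal (indicator A x *\<^sub>R f x) \<partial>lborel) < \<infinity>" 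
    using ennreal_less_top order_le_less_trans by (metis infinity_ennreal_def)
qed

section \<open>Monotone transport of a radial log-concave density\<close>

text \<open>The profile \<open>v\<close> of a \<open>c\<close>-convex radial potential in dimension \<open>d + 1\<close>: the distribution
  of \<open>|x|\<close> has the density \<open>m\<close> on the half-line.\<close>
locale radial_density =
  fixes d :: nat and N c :: real and v v' :: "real \<Rightarrow> real"
  assumes N_pos: "N > 0" and c_pos: "c > 0"
    and v_deriv: "\<And>r. (v has_real_derivative v' r) (at r)"
    and v'_cont: "continuous_on UNIV v'"
    and v_convex: "\<And>r s. v r + v' r * (s - r) + c / 2 * (s - r)\<^sup>2 \<le> v s"
    and v'0: "v' 0 = 0"
    and total_mass: "(\<integral>\<^sup>+r. ennreal (N * r ^ d * exp (- v r) * indicator {0<..} r) \<partial>lborel) = 1"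
begin

definition m :: "real \<Rightarrow> real" where "m r = N * r ^ d * exp (- v r)"

lemma v_cont: "continuous_on A v"
  using DERIV_isCont[OF v_deriv] by (simp add: continuous_at_imp_continuous_on)

lemma m_cont: "continuous_on A m"
  unfolding m_def by (intro continuous_intros v_cont)

lemma m_measurable [measurable]: "m \<in> borel_measurable borel"
  using m_cont by (rule borel_measurable_continuous_onI)

lemma m_pos: "r > 0 \<Longrightarrow> m r > 0"
  unfolding m_def using N_pos by simp

lemma v'_nonneg: assumes "r \<ge> 0" shows "v' r \<ge> 0"
proof (cases "r = 0")
  case False
  have "v r + v' r * (0 - r) + c / 2 * (0 - r)\<^sup>2 \<le> v 0" "v 0 + v' 0 * (r - 0) + c / 2 * (r - 0)\<^sup>2 \<le> v r"
    by (rule v_convex)+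
  hence "c * r\<^sup>2 \<le> v' r * r" using v'0 by (simp add: field_simps)
  hence "0 \<le> v' r * r" using c_pos order_trans[of 0 "c * r\<^sup>2"] by simp
  thus ?thesis using False assms by (simp add: zero_le_mult_iff)
qed (simp add: v'0)

lemma v_mono: assumes "0 \<le> r" "r \<le> s" shows "v r \<le> v s"
proof -
  have "0 \<le> v' r * (s - r) + c / 2 * (s - r)\<^sup>2" using v'_nonneg[of r] assms c_pos by simp
  thus ?thesis using v_convex[of r s] by linarith
qed

lemma m_integrable: "set_integrable lborel {0<..} m"
  by (rule set_integrable_of_nn_integral_le[where B=1])
     (use m_cont m_pos total_mass in \<open>auto simp: m_def less_imp_le\<close>)

lemma m_integral: "(LINT r:{0<..}|lborel. m r) = 1"
proof -
  have "ennreal (LINT r:{0<..}|lborel. m r) = ennreal 1"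
    using nn_integral_eq_set_integral[OF m_integrable] total_mass m_pos unfolding m_def
    by (auto simp: less_imp_le)
  moreover have "(LINT r:{0<..}|lborel. m r) \<ge> 0"
    unfolding set_lebesgue_integral_def using m_pos by (intro integral_nonneg_AE) (auto simp: indicator_def less_imp_le)
  ultimately show ?thesis by simp
qed

lemma m_deriv: assumes "r > 0" shows "(m has_real_derivative (d / r - v' r) * m r) (at r)"
proof -
  have *: "real d * r ^ (d - 1) = d / r * r ^ d" using assms by (cases d) auto
  have "(m has_real_derivative N * (real d * r ^ (d - 1)) * exp (- v r) + N * r ^ d * (exp (- v r) * (- v' r))) (at r)"
    unfolding m_def by (auto intro!: derivative_eq_intros v_deriv)
  thus ?thesis unfolding * by (simp add: m_def algebra_simps)
qed

end

text \<open>The function \<open>l\<close> stands for the inf-convolution of \<open>\<gamma>\<close>, through the inequality \<open>dual\<close>, and \<open>s\<close> transports \<open>m\<close> to the density \<open>exp l m / Z\<close> on \<open>{0..R}\<close>.\<close>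
locale radial_transport_map = radial_density +
  fixes \<gamma> l :: "real \<Rightarrow> real" and R Z :: real and s s' :: "real \<Rightarrow> real"
  assumes R_pos: "R > 0" and Z_pos: "Z > 0"
    and l_cont: "continuous_on {0..R} l"
    and \<gamma>_int: "set_integrable lborel {0<..} (\<lambda>r. \<gamma> r * m r)"
    and dual: "\<And>r t. r > 0 \<Longrightarrow> 0 \<le> t \<Longrightarrow> t \<le> R \<Longrightarrow> l t \<le> \<gamma> r + c / 2 * (t - r)\<^sup>2"
    and Z_def: "Z = (LINT t:{0..R}|lborel. exp (l t) * m t)"
    and s_pos: "\<And>r. r > 0 \<Longrightarrow> 0 < s r" and s_less: "\<And>r. r > 0 \<Longrightarrow> s r < R"
    and s_deriv: "\<And>r. r > 0 \<Longrightarrow> (s has_real_derivative s' r) (at r)"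
    and s'_pos: "\<And>r. r > 0 \<Longrightarrow> s' r > 0"
    and push: "\<And>r. r > 0 \<Longrightarrow> exp (l (s r)) * m (s r) / Z * s' r = m r"
    and s_lim: "(s \<longlongrightarrow> 0) (at_right 0)"
    and s_image: "s ` {0<..} = {0<..<R}" and s_inj: "inj_on s {0<..}"
begin

text \<open>The differential of the radial map \<open>x \<mapsto> s |x| x / |x|\<close> has the eigenvalue \<open>s' r\<close> in the radial
  direction and \<open>s r / r\<close> in the \<open>d\<close> tangential ones. \<open>\<Phi>\<close> measures their distance to \<open>1\<close> by
  \<open>\<lambda> - 1 - ln \<lambda>\<close>, as the transport proof of the inequality does, and \<open>\<Psi>\<close> by \<open>|\<lambda> - 1|\<close>.\<close>
definition \<Phi> :: "real \<Rightarrow> real" where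
  "\<Phi> r = (s' r - 1 - ln (s' r)) + d * (s r / r - 1 - ln (s r / r))"

definition \<Psi> :: "real \<Rightarrow> real" where
  "\<Psi> r = \<bar>s' r - 1\<bar> + d * \<bar>s r / r - 1\<bar>"

definition \<Gamma> :: real where "\<Gamma> = (LINT r:{0<..}|lborel. \<gamma> r * m r)"

lemma s_cont: "continuous_on {0<..} s"
  using DERIV_isCont[OF s_deriv] by (simp add: continuous_at_imp_continuous_on)

lemma s'_eq: "r > 0 \<Longrightarrow> s' r = m r * Z / (exp (l (s r)) * m (s r))"
  using push[of r] m_pos[OF s_pos[of r]] Z_pos by (auto simp: field_simps)

lemma s'_cont: "continuous_on {0<..} s'"
proof -
  have 1: "continuous_on {0<..} (\<lambda>r. l (s r))"
    by (rule continuous_on_compose2[OF l_cont s_cont]) (use s_pos s_less in \<open>auto simp: less_imp_le\<close>)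
  have 2: "continuous_on {0<..} (\<lambda>r. m (s r))"
    by (rule continuous_on_compose2[OF m_cont s_cont]) auto
  have "continuous_on {0<..} (\<lambda>r. m r * Z / (exp (l (s r)) * m (s r)))"
    by (intro continuous_intros 1 2 m_cont) (use m_pos s_pos in force)
  thus ?thesis by (subst continuous_on_cong[OF refl s'_eq]) auto
qed

lemma s_over_r_cont: "continuous_on {0<..} (\<lambda>r. s r / r)"
  by (intro continuous_intros s_cont) auto

lemma \<Phi>m_cont: "continuous_on {0<..} (\<lambda>r. \<Phi> r * m r)"
  unfolding \<Phi>_def using s_pos s'_pos
  by (intro continuous_intros s'_cont s_over_r_cont m_cont) (auto simp: less_imp_neq[symmetric])

lemma \<Psi>m_cont: "continuous_on {0<..} (\<lambda>r. \<Psi> r * m r)"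
  unfolding \<Psi>_def by (intro continuous_intros s'_cont s_over_r_cont m_cont)

lemma \<Phi>_nonneg: assumes "r > 0" shows "\<Phi> r \<ge> 0"
proof -
  have "ln (s' r) \<le> s' r - 1" "ln (s r / r) \<le> s r / r - 1"
    using assms s_pos s'_pos by (auto intro!: ln_le_minus_one)
  thus ?thesis unfolding \<Phi>_def by simp
qed

lemma \<Psi>_nonneg: "\<Psi> r \<ge> 0" unfolding \<Psi>_def by simp

lemma \<Psi>_le_\<Phi>: assumes "r > 0" "0 < \<epsilon>" "\<epsilon> \<le> 1" shows "\<Psi> r \<le> (1 + real d) * \<epsilon> + 2 / \<epsilon> * \<Phi> r"
proof -
  have 1: "\<bar>s' r - 1\<bar> \<le> \<epsilon> + 2 * (s' r - 1 - ln (s' r)) / \<epsilon>"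
    using abs_minus_one_le_entropy[OF s'_pos[OF assms(1)] assms(2,3)] .
  have "\<bar>s r / r - 1\<bar> \<le> \<epsilon> + 2 * (s r / r - 1 - ln (s r / r)) / \<epsilon>"
    by (rule abs_minus_one_le_entropy) (use assms s_pos in auto)
  hence "d * \<bar>s r / r - 1\<bar> \<le> d * (\<epsilon> + 2 * (s r / r - 1 - ln (s r / r)) / \<epsilon>)"
    by (intro mult_left_mono) auto
  with 1 show ?thesis unfolding \<Psi>_def \<Phi>_def by (simp add: algebra_simps add_divide_distrib diff_divide_distrib)
qed

text \<open>The last summand is the derivative of \<open>(s r - r) m r\<close>, so that only a boundary term is left of it
  after integration.\<close>
lemma \<Phi>_pointwise:
  assumes r: "r > 0"
  shows "\<Phi> r * m r \<le> (\<gamma> r - ln Z) * m r + ((s' r - 1) * m r + (s r - r) * ((d / r - v' r) * m r))"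
proof -
  have lnm: "ln (m x) = ln N + d * ln x - v x" if "x > 0" for x
    unfolding m_def using that N_pos by (simp add: ln_mult ln_realpow)
  have "ln (m r) = ln (exp (l (s r)) * m (s r) / Z * s' r)" using push[OF r] by simp
  also have "\<dots> = l (s r) + ln (m (s r)) - ln Z + ln (s' r)"
    using m_pos[OF s_pos[OF r]] Z_pos s'_pos[OF r] by (simp add: ln_mult ln_div)
  finally have 1: "- ln (s' r) - d * ln (s r / r) = l (s r) - ln Z - v (s r) + v r"
    using lnm[OF r] lnm[OF s_pos[OF r]] s_pos[OF r] r by (simp add: ln_div algebra_simps)
  have "l (s r) \<le> \<gamma> r + c / 2 * (s r - r)\<^sup>2"
    using dual[of r "s r"] s_pos[OF r] s_less[OF r] r by simp
  moreover have "v r + v' r * (s r - r) + c / 2 * (s r - r)\<^sup>2 \<le> v (s r)" by (rule v_convex)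
  ultimately have "- ln (s' r) - d * ln (s r / r) \<le> \<gamma> r - ln Z - v' r * (s r - r)" using 1 by linarith
  hence "\<Phi> r \<le> (\<gamma> r - ln Z) + (s' r - 1) + d * (s r / r - 1) - v' r * (s r - r)"
    unfolding \<Phi>_def by (simp add: algebra_simps)
  also have "d * (s r / r - 1) = (s r - r) * (d / r)" using r by (simp add: field_simps)
  finally have "\<Phi> r * m r \<le> ((\<gamma> r - ln Z) + (s' r - 1) + (s r - r) * (d / r) - v' r * (s r - r)) * m r"
    using m_pos[OF r] by (intro mult_right_mono) auto
  thus ?thesis by (simp add: algebra_simps)
qed

lemma boundary_term_lim:
  "(\<lambda>k. m (inverse (real (Suc k))) * \<bar>s (inverse (real (Suc k))) - inverse (real (Suc k))\<bar>) \<longlonglongrightarrow> 0"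
proof -
  have i: "filterlim (\<lambda>k. inverse (real (Suc k))) (at_right 0) sequentially"
    using LIMSEQ_inverse_real_of_nat unfolding filterlim_at by auto
  have 1: "(\<lambda>k. s (inverse (real (Suc k)))) \<longlonglongrightarrow> 0" by (rule filterlim_compose[OF s_lim i])
  have "isCont m 0" using m_cont[of UNIV] by (simp add: continuous_on_eq_continuous_at)
  hence 2: "(\<lambda>k. m (inverse (real (Suc k)))) \<longlonglongrightarrow> m 0"
    by (rule isCont_tendsto_compose[OF _ LIMSEQ_inverse_real_of_nat])
  have "(\<lambda>k. m (inverse (real (Suc k))) * \<bar>s (inverse (real (Suc k))) - inverse (real (Suc k))\<bar>) \<longlonglongrightarrow> m 0 * \<bar>0 - 0\<bar>"
    by (intro tendsto_intros 1 2 LIMSEQ_inverse_real_of_nat)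
  thus ?thesis by simp
qed

lemma interval_halfline: "{inverse (real (Suc k))..real (Suc k)} \<subseteq> {0<..}"
proof -
  have "inverse (real (Suc k)) > 0" by simp
  thus ?thesis by (meson atLeastAtMost_iff greaterThan_iff less_le_trans subsetI)
qed

lemma inv_le: "inverse (real (Suc k)) \<le> real (Suc k)"
proof -
  have "inverse (real (Suc k)) \<le> 1" by (rule inverse_le_1_iff[THEN iffD2]) auto
  thus ?thesis by simp
qed

lemma \<Phi>_integral: "(\<integral>\<^sup>+r. ennreal (\<Phi> r * m r * indicator {0<..} r) \<partial>lborel) \<le> ennreal (\<Gamma> - ln Z)"
  and ln_Z_le: "ln Z \<le> \<Gamma>"
proof -
  define D where "D r = (s' r - 1) * m r + (s r - r) * ((d / r - v' r) * m r)" for r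
  define u where "u r = (\<gamma> r - ln Z) * m r" for r
  define A where "A k = {inverse (real (Suc k))..real (Suc k)}" for k :: nat
  define \<beta> where "\<beta> k = m (inverse (real (Suc k))) * \<bar>s (inverse (real (Suc k))) - inverse (real (Suc k))\<bar>" for k
  have sub: "A k \<subseteq> {0<..}" for k unfolding A_def by (rule interval_halfline)
  have D_cont: "continuous_on (A k) D" for k
    unfolding D_def using sub[of k]
    by (intro continuous_intros continuous_on_subset[OF s_cont] continuous_on_subset[OF s'_cont] 
        continuous_on_subset[OF v'_cont] m_cont) auto
  have D_FTC: "(LINT r:A k|lborel. D r) = (s (Suc k) - Suc k) * m (Suc k) - (s (inverse (real (Suc k))) - inverse (real (Suc k))) * m (inverse (real (Suc k)))" for k
    unfolding set_lebesgue_integral_def A_def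
  proof (rule integral_FTC_atLeastAtMost[OF inv_le])
    fix x assume "inverse (real (Suc k)) \<le> x" "x \<le> real (Suc k)"
    hence x: "x > 0" using interval_halfline[of k] by auto
    have "((\<lambda>r. (s r - r) * m r) has_real_derivative D x) (at x)"
      unfolding D_def by (auto intro!: derivative_eq_intros s_deriv[OF x] m_deriv[OF x])
    thus "((\<lambda>r. (s r - r) * m r) has_vector_derivative D x) (at x within {inverse (real (Suc k))..real (Suc k)})"
      by (simp add: has_real_derivative_iff_has_vector_derivative has_vector_derivative_at_within)
  qed (use D_cont[of k] A_def in simp)
  have u_int: "set_integrable lborel {0<..} u"
    using set_integral_diff(1)[OF \<gamma>_int set_integrable_mult_right[of "ln Z", OF m_integrable]]
    unfolding u_def by (simp add: algebra_simps)
  have u_val: "(LINT r:{0<..}|lborel. u r) = \<Gamma> - ln Z"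
    using set_integral_diff(2)[OF \<gamma>_int set_integrable_mult_right[of "ln Z", OF m_integrable]] m_integral
    unfolding u_def \<Gamma>_def by (simp add: algebra_simps)
  have uA: "set_integrable lborel (A k) u" for k
    by (rule set_integrable_subset[OF u_int]) (use sub in \<open>auto simp: A_def\<close>)
  have DA: "set_integrable lborel (A k) D" for k
    using borel_integrable_atLeastAtMost' D_cont unfolding A_def by blast
  have \<Phi>A: "set_integrable lborel (A k) (\<lambda>r. \<Phi> r * m r)" for k
    unfolding A_def by (rule borel_integrable_atLeastAtMost') (rule continuous_on_subset[OF \<Phi>m_cont interval_halfline])
  have \<beta>0: "\<beta> \<longlonglongrightarrow> 0" unfolding \<beta>_def by (rule boundary_term_lim)
    have ev: "\<forall>\<^sub>F k in sequentially. (LINT x:{inverse (Suc k)..Suc k}|lborel. \<Phi> x * m x)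
         \<le> (LINT x:{inverse (Suc k)..Suc k}|lborel. u x) + \<beta> k"
      using eventually_ge_at_top[of "nat \<lceil>R\<rceil>"]
    proof eventually_elim
      case (elim k)
      hence kR: "R \<le> Suc k" by linarith
      have "(LINT x:A k|lborel. \<Phi> x * m x) \<le> (LINT x:A k|lborel. u x + D x)"
        by (rule set_integral_mono[OF \<Phi>A set_integral_add(1)[OF uA DA]])
           (use \<Phi>_pointwise sub in \<open>auto simp: u_def D_def\<close>)
      also have "\<dots> = (LINT x:A k|lborel. u x) + (LINT x:A k|lborel. D x)"
        by (rule set_integral_add(2)[OF uA DA])
      also have "(LINT x:A k|lborel. D x) \<le> \<beta> k"
      proof -
        have "(s (Suc k) - Suc k) * m (Suc k) \<le> 0"
          \<comment> \<open>The boundary term at the right end point is nonpositive as soon as that point exceeds the bound \<open>R\<close> of \<open>s\<close>.\<close>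
          using s_less[of "Suc k"] kR m_pos[of "Suc k"] by (intro mult_nonpos_nonneg) auto
        moreover have "- ((s (inverse (real (Suc k))) - inverse (real (Suc k))) * m (inverse (real (Suc k)))) \<le> \<beta> k"
        proof -
          have "- (y * M) \<le> M * \<bar>y\<bar>" if "M > 0" for y M :: real
            using mult_left_mono[of "-y" "\<bar>y\<bar>" M] that by (simp add: mult.commute)
          thus ?thesis unfolding \<beta>_def using m_pos[of "inverse (real (Suc k))"] by (simp del: of_nat_Suc)
        qed
        ultimately show ?thesis unfolding D_FTC by linarith
      qed
      finally show ?case unfolding A_def by simp
    qed
  have nn: "\<Phi> r * m r \<ge> 0" if "r > 0" for r
    using \<Phi>_nonneg[OF that] m_pos[OF that] by simp
  note lims = nn_integral_halfline_le[OF nn \<Phi>A[unfolded A_def] u_int \<beta>0 ev, unfolded u_val]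
  show "(\<integral>\<^sup>+r. ennreal (\<Phi> r * m r * indicator {0<..} r) \<partial>lborel) \<le> ennreal (\<Gamma> - ln Z)"
    "ln Z \<le> \<Gamma>" using lims by auto
qed

lemma \<Psi>_integrable: "set_integrable lborel {0<..} (\<lambda>r. \<Psi> r * m r)"
  and \<Psi>_integral: "\<And>\<epsilon>. 0 < \<epsilon> \<Longrightarrow> \<epsilon> \<le> 1 \<Longrightarrow>
    (LINT r:{0<..}|lborel. \<Psi> r * m r) \<le> (1 + real d) * \<epsilon> + 2 / \<epsilon> * (\<Gamma> - ln Z)"
proof -
  have \<Phi>int: "set_integrable lborel {0<..} (\<lambda>r. \<Phi> r * m r)"
    by (rule set_integrable_of_nn_integral_le[OF \<Phi>m_cont _ _ \<Phi>_integral])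
       (use \<Phi>_nonneg m_pos in \<open>auto simp: less_imp_le\<close>)
  have \<Phi>le: "(LINT r:{0<..}|lborel. \<Phi> r * m r) \<le> \<Gamma> - ln Z"
  proof -
    have "ennreal (LINT r:{0<..}|lborel. \<Phi> r * m r) \<le> ennreal (\<Gamma> - ln Z)"
      using nn_integral_eq_set_integral[OF \<Phi>int] \<Phi>_nonneg m_pos \<Phi>_integral by (simp add: less_imp_le)
    thus ?thesis using ln_Z_le by (simp add: ennreal_le_iff)
  qed
  have bound: "set_integrable lborel {0<..} (\<lambda>r. (1 + real d) * \<epsilon> * m r + 2 / \<epsilon> * (\<Phi> r * m r))"
    "(LINT r:{0<..}|lborel. (1 + real d) * \<epsilon> * m r + 2 / \<epsilon> * (\<Phi> r * m r))
      = (1 + real d) * \<epsilon> + 2 / \<epsilon> * (LINT r:{0<..}|lborel. \<Phi> r * m r)" for \<epsilon>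
    using set_integral_add[OF set_integrable_mult_right[of "(1 + real d) * \<epsilon>", OF m_integrable]
        set_integrable_mult_right[of "2 / \<epsilon>", OF \<Phi>int]] m_integral by simp_all
  have le: "\<Psi> r * m r \<le> (1 + real d) * \<epsilon> * m r + 2 / \<epsilon> * (\<Phi> r * m r)"
    if "r > 0" "0 < \<epsilon>" "\<epsilon> \<le> 1" for r \<epsilon>
    using mult_right_mono[OF \<Psi>_le_\<Phi>[OF that], of "m r"] m_pos[OF that(1)] by (simp add: algebra_simps)
  show int: "set_integrable lborel {0<..} (\<lambda>r. \<Psi> r * m r)"
    unfolding set_integrable_def
  proof (rule Bochner_Integration.integrable_bound[OF bound(1)[of 1, unfolded set_integrable_def]])
    show "(\<lambda>x. indicator {0<..} x *\<^sub>R (\<Psi> x * m x)) \<in> borel_measurable lborel"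
      using borel_measurable_continuous_on_indicator[OF _ \<Psi>m_cont] by simp
    show "AE x in lborel. norm (indicator {0<..} x *\<^sub>R (\<Psi> x * m x)) \<le>
      norm (indicator {0<..} x *\<^sub>R ((1 + real d) * 1 * m x + 2 / 1 * (\<Phi> x * m x)))"
    proof (rule AE_I2)
      fix x :: real
      show "norm (indicator {0<..} x *\<^sub>R (\<Psi> x * m x)) \<le>
        norm (indicator {0<..} x *\<^sub>R ((1 + real d) * 1 * m x + 2 / 1 * (\<Phi> x * m x)))"
      proof (cases "x > 0")
        case True
        have "0 \<le> \<Psi> x * m x" using \<Psi>_nonneg m_pos[OF True] by simp
        thus ?thesis using le[OF True, of 1] True by simp
      qed simp
    qed
  qed
  show "(LINT r:{0<..}|lborel. \<Psi> r * m r) \<le> (1 + real d) * \<epsilon> + 2 / \<epsilon> * (\<Gamma> - ln Z)"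
    if "0 < \<epsilon>" "\<epsilon> \<le> 1" for \<epsilon>
  proof -
    have "(LINT r:{0<..}|lborel. \<Psi> r * m r) \<le> (LINT r:{0<..}|lborel. (1 + real d) * \<epsilon> * m r + 2 / \<epsilon> * (\<Phi> r * m r))"
      by (rule set_integral_mono[OF int bound(1)]) (use le that in auto)
    also have "\<dots> = (1 + real d) * \<epsilon> + 2 / \<epsilon> * (LINT r:{0<..}|lborel. \<Phi> r * m r)" by (rule bound(2))
    also have "\<dots> \<le> (1 + real d) * \<epsilon> + 2 / \<epsilon> * (\<Gamma> - ln Z)"
      using \<Phi>le that by (intro add_left_mono mult_left_mono) auto
    finally show ?thesis .
  qed
qed

end

context radial_transport_map begin

text \<open>The functions \<open>P\<close>, \<open>h\<close> and \<open>q\<close> deal with the region where \<open>s\<close> moves mass outwards.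
  There \<open>q\<close> is the loss caused by the factor \<open>exp (- v)\<close>, which \<open>\<Psi>\<close> does not control pointwise.\<close>
definition P :: "real \<Rightarrow> real" where "P t = integral {0..t} (\<lambda>x. exp (- v x))"

lemma P_deriv: assumes "t > 0" shows "(P has_real_derivative exp (- v t)) (at t)"
  by (rule primitive_on_interval(2)[where B="t+1"])
     (use assms in \<open>auto intro!: continuous_intros v_cont simp: P_def\<close>)

lemma P_mono: assumes "0 \<le> x" "x < y" shows "P x < P y"
  by (rule primitive_on_interval(3)[where B=y and k="\<lambda>x. exp (- v x)"])
     (use assms in \<open>auto intro!: continuous_intros v_cont simp: P_def\<close>)

lemma P_diff_le: assumes "0 < x" "0 < y" shows "P y - P x \<le> exp (- v x) * (y - x)"
proof (cases x y rule: linorder_cases)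
  case less
  obtain \<xi> where \<xi>: "x < \<xi>" "\<xi> < y" "P y - P x = (y - x) * exp (- v \<xi>)"
    using MVT2[OF less, of P "\<lambda>t. exp (- v t)"] P_deriv assms by auto
  thus ?thesis using v_mono[of x \<xi>] assms by simp
next
  case greater
  obtain \<xi> where \<xi>: "y < \<xi>" "\<xi> < x" "P x - P y = (x - y) * exp (- v \<xi>)"
    using MVT2[OF greater, of P "\<lambda>t. exp (- v t)"] P_deriv assms by auto
  have "(x - y) * exp (- v x) \<le> (x - y) * exp (- v \<xi>)"
    using v_mono[of \<xi> x] \<xi> assms by (intro mult_left_mono) auto
  thus ?thesis using \<xi>(3) by (simp add: algebra_simps)
qed simp

definition h :: "real \<Rightarrow> real" where "h r = N * r ^ d * (P (s r) - P r)"

definition h' :: "real \<Rightarrow> real" where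
  "h' r = N * (d / r * r ^ d) * (P (s r) - P r) + N * r ^ d * (exp (- v (s r)) * s' r - exp (- v r))"

lemma h_deriv: assumes r: "r > 0" shows "(h has_real_derivative h' r) (at r)"
proof -
  have *: "real d * r ^ (d - 1) = d / r * r ^ d" using assms by (cases d) auto
  have Ps: "((\<lambda>r. P (s r)) has_real_derivative exp (- v (s r)) * s' r) (at r)"
    using DERIV_chain2[OF P_deriv[OF s_pos[OF r]] s_deriv[OF r]] .
  have "(h has_real_derivative N * (real d * r ^ (d - 1)) * (P (s r) - P r) + N * r ^ d * (exp (- v (s r)) * s' r - exp (- v r))) (at r)"
    unfolding h_def by (auto intro!: derivative_eq_intros Ps P_deriv[OF r])
  thus ?thesis unfolding * h'_def .
qed

lemma h_sgn: assumes "r > 0" shows "sgn (h r) = sgn (s r - r)"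
proof -
  have "N * r ^ d > 0" using N_pos assms by simp
  moreover have "sgn (P (s r) - P r) = sgn (s r - r)"
    using P_mono[of r "s r"] P_mono[of "s r" r] s_pos[OF assms] assms
    by (cases r "s r" rule: linorder_cases) auto
  ultimately show ?thesis unfolding h_def
    using sgn_mult[of "N * r ^ d" "P (s r) - P r"] by (simp only: sgn_pos mult_1_left)
qed

lemma h'_cont: "continuous_on {0<..} h'"
proof -
  have Pc: "continuous_on {0<..} P"
    using DERIV_isCont[OF P_deriv] by (simp add: continuous_at_imp_continuous_on)
  have 1: "continuous_on {0<..} (\<lambda>r. P (s r))"
    by (rule continuous_on_compose2[OF Pc s_cont]) (use s_pos in auto)
  have 2: "continuous_on {0<..} (\<lambda>r. v (s r))"
    by (rule continuous_on_compose2[OF v_cont s_cont]) auto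
  show ?thesis unfolding h'_def by (intro continuous_intros 1 2 Pc s'_cont v_cont) auto
qed

definition q :: "real \<Rightarrow> real" where
  "q r = N * r ^ d * max 0 (exp (- v r) - exp (- v (s r)))"

lemma q_nonneg: "r > 0 \<Longrightarrow> q r \<ge> 0"
  unfolding q_def using N_pos by simp

lemma q_cont: "continuous_on {0<..} q"
  unfolding q_def by (intro continuous_intros v_cont continuous_on_compose2[OF v_cont s_cont]) auto

text \<open>Where \<open>s r > r\<close>, differentiating \<open>h\<close> gives \<open>- q\<close>, a term with the factor \<open>s' r - 1\<close>, and one with
  \<open>d / r (P (s r) - P r) \<le> d exp (- v r) (s r / r - 1)\<close>. Comparing with \<open>N r\<^sup>d P\<close> instead of the mass
  of \<open>m\<close> keeps the Jacobian \<open>s' (s / r)\<^sup>d\<close> out of the estimate; such a product of eigenvalues would not be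
  controlled by \<open>\<Psi>\<close>.\<close>
lemma q_pointwise: assumes r: "r > 0" shows "q r \<le> \<Psi> r * m r - (1 + sgn (h r)) / 2 * h' r"
proof (cases r "s r" rule: linorder_cases)
  case less
  define K where "K = N * r ^ d"
  have K: "K > 0" unfolding K_def using N_pos r by simp
  have e: "exp (- v (s r)) \<le> exp (- v r)" using v_mono[of r "s r"] less r by simp
  have q: "q r = K * (exp (- v r) - exp (- v (s r)))" unfolding q_def K_def using e by simp
  have 1: "exp (- v (s r)) * (s' r - 1) \<le> exp (- v r) * \<bar>s' r - 1\<bar>"
    by (rule order_trans[OF mult_left_mono mult_right_mono[OF e]]) auto
  have "d / r * (P (s r) - P r) \<le> d / r * (exp (- v r) * (s r - r))"
    using P_diff_le[OF r s_pos[OF r]] r by (intro mult_left_mono) auto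
  also have "\<dots> = exp (- v r) * (d * (s r / r - 1))" using r by (simp add: field_simps)
  also have "\<dots> \<le> exp (- v r) * (d * \<bar>s r / r - 1\<bar>)" by (intro mult_left_mono) auto
  finally have 2: "d / r * (P (s r) - P r) \<le> exp (- v r) * (d * \<bar>s r / r - 1\<bar>)" .
  have "K * (d / r * (P (s r) - P r) + exp (- v (s r)) * (s' r - 1)) \<le> K * (exp (- v r) * (d * \<bar>s r / r - 1\<bar>) + exp (- v r) * \<bar>s' r - 1\<bar>)"
    using 1 2 K by (intro mult_left_mono add_mono) auto
  also have "\<dots> = \<Psi> r * m r" unfolding \<Psi>_def m_def K_def by (simp add: algebra_simps)
  also have "K * (d / r * (P (s r) - P r) + exp (- v (s r)) * (s' r - 1)) = q r + h' r"
    unfolding q h'_def K_def by (simp add: algebra_simps diff_divide_distrib)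
  finally show ?thesis using h_sgn[OF r] less by simp
next
  case equal
  have "h' r = m r * (s' r - 1)" unfolding h'_def m_def equal[symmetric] by (simp add: algebra_simps)
  also have "\<dots> \<le> m r * \<Psi> r" unfolding \<Psi>_def using m_pos[OF r] 
    by (intro mult_left_mono) (auto intro: order_trans[OF abs_ge_self])
  finally have "h' r \<le> \<Psi> r * m r" by (simp add: mult.commute)
  moreover have "0 \<le> \<Psi> r * m r" using \<Psi>_nonneg m_pos[OF r] by simp
  moreover have "q r = 0" unfolding q_def equal[symmetric] by simp
  moreover have "sgn (h r) = 0" using h_sgn[OF r] equal by simp
  ultimately show ?thesis by simp
next
  case greater
  have "q r = 0" unfolding q_def using v_mono[of "s r" r] s_pos[OF r] greater by simp
  moreover have "0 \<le> \<Psi> r * m r" using \<Psi>_nonneg m_pos[OF r] by simp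
  moreover have "sgn (h r) = -1" using h_sgn[OF r] greater by simp
  ultimately show ?thesis by simp
qed

lemma q_integral: "(\<integral>\<^sup>+r. ennreal (q r * indicator {0<..} r) \<partial>lborel) \<le> ennreal (LINT r:{0<..}|lborel. \<Psi> r * m r)"
proof -
  define A where "A k = {inverse (real (Suc k))..real (Suc k)}" for k :: nat
  define \<beta> where "\<beta> k = m (inverse (real (Suc k))) * \<bar>s (inverse (real (Suc k))) - inverse (real (Suc k))\<bar>" for k
  define W where "W r = (1 + sgn (h r)) / 2 * h' r" for r
  have sub: "A k \<subseteq> {0<..}" for k unfolding A_def by (rule interval_halfline)
  have qA: "set_integrable lborel (A k) q" for k
    unfolding A_def by (rule borel_integrable_atLeastAtMost') (rule continuous_on_subset[OF q_cont interval_halfline])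
  have \<Psi>A: "set_integrable lborel (A k) (\<lambda>r. \<Psi> r * m r)" for k
    by (rule set_integrable_subset[OF \<Psi>_integrable]) (use sub in \<open>auto simp: A_def\<close>)
  have h_derA: "(h has_real_derivative h' x) (at x)" if "inverse (real (Suc k)) \<le> x" "x \<le> real (Suc k)" for x k
    by (rule h_deriv) (use that interval_halfline[of k] in auto)
  have h'_contA: "continuous_on {inverse (real (Suc k))..real (Suc k)} h'" for k
    by (rule continuous_on_subset[OF h'_cont interval_halfline])
  have W: "(LINT r:A k|lborel. W r) = max (h (Suc k)) 0 - max (h (inverse (real (Suc k)))) 0"
    "set_integrable lborel (A k) W" for k
    unfolding W_def A_def using FTC_positive_part[OF inv_le h_derA h'_contA] by auto
  have \<beta>0: "\<beta> \<longlonglongrightarrow> 0" unfolding \<beta>_def by (rule boundary_term_lim)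
  have ev: "\<forall>\<^sub>F k in sequentially. (LINT x:{inverse (Suc k)..Suc k}|lborel. q x)
         \<le> (LINT x:{inverse (Suc k)..Suc k}|lborel. \<Psi> x * m x) + \<beta> k"
  proof (rule always_eventually, rule allI)
    fix k
    define a where "a = inverse (real (Suc k))"
    have a: "a > 0" unfolding a_def by simp
    have "(LINT x:A k|lborel. q x) \<le> (LINT x:A k|lborel. \<Psi> x * m x - W x)"
      by (rule set_integral_mono[OF qA set_integral_diff(1)[OF \<Psi>A W(2)]])
         (use q_pointwise sub in \<open>auto simp: W_def\<close>)
    moreover have "(LINT x:A k|lborel. \<Psi> x * m x - W x) = (LINT x:A k|lborel. \<Psi> x * m x) - (LINT x:A k|lborel. W x)"
      by (rule set_integral_diff(2)[OF \<Psi>A W(2)])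
    moreover have "- (LINT x:A k|lborel. W x) \<le> max (h a) 0" unfolding W a_def by simp
    moreover have "max (h a) 0 \<le> \<beta> k"
    proof -
      have "h a \<le> N * a ^ d * (exp (- v a) * (s a - a))"
        unfolding h_def using P_diff_le[OF a s_pos[OF a]] N_pos a by (intro mult_left_mono) auto
      also have "\<dots> = m a * (s a - a)" unfolding m_def by simp
      also have "\<dots> \<le> m a * \<bar>s a - a\<bar>" using m_pos[OF a] by (intro mult_left_mono) auto
      finally show ?thesis unfolding \<beta>_def a_def[symmetric] using m_pos[OF a] by simp
    qed
    ultimately show "(LINT x:{inverse (Suc k)..Suc k}|lborel. q x)
         \<le> (LINT x:{inverse (Suc k)..Suc k}|lborel. \<Psi> x * m x) + \<beta> k"
      unfolding A_def by linarith
  qed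
  show ?thesis
    using nn_integral_halfline_le(1)[OF q_nonneg qA[unfolded A_def] \<Psi>_integrable \<beta>0 ev] by simp
qed

text \<open>The part of \<open>m\<close> that exceeds the density \<open>m (s r) s' r\<close>, which \<open>s\<close> transports to the
  restriction of \<open>m\<close> to \<open>{0<..<R}\<close>. Its integral is half of the total variation, by the substitution
  \<open>t = s r\<close>.\<close>
definition p :: "real \<Rightarrow> real" where "p r = max 0 (m r - m (s r) * s' r)"

lemma p_cont: "continuous_on {0<..} p"
  unfolding p_def by (intro continuous_intros m_cont s'_cont continuous_on_compose2[OF m_cont s_cont]) auto

text \<open>For \<open>s r \<le> r\<close> the monotonicity of \<open>v\<close> reduces the claim to \<open>1 - s' r (s r / r)\<^sup>d \<le> \<Psi> r\<close>, which is
  Bernoulli's inequality; for \<open>s r > r\<close> the factor \<open>(s r / r)\<^sup>d \<ge> 1\<close> can be dropped, at the price of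
  \<open>q\<close>.\<close>
lemma p_le: assumes r: "r > 0" shows "p r \<le> q r + \<Psi> r * m r"
proof -
  have nn: "0 \<le> q r + \<Psi> r * m r" using q_nonneg[OF r] \<Psi>_nonneg m_pos[OF r] by simp
  define \<kappa> where "\<kappa> = (s r / r) ^ d"
  have \<kappa>: "\<kappa> > 0" unfolding \<kappa>_def using s_pos[OF r] r by simp
  have ms: "m (s r) * s' r = N * r ^ d * (exp (- v (s r)) * (\<kappa> * s' r))"
    unfolding m_def \<kappa>_def using r by (simp add: power_divide)
  have "m r - m (s r) * s' r \<le> q r + \<Psi> r * m r"
  proof (cases "r \<le> s r")
    case True
    have e: "exp (- v (s r)) \<le> exp (- v r)" using v_mono[of r "s r"] True r by simp
    have "\<kappa> \<ge> 1" unfolding \<kappa>_def using True r by (intro one_le_power) simp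
    hence "s' r \<le> \<kappa> * s' r" using s'_pos[OF r] by simp
    hence "exp (- v (s r)) * s' r \<le> exp (- v (s r)) * (\<kappa> * s' r)" by simp
    moreover have "exp (- v (s r)) * (1 - s' r) \<le> exp (- v r) * \<bar>s' r - 1\<bar>"
      by (rule order_trans[OF mult_left_mono mult_right_mono[OF e]]) auto
    ultimately have "exp (- v r) - exp (- v (s r)) * (\<kappa> * s' r) \<le> (exp (- v r) - exp (- v (s r))) + exp (- v r) * \<bar>s' r - 1\<bar>"
      by (simp add: algebra_simps)
    also have "\<dots> \<le> max 0 (exp (- v r) - exp (- v (s r))) + exp (- v r) * \<Psi> r"
      unfolding \<Psi>_def by (intro add_mono mult_left_mono) auto
    finally have "N * r ^ d * (exp (- v r) - exp (- v (s r)) * (\<kappa> * s' r)) \<le> N * r ^ d * (max 0 (exp (- v r) - exp (- v (s r))) + exp (- v r) * \<Psi> r)"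
      using N_pos r by (intro mult_left_mono) auto
    thus ?thesis unfolding ms unfolding q_def m_def by (simp add: algebra_simps)
  next
    case False
    hence sr: "s r < r" by simp
    have "exp (- v r) \<le> exp (- v (s r))" using v_mono[of "s r" r] s_pos[OF r] sr by simp
    hence "exp (- v r) * (\<kappa> * s' r) \<le> exp (- v (s r)) * (\<kappa> * s' r)"
      using \<kappa> s'_pos[OF r] by (intro mult_right_mono) auto
    hence 1: "exp (- v r) - exp (- v (s r)) * (\<kappa> * s' r) \<le> exp (- v r) * (1 - \<kappa> * s' r)"
      by (simp add: algebra_simps)
    have \<kappa>1: "\<kappa> \<le> 1" unfolding \<kappa>_def using sr r s_pos[OF r] by (intro power_le_one) auto
    have B: "1 - \<kappa> \<le> d * \<bar>s r / r - 1\<bar>"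
    proof -
      have "s r / r \<ge> 0" using s_pos[OF r] r by simp
      hence "1 + real d * (s r / r - 1) \<le> (1 + (s r / r - 1)) ^ d" by (intro Bernoulli_inequality) simp
      hence "1 - \<kappa> \<le> d * - (s r / r - 1)" unfolding \<kappa>_def by (simp add: algebra_simps)
      also have "\<dots> \<le> d * \<bar>s r / r - 1\<bar>" by (intro mult_left_mono) (simp_all add: abs_ge_minus_self)
      finally show ?thesis .
    qed
    have "1 - \<kappa> * s' r \<le> \<Psi> r"
    proof (cases "s' r \<le> 1")
      case True
      have "1 - \<kappa> * s' r = (1 - s' r) + s' r * (1 - \<kappa>)" by (simp add: algebra_simps)
      also have "\<dots> \<le> \<bar>s' r - 1\<bar> + 1 * (1 - \<kappa>)"
        using True \<kappa>1 by (intro add_mono mult_right_mono) auto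
      finally show ?thesis unfolding \<Psi>_def using B by simp
    next
      case False
      have "1 - \<kappa> * s' r \<le> 1 - \<kappa> * 1" using False \<kappa> by (intro diff_left_mono mult_left_mono) auto
      thus ?thesis unfolding \<Psi>_def using B by simp
    qed
    hence "exp (- v r) * (1 - \<kappa> * s' r) \<le> exp (- v r) * \<Psi> r" by simp
    with 1 have "exp (- v r) - exp (- v (s r)) * (\<kappa> * s' r) \<le> exp (- v r) * \<Psi> r" by linarith
    hence "N * r ^ d * (exp (- v r) - exp (- v (s r)) * (\<kappa> * s' r)) \<le> N * r ^ d * (exp (- v r) * \<Psi> r)"
      using N_pos r by (intro mult_left_mono) auto
    hence "m r - m (s r) * s' r \<le> \<Psi> r * m r" unfolding ms unfolding m_def by (simp add: algebra_simps)
    thus ?thesis using q_nonneg[OF r] by simp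
  qed
  thus ?thesis unfolding p_def using nn by simp
qed

lemma p_integral: "set_integrable lborel {0<..} p"
  "(LINT r:{0<..}|lborel. p r) \<le> 2 * (LINT r:{0<..}|lborel. \<Psi> r * m r)"
proof -
  have qint: "set_integrable lborel {0<..} q"
    by (rule set_integrable_of_nn_integral_le[OF q_cont _ _ q_integral]) (use q_nonneg in auto)
  have \<Psi>nn: "0 \<le> (LINT r:{0<..}|lborel. \<Psi> r * m r)"
    unfolding set_lebesgue_integral_def
    by (rule Bochner_Integration.integral_nonneg) (use \<Psi>_nonneg m_pos in \<open>auto simp: indicator_def less_imp_le\<close>)
  have "ennreal (LINT r:{0<..}|lborel. q r) \<le> ennreal (LINT r:{0<..}|lborel. \<Psi> r * m r)"
    using nn_integral_eq_set_integral[OF qint] q_nonneg q_integral by simp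
  hence qle: "(LINT r:{0<..}|lborel. q r) \<le> (LINT r:{0<..}|lborel. \<Psi> r * m r)"
    using \<Psi>nn by (simp add: ennreal_le_iff)
  note sum = set_integral_add[OF qint \<Psi>_integrable]
  show int: "set_integrable lborel {0<..} p"
    unfolding set_integrable_def
  proof (rule Bochner_Integration.integrable_bound[OF sum(1)[unfolded set_integrable_def]])
    show "(\<lambda>x. indicator {0<..} x *\<^sub>R p x) \<in> borel_measurable lborel"
      using borel_measurable_continuous_on_indicator[OF _ p_cont] by simp
    show "AE x in lborel. norm (indicator {0<..} x *\<^sub>R p x) \<le> norm (indicator {0<..} x *\<^sub>R (q x + \<Psi> x * m x))"
    proof (rule AE_I2)
      fix x :: real
      have "0 \<le> p x" unfolding p_def by simp
      thus "norm (indicator {0<..} x *\<^sub>R p x) \<le> norm (indicator {0<..} x *\<^sub>R (q x + \<Psi> x * m x))"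
        using p_le[of x] by (auto simp: indicator_def)
    qed
  qed
  have "(LINT r:{0<..}|lborel. p r) \<le> (LINT r:{0<..}|lborel. q r + \<Psi> r * m r)"
    by (rule set_integral_mono[OF int sum(1)]) (use p_le in auto)
  thus "(LINT r:{0<..}|lborel. p r) \<le> 2 * (LINT r:{0<..}|lborel. \<Psi> r * m r)"
    using sum(2) qle by simp
qed

lemma total_variation:
  "(\<integral>\<^sup>+r. ennreal (\<bar>1 - indicator {0..R} r * exp (l r) / Z\<bar> * m r * indicator {0<..} r) \<partial>lborel)
    = ennreal (2 * (LINT r:{0<..}|lborel. p r))"
proof -
  define f where "f r = indicator {0..R} r * exp (l r) / Z" for r
  have em_cont: "continuous_on {0..R} (\<lambda>t. exp (l t) * m t)"
    by (intro continuous_intros l_cont m_cont)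
  have fm_ind: "indicator {0<..} r *\<^sub>R (f r * m r) = (1 / Z) * (indicator {0<..R} r *\<^sub>R (exp (l r) * m r))" for r
    unfolding f_def by (auto simp: indicator_def)
  have emR: "set_integrable lborel {0..R} (\<lambda>t. exp (l t) * m t)"
    by (rule borel_integrable_atLeastAtMost'[OF em_cont])
  have emR': "set_integrable lborel {0<..R} (\<lambda>t. exp (l t) * m t)"
    by (rule set_integrable_subset[OF emR]) auto
  have Z2: "(LINT t:{0<..R}|lborel. exp (l t) * m t) = Z"
    unfolding Z_def set_lebesgue_integral_def
  proof (rule integral_cong_AE)
    show "AE x in lborel. indicator {0<..R} x *\<^sub>R (exp (l x) * m x) = indicator {0..R} x *\<^sub>R (exp (l x) * m x)"
      using AE_lborel_singleton[of 0] by eventually_elim (auto simp: indicator_def)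
  qed (use emR emR' in \<open>auto simp: set_integrable_def\<close>)
  have fm: "set_integrable lborel {0<..} (\<lambda>r. f r * m r)" "(LINT r:{0<..}|lborel. f r * m r) = 1"
    unfolding set_integrable_def set_lebesgue_integral_def fm_ind
    using emR' Z2 Z_pos by (auto simp: set_integrable_def set_lebesgue_integral_def)
  define w where "w r = max 0 (f r - 1) * m r" for r
  have fm_meas: "(\<lambda>x. indicator {0<..} x *\<^sub>R (f x * m x - m x)) \<in> borel_measurable lborel"
    using set_integral_diff(1)[OF fm(1) m_integrable] unfolding set_integrable_def by auto
  have w_alt: "indicator {0<..} x *\<^sub>R w x = max 0 (indicator {0<..} x *\<^sub>R (f x * m x - m x))" for x
  proof (cases "x > 0")
    case True
    have "max 0 (f x - 1) * m x = max 0 ((f x - 1) * m x)"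
      using m_pos[OF True] by (auto simp: max_def mult_le_0_iff zero_le_mult_iff)
    thus ?thesis using True unfolding w_def by (simp add: algebra_simps)
  qed simp
  have w_int: "set_integrable lborel {0<..} w"
    unfolding set_integrable_def w_alt
    by (intro integrable_max set_integral_diff(1)[OF fm(1) m_integrable, unfolded set_integrable_def]) simp
  have eq: "\<bar>1 - f r\<bar> * m r = 2 * w r + (m r - f r * m r)" for r
    unfolding w_def by (auto simp: max_def abs_if algebra_simps)
  have "(LINT r:{0<..}|lborel. \<bar>1 - f r\<bar> * m r) = 2 * (LINT r:{0<..}|lborel. w r)"
    "set_integrable lborel {0<..} (\<lambda>r. \<bar>1 - f r\<bar> * m r)"
    unfolding eq
    using set_integral_add[OF set_integrable_mult_right[of 2, OF w_int] set_integral_diff(1)[OF m_integrable fm(1)]]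
      set_integral_diff(2)[OF m_integrable fm(1)] m_integral fm(2) by simp_all
  hence 1: "(\<integral>\<^sup>+r. ennreal (\<bar>1 - f r\<bar> * m r * indicator {0<..} r) \<partial>lborel) = ennreal (2 * (LINT r:{0<..}|lborel. w r))"
    using nn_integral_eq_set_integral[of "{0<..}" "\<lambda>r. \<bar>1 - f r\<bar> * m r"] m_pos by (simp add: less_imp_le)
  have "(LINT r:{0<..}|lborel. w r) = (LINT r:{0<..<R}|lborel. w r)"
    unfolding set_lebesgue_integral_def
  proof (rule integral_cong_AE)
    show "AE x in lborel. indicator {0<..} x *\<^sub>R w x = indicator {0<..<R} x *\<^sub>R w x"
      using AE_lborel_singleton[of R] by eventually_elim (auto simp: indicator_def w_def f_def)
    show "(\<lambda>x. indicator {0<..<R} x *\<^sub>R w x) \<in> borel_measurable lborel"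
    proof -
      have "set_integrable lborel {0<..<R} w" by (rule set_integrable_subset[OF w_int]) auto
      thus ?thesis unfolding set_integrable_def by (rule borel_measurable_integrable)
    qed
  qed (use w_int in \<open>auto simp: set_integrable_def\<close>)
  also have "\<dots> = integral {0<..<R} w"
    by (rule set_borel_integral_eq_integral(2)[OF set_integrable_subset[OF w_int]]) auto
  also have "\<dots> = integral {0<..} p"
  proof -
    have wR: "w integrable_on {0<..<R}"
      by (rule set_borel_integral_eq_integral(1)[OF set_integrable_subset[OF w_int]]) auto
    have "w absolutely_integrable_on {0<..<R}"
      by (rule nonnegative_absolutely_integrable_1[OF wR]) (use m_pos in \<open>auto simp: w_def less_imp_le\<close>)
    hence "w absolutely_integrable_on (s ` {0<..}) \<and> integral (s ` {0<..}) w = integral {0<..<R} w"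
      unfolding s_image by simp
    hence "integral {0<..} (\<lambda>x. \<bar>s' x\<bar> * w (s x)) = integral {0<..<R} w"
      using has_absolute_integral_change_of_variables_1'[of "{0<..}" s s' w "integral {0<..<R} w"] s_deriv s_inj
      by (auto intro: has_field_derivative_at_within)
    moreover have "\<bar>s' r\<bar> * w (s r) = p r" if r: "r > 0" for r
    proof -
      have "f (s r) * m (s r) * s' r = m r"
        using push[OF r] s_pos[OF r] s_less[OF r] unfolding f_def by (simp add: mult.commute mult.left_commute)
      moreover have "max 0 (f (s r) - 1) * (m (s r) * s' r) = max 0 ((f (s r) - 1) * (m (s r) * s' r))"
        using m_pos[OF s_pos[OF r]] s'_pos[OF r] by (auto simp: max_def mult_le_0_iff zero_le_mult_iff)
      ultimately show ?thesis unfolding p_def w_def using s'_pos[OF r] by (simp add: algebra_simps)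
    qed
    ultimately show ?thesis by (metis (no_types, lifting) greaterThan_iff integral_cong)
  qed
  also have "\<dots> = (LINT r:{0<..}|lborel. p r)"
    by (rule set_borel_integral_eq_integral(2)[symmetric, OF p_integral(1)])
  finally show ?thesis using 1 unfolding f_def by simp
qed

lemma transport_stability:
  assumes "0 < \<epsilon>" "\<epsilon> \<le> 1"
  shows "(\<integral>\<^sup>+r. ennreal (\<bar>1 - indicator {0..R} r * exp (l r) / Z\<bar> * m r * indicator {0<..} r) \<partial>lborel)
    \<le> ennreal (4 * ((1 + real d) * \<epsilon> + 2 / \<epsilon> * (\<Gamma> - ln Z)))"
proof -
  have "2 * a \<le> 4 * x" if "a \<le> 2 * b" "b \<le> x" for a b x :: real using that by simp
  from this[OF p_integral(2) \<Psi>_integral[OF assms]] show ?thesis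
    unfolding total_variation by (rule ennreal_leI)
qed

end

text \<open>Taking \<open>R\<close> inside the interval where the inf-convolution is finite makes \<open>l\<close> continuous up to
  the end points, so that the monotone transport is smooth, and makes \<open>Z\<close> finite.\<close>
lemma (in radial_density) stability_on_interval:
  fixes \<gamma> l :: "real \<Rightarrow> real"
  assumes R: "R > 0"
    and l_cont: "continuous_on {0..R} l"
    and \<gamma>_int: "set_integrable lborel {0<..} (\<lambda>r. \<gamma> r * m r)"
    and dual: "\<And>r t. r > 0 \<Longrightarrow> 0 \<le> t \<Longrightarrow> t \<le> R \<Longrightarrow> l t \<le> \<gamma> r + c / 2 * (t - r)\<^sup>2"
  defines "Z \<equiv> (LINT t:{0..R}|lborel. exp (l t) * m t)"
    and "J \<equiv> (LINT r:{0<..}|lborel. \<gamma> r * m r)"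
  shows "Z > 0" and "ln Z \<le> J"
    and "\<And>\<epsilon>. 0 < \<epsilon> \<Longrightarrow> \<epsilon> \<le> 1 \<Longrightarrow>
      (\<integral>\<^sup>+r. ennreal (\<bar>1 - indicator {0..R} r * exp (l r) / Z\<bar> * m r * indicator {0<..} r) \<partial>lborel)
        \<le> ennreal (4 * ((1 + real d) * \<epsilon> + 2 / \<epsilon> * (J - ln Z)))"
proof -
  have em_cont: "continuous_on {0..R} (\<lambda>t. exp (l t) * m t)"
    by (intro continuous_intros l_cont m_cont)
  have em_pos: "exp (l t) * m t > 0" if "0 < t" "t < R" for t using m_pos that by simp
  define E where "E = (\<lambda>t. integral {0..t} (\<lambda>t. exp (l t) * m t))"
  have "E 0 < E R" by (rule primitive_on_interval(3)[OF em_cont em_pos E_def]) (use R in auto)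
  moreover have "E R = Z" unfolding Z_def by (rule primitive_on_interval(5)[OF em_cont em_pos E_def]) (use R in auto)
  ultimately show Z: "Z > 0" unfolding E_def by simp
  have bint: "(LINT t:{0..R}|lborel. exp (l t) * m t / Z) = 1"
    using Z unfolding Z_def by simp
  obtain s s' where ss: "\<And>r. r > 0 \<Longrightarrow> 0 < s r" "\<And>r. r > 0 \<Longrightarrow> s r < R"
    "\<And>r. r > 0 \<Longrightarrow> (s has_real_derivative s' r) (at r)"
    "\<And>r. r > 0 \<Longrightarrow> s' r > 0"
    "\<And>r. r > 0 \<Longrightarrow> exp (l (s r)) * m (s r) / Z * s' r = m r"
    "(s \<longlongrightarrow> 0) (at_right 0)"
    "s ` {0<..} = {0<..<R}" "inj_on s {0<..}"
  proof (rule monotone_transport_exists[of R m "\<lambda>t. exp (l t) * m t / Z"])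
    show "set_integrable lborel {0..} m"
      using m_integrable set_integral_open_closed_halfline(1)[of m] by simp
    show "(LINT r:{0..}|lborel. m r) = (LINT t:{0..R}|lborel. exp (l t) * m t / Z)"
      using m_integral set_integral_open_closed_halfline(2)[of m] bint by simp
    show "continuous_on {0..R} (\<lambda>t. exp (l t) * m t / Z)"
      using Z by (intro continuous_intros em_cont) auto
  qed (use R m_pos m_cont Z in auto)
  interpret radial_transport_map d N c v v' \<gamma> l R Z s s'
    by unfold_locales (fact R Z l_cont \<gamma>_int dual ss | simp add: Z_def)+
  show "ln Z \<le> J" using ln_Z_le unfolding \<Gamma>_def J_def .
  show "(\<integral>\<^sup>+r. ennreal (\<bar>1 - indicator {0..R} r * exp (l r) / Z\<bar> * m r * indicator {0<..} r) \<partial>lborel)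
        \<le> ennreal (4 * ((1 + real d) * \<epsilon> + 2 / \<epsilon> * (J - ln Z)))" if "0 < \<epsilon>" "\<epsilon> \<le> 1" for \<epsilon>
    using transport_stability[OF that] unfolding \<Gamma>_def J_def .
qed

section \<open>Stability on the half-line\<close>

text \<open>The exceptional point \<open>b\<close> is the supremum of \<open>D\<close>, which may or may not belong to \<open>D\<close>.\<close>
lemma exhausting_radii:
  fixes D :: "real set"
  assumes "t0 \<in> D" "t0 > 0"
  obtains \<rho> :: "nat \<Rightarrow> real" and b where "incseq \<rho>" "\<And>k. \<rho> k > 0" "\<And>k. \<exists>R'\<in>D. R' > \<rho> k"
    "\<And>t. t \<in> D \<Longrightarrow> t \<noteq> b \<Longrightarrow> \<exists>k. t \<le> \<rho> k"
proof (cases "bdd_above D")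
  case False
  show ?thesis
  proof (rule that[of "\<lambda>k. real (Suc k)" 0])
    show "incseq (\<lambda>k. real (Suc k))" by (auto intro: incseq_SucI)
    show "\<exists>R'\<in>D. R' > real (Suc k)" for k using False by (force simp: bdd_above_def not_le)
    show "\<exists>k. t \<le> real (Suc k)" for t
    proof -
      obtain n :: nat where "t \<le> real n" using real_arch_simple by blast
      thus ?thesis by (intro exI[of _ n]) simp
    qed
  qed auto
next
  case True
  define b where "b = Sup D"
  have b: "b > 0" using cSup_upper[OF assms(1) True] assms(2) unfolding b_def by linarith
  define \<rho> where "\<rho> k = b * (1 - inverse (real (Suc (Suc k))))" for k
  have i: "0 < inverse (real (Suc (Suc k)))" "inverse (real (Suc (Suc k))) < 1" for k
    by (auto simp: inverse_less_1_iff)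
  show ?thesis
  proof (rule that[of \<rho> b])
    show "incseq \<rho>" unfolding \<rho>_def using b
      by (intro incseq_SucI mult_left_mono diff_left_mono le_imp_inverse_le) auto
    show "\<rho> k > 0" for k unfolding \<rho>_def using b i[of k] by simp
    show "\<exists>R'\<in>D. R' > \<rho> k" for k
    proof -
      have "b * (1 - inverse (real (Suc (Suc k)))) < b * 1" using b i[of k] by (intro mult_strict_left_mono) linarith+
      hence "\<rho> k < b" unfolding \<rho>_def by simp
      thus ?thesis using less_cSup_iff[OF _ True, of "\<rho> k"] assms unfolding b_def by auto
    qed
    show "\<exists>k. t \<le> \<rho> k" if "t \<in> D" "t \<noteq> b" for t
    proof -
      have "t < b" using cSup_upper[OF that(1) True] that(2) unfolding b_def by linarith
      have "\<rho> \<longlonglongrightarrow> b * (1 - 0)" unfolding \<rho>_def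
        by (intro tendsto_intros LIMSEQ_Suc[OF LIMSEQ_inverse_real_of_nat])
      hence "\<forall>\<^sub>F k in sequentially. t < \<rho> k" using \<open>t < b\<close> by (intro order_tendstoD(1)) auto
      then obtain k where "t < \<rho> k" by (auto simp: eventually_sequentially)
      thus ?thesis by (intro exI[of _ k]) simp
    qed
  qed
qed

context radial_density begin

text \<open>Here \<open>D\<close> is the set where the inf-convolution is finite and \<open>E\<close> is its exponential, extended
  by \<open>0\<close>. On intervals exhausting \<open>D\<close> the preceding estimate is uniform: the bound \<open>ln Z \<le> J\<close> gives
  integrability of \<open>E\<close> by monotone convergence, and Fatou's lemma carries over the estimate. For
  \<open>\<delta> = J - ln Z \<le> 1\<close> the choice \<open>\<epsilon> = sqrt \<delta>\<close> balances the two terms; for \<open>\<delta> > 1\<close> the trivial bound \<open>2\<close>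
  suffices.\<close>
lemma stability_halfline:
  fixes \<gamma> l E :: "real \<Rightarrow> real"
  assumes D: "t0 \<in> D" "t0 > 0"
    and l_cont: "\<And>R R'. 0 < R \<Longrightarrow> R' \<in> D \<Longrightarrow> R < R' \<Longrightarrow> {0..R} \<subseteq> D \<and> continuous_on {0..R} l"
    and \<gamma>_int: "set_integrable lborel {0<..} (\<lambda>r. \<gamma> r * m r)"
    and dual: "\<And>r t. r > 0 \<Longrightarrow> t \<in> D \<Longrightarrow> l t \<le> \<gamma> r + c / 2 * (t - r)\<^sup>2"
    and E: "\<And>t. E t = (if t \<in> D then exp (l t) else 0)"
    and E_meas [measurable]: "E \<in> borel_measurable borel"
  defines "Z \<equiv> (LINT t:{0<..}|lborel. E t * m t)"
    and "J \<equiv> (LINT r:{0<..}|lborel. \<gamma> r * m r)"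
  shows "set_integrable lborel {0<..} (\<lambda>t. E t * m t)" and "Z > 0" and "ln Z \<le> J"
    and "(\<integral>\<^sup>+r. ennreal (\<bar>1 - E r / Z\<bar> * m r * indicator {0<..} r) \<partial>lborel)
        \<le> ennreal (4 * (real d + 3) * sqrt (J - ln Z))"
proof -
  obtain \<rho> b where \<rho>: "incseq \<rho>" "\<And>k. \<rho> k > 0" "\<And>k. \<exists>R'\<in>D. R' > \<rho> k"
    "\<And>t. t \<in> D \<Longrightarrow> t \<noteq> b \<Longrightarrow> \<exists>k. t \<le> \<rho> k"
    using exhausting_radii[OF D] by blast
  have sub: "{0..\<rho> k} \<subseteq> D" and cont: "continuous_on {0..\<rho> k} l" for k
    using l_cont[OF \<rho>(2)[of k]] \<rho>(3)[of k] by blast+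
  define Ek where "Ek k r = indicator {0..\<rho> k} r * E r" for k r
  define Zk where "Zk k = (LINT t:{0..\<rho> k}|lborel. exp (l t) * m t)" for k
  have Ek_alt: "Ek k r = indicator {0..\<rho> k} r * exp (l r)" for k r
    unfolding Ek_def E using sub[of k] by (auto simp: indicator_def)
  have E_nonneg: "E r \<ge> 0" for r unfolding E by simp
  have dual': "l t \<le> \<gamma> r + c / 2 * (t - r)\<^sup>2" if "r > 0" "0 \<le> t" "t \<le> \<rho> k" for r t k
    using dual[of r t] sub[of k] that by auto
  have Zk_pos: "Zk k > 0" and Zk_le: "ln (Zk k) \<le> J" for k
    using stability_on_interval(1,2)[OF \<rho>(2) cont \<gamma>_int dual', of k] unfolding Zk_def J_def by auto
  have Zk_st: "(\<integral>\<^sup>+r. ennreal (\<bar>1 - Ek k r / Zk k\<bar> * m r * indicator {0<..} r) \<partial>lborel)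
        \<le> ennreal (4 * ((1 + real d) * \<epsilon> + 2 / \<epsilon> * (J - ln (Zk k))))" if "0 < \<epsilon>" "\<epsilon> \<le> 1" for k \<epsilon>
    using stability_on_interval(3)[OF \<rho>(2) cont \<gamma>_int dual' that, of k] unfolding Zk_def J_def Ek_alt by auto
  have Ek_lim: "(\<lambda>k. Ek k r) \<longlonglongrightarrow> E r" if r0: "r > 0" and rb: "r \<noteq> b" for r
  proof (cases "r \<in> D")
    case True
    then obtain k0 where "r \<le> \<rho> k0" using \<rho>(4)[OF True rb] by blast
    have "Ek k r = E r" if "k \<ge> k0" for k
      using incseqD[OF \<rho>(1) that] \<open>r \<le> \<rho> k0\<close> \<open>r > 0\<close> unfolding Ek_def by simp
    hence "\<forall>\<^sub>F k in sequentially. Ek k r = E r" unfolding eventually_sequentially by blast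
    thus ?thesis by (rule tendsto_eventually)
  next
    case False
    thus ?thesis unfolding Ek_def E by simp
  qed
  have Ek_le: "Ek k r \<le> E r" "0 \<le> Ek k r" for k r
    unfolding Ek_def using E_nonneg by (auto simp: indicator_def)
  have Ek_mono: "Ek k r \<le> Ek (Suc k) r" for k r
    unfolding Ek_def using incseq_SucD[OF \<rho>(1), of k] E_nonneg by (auto simp: indicator_def)
  have Ekm_int: "integrable lborel (\<lambda>r. Ek k r * (m r * indicator {0<..} r))"
    and Ekm_val: "(\<integral>r. Ek k r * (m r * indicator {0<..} r) \<partial>lborel) = Zk k" for k
  proof -
    have "set_integrable lborel {0..\<rho> k} (\<lambda>t. exp (l t) * m t)"
      by (intro borel_integrable_atLeastAtMost' continuous_intros cont m_cont)
    hence 1: "integrable lborel (\<lambda>r. Ek k r * m r)"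
      unfolding set_integrable_def Ek_alt by (simp add: mult.assoc)
    have ae: "AE r in lborel. Ek k r * m r = Ek k r * (m r * indicator {0<..} r)"
      using AE_lborel_singleton[of 0] by eventually_elim (auto simp: Ek_def indicator_def)
    have [measurable]: "Ek k \<in> borel_measurable borel" unfolding Ek_def by measurable
    show "integrable lborel (\<lambda>r. Ek k r * (m r * indicator {0<..} r))"
      by (rule integrable_cong_AE_imp[OF 1 _ ae]) measurable
    have "(\<integral>r. Ek k r * (m r * indicator {0<..} r) \<partial>lborel) = (\<integral>r. Ek k r * m r \<partial>lborel)"
    proof (rule integral_cong_AE)
      show "AE r in lborel. Ek k r * (m r * indicator {0<..} r) = Ek k r * m r"
        using ae by eventually_elim simp
    qed measurable
    thus "(\<integral>r. Ek k r * (m r * indicator {0<..} r) \<partial>lborel) = Zk k"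
      unfolding Zk_def set_lebesgue_integral_def Ek_alt by (simp add: mult.assoc)
  qed
  have mi: "m r * indicator {0<..} r \<ge> 0" for r using m_pos[of r] by (auto simp: indicator_def)
  have ae_lim: "AE r in lborel. (\<lambda>k. Ek k r * (m r * indicator {0<..} r)) \<longlonglongrightarrow> E r * (m r * indicator {0<..} r)"
    using AE_lborel_singleton[of b]
  proof eventually_elim
    case (elim r)
    show ?case
    proof (cases "r > 0")
      case True
      thus ?thesis using elim by (intro tendsto_intros Ek_lim) auto
    qed simp
  qed
  have Zk_bound: "Zk k \<le> exp J" for k using Zk_le[of k] Zk_pos[of k] by (metis exp_le_cancel_iff exp_ln)
  obtain L where L: "Zk \<longlonglongrightarrow> L"
  proof (rule incseq_convergent[of Zk "exp J"])
    show "incseq Zk"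
    proof (rule incseq_SucI)
      fix k show "Zk k \<le> Zk (Suc k)"
        unfolding Ekm_val[symmetric] by (intro integral_mono Ekm_int mult_right_mono Ek_mono mi)
    qed
  qed (use Zk_bound in auto)
  have bi: "has_bochner_integral lborel (\<lambda>r. E r * (m r * indicator {0<..} r)) L"
  proof (rule has_bochner_integral_monotone_convergence[where f="\<lambda>k r. Ek k r * (m r * indicator {0<..} r)"])
    show "AE x in lborel. mono (\<lambda>k. Ek k x * (m x * indicator {0<..} x))"
      by (intro AE_I2 incseq_SucI mult_right_mono Ek_mono mi)
    show "(\<lambda>k. \<integral>r. Ek k r * (m r * indicator {0<..} r) \<partial>lborel) \<longlonglongrightarrow> L" unfolding Ekm_val by (rule L)
  qed (use Ekm_int ae_lim in auto)
  show Eint: "set_integrable lborel {0<..} (\<lambda>t. E t * m t)"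
    using bi unfolding set_integrable_def has_bochner_integral_iff by (simp add: mult_ac)
  have ZL: "Z = L"
    using bi unfolding Z_def set_lebesgue_integral_def has_bochner_integral_iff by (simp add: mult_ac)
  have "Zk 0 \<le> L" by (rule incseq_le[OF incseq_SucI L])
      (unfold Ekm_val[symmetric], intro integral_mono Ekm_int mult_right_mono Ek_mono mi)
  thus Zpos: "Z > 0" using Zk_pos[of 0] ZL by simp
  have lnlim: "(\<lambda>k. ln (Zk k)) \<longlonglongrightarrow> ln Z" using L ZL Zpos by (intro tendsto_ln) auto
  show lnle: "ln Z \<le> J" by (rule LIMSEQ_le_const2[OF lnlim]) (use Zk_le in auto)
  define \<delta> where "\<delta> = J - ln Z"
  define TV where "TV = (\<integral>\<^sup>+r. ennreal (\<bar>1 - E r / Z\<bar> * m r * indicator {0<..} r) \<partial>lborel)"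
  have [measurable]: "Ek k \<in> borel_measurable borel" for k unfolding Ek_def by measurable
  have TV_le: "TV \<le> ennreal (4 * ((1 + real d) * \<epsilon> + 2 / \<epsilon> * \<delta>))" if \<epsilon>: "0 < \<epsilon>" "\<epsilon> \<le> 1" for \<epsilon>
  proof -
    have "TV = (\<integral>\<^sup>+r. liminf (\<lambda>k. ennreal (\<bar>1 - Ek k r / Zk k\<bar> * m r * indicator {0<..} r)) \<partial>lborel)"
      unfolding TV_def
    proof (rule nn_integral_cong_AE)
      show "AE r in lborel. ennreal (\<bar>1 - E r / Z\<bar> * m r * indicator {0<..} r)
          = liminf (\<lambda>k. ennreal (\<bar>1 - Ek k r / Zk k\<bar> * m r * indicator {0<..} r))"
        using AE_lborel_singleton[of b]
      proof eventually_elim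
        case (elim r)
        have "(\<lambda>k. ennreal (\<bar>1 - Ek k r / Zk k\<bar> * m r * indicator {0<..} r)) \<longlonglongrightarrow> ennreal (\<bar>1 - E r / Z\<bar> * m r * indicator {0<..} r)"
        proof (cases "r > 0")
          case True
          show ?thesis using elim True L ZL Zpos by (intro tendsto_intros tendsto_ennrealI Ek_lim) auto
        qed simp
        thus ?case by (intro lim_imp_Liminf[symmetric]) auto
      qed
    qed
    also have "\<dots> \<le> liminf (\<lambda>k. \<integral>\<^sup>+r. ennreal (\<bar>1 - Ek k r / Zk k\<bar> * m r * indicator {0<..} r) \<partial>lborel)"
      by (rule nn_integral_liminf) measurable
    also have "\<dots> \<le> liminf (\<lambda>k. ennreal (4 * ((1 + real d) * \<epsilon> + 2 / \<epsilon> * (J - ln (Zk k)))))"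
      by (intro Liminf_mono always_eventually allI Zk_st \<epsilon>)
    also have "\<dots> = ennreal (4 * ((1 + real d) * \<epsilon> + 2 / \<epsilon> * \<delta>))"
      unfolding \<delta>_def by (intro lim_imp_Liminf tendsto_ennrealI tendsto_intros lnlim) auto
    finally show ?thesis .
  qed
  have TV2: "TV \<le> ennreal 2"
  proof -
    have mi': "integrable lborel (\<lambda>r. m r * indicator {0<..} r)" "(\<integral>r. m r * indicator {0<..} r \<partial>lborel) = 1"
      using m_integrable m_integral unfolding set_integrable_def set_lebesgue_integral_def by (simp_all add: mult.commute)
    have Ei: "integrable lborel (\<lambda>r. E r / Z * (m r * indicator {0<..} r))"
      "(\<integral>r. E r / Z * (m r * indicator {0<..} r) \<partial>lborel) = 1"
      using bi ZL Zpos unfolding has_bochner_integral_iff by simp_all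
    have "TV \<le> (\<integral>\<^sup>+r. ennreal (m r * indicator {0<..} r + E r / Z * (m r * indicator {0<..} r)) \<partial>lborel)"
      unfolding TV_def
    proof (intro nn_integral_mono ennreal_leI)
      fix r
      have "\<bar>1 - E r / Z\<bar> \<le> 1 + E r / Z" using E_nonneg[of r] Zpos by (auto simp: abs_le_iff)
      from mult_right_mono[OF this mi[of r]]
      show "\<bar>1 - E r / Z\<bar> * m r * indicator {0<..} r \<le> m r * indicator {0<..} r + E r / Z * (m r * indicator {0<..} r)"
        by (simp add: algebra_simps)
    qed
    also have "\<dots> = ennreal (\<integral>r. m r * indicator {0<..} r + E r / Z * (m r * indicator {0<..} r) \<partial>lborel)"
      by (intro nn_integral_eq_integral Bochner_Integration.integrable_add mi' Ei AE_I2 add_nonneg_nonneg mult_nonneg_nonneg mi)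
        (use E_nonneg Zpos mi in auto)
    also have "\<dots> = ennreal 2" by (subst Bochner_Integration.integral_add[OF mi'(1) Ei(1)]) (simp only: mi'(2) Ei(2), simp)
    finally show ?thesis .
  qed
  have \<delta>0: "\<delta> \<ge> 0" unfolding \<delta>_def using lnle by simp
  consider "\<delta> = 0" | "0 < \<delta>" "\<delta> \<le> 1" | "\<delta> > 1" using \<delta>0 by linarith
  hence "TV \<le> ennreal (4 * (real d + 3) * sqrt \<delta>)"
  proof cases
    case 1
    have "TV \<le> ennreal 0"
    proof (rule tendsto_lowerbound)
      show "((\<lambda>\<epsilon>. ennreal (4 * ((1 + real d) * \<epsilon>))) \<longlongrightarrow> ennreal 0) (at_right 0)"
        by (intro tendsto_ennrealI) (auto intro!: tendsto_eq_intros)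
      show "\<forall>\<^sub>F \<epsilon> in at_right 0. TV \<le> ennreal (4 * ((1 + real d) * \<epsilon>))"
        using TV_le 1 by (intro eventually_at_rightI[of 0 1]) auto
    qed auto
    thus ?thesis using 1 by simp
  next
    case 2
    have s: "0 < sqrt \<delta>" "sqrt \<delta> \<le> 1" using 2 by auto
    have "2 / sqrt \<delta> * \<delta> = 2 * sqrt \<delta>" using 2 by (simp add: real_div_sqrt field_simps)
    thus ?thesis using TV_le[OF s] by (simp add: algebra_simps)
  next
    case 3
    have "2 \<le> 4 * (real d + 3) * 1" by simp
    also have "\<dots> \<le> 4 * (real d + 3) * sqrt \<delta>" using 3 by (intro mult_left_mono) auto
    finally show ?thesis using TV2 by (meson ennreal_leI order_trans)
  qed
  thus "(\<integral>\<^sup>+r. ennreal (\<bar>1 - E r / Z\<bar> * m r * indicator {0<..} r) \<partial>lborel)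
        \<le> ennreal (4 * (real d + 3) * sqrt (J - ln Z))" unfolding TV_def \<delta>_def .
qed

end

section \<open>Rotation invariance and the radial profile\<close>

lemma nn_integral_lborel_translate:
  fixes f :: "'a::euclidean_space \<Rightarrow> ennreal"
  assumes [measurable]: "f \<in> borel_measurable borel"
  shows "(\<integral>\<^sup>+x. f (x + a) \<partial>lborel) = (\<integral>\<^sup>+x. f x \<partial>lborel)"
proof -
  have "(\<integral>\<^sup>+x. f x \<partial>lborel) = (\<integral>\<^sup>+x. f x \<partial>distr lborel borel ((+) a))"
    by (simp add: lborel_distr_plus)
  also have "\<dots> = (\<integral>\<^sup>+x. f (x + a) \<partial>lborel)"
    by (subst nn_integral_distr) (auto simp: add.commute)
  finally show ?thesis ..
qed

lemma orthogonal_measurable: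
  fixes \<tau> :: "'a::euclidean_space \<Rightarrow> 'a"
  assumes "orthogonal_transformation \<tau>"
  shows "\<tau> \<in> borel_measurable borel"
  using orthogonal_transformation_linear[OF assms]
  by (intro borel_measurable_continuous_onI linear_continuous_on linear_conv_bounded_linear[THEN iffD1])

text \<open>Uniqueness of Haar measure. The image \<open>e\<close> of Lebesgue measure under \<open>\<tau>\<close> is translation
  invariant, so by Fubini's theorem \<open>e A \<lambda> B = \<lambda> A e B\<close> for every \<open>A\<close> and every symmetric \<open>B\<close>; for the
  unit ball \<open>B\<close> one has \<open>e B = \<lambda> B\<close>.\<close>
lemma lborel_orthogonal_invariant:
  fixes \<tau> :: "'a::euclidean_space \<Rightarrow> 'a"
  assumes \<tau>: "orthogonal_transformation \<tau>"
  shows "distr lborel borel \<tau> = lborel"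
proof (rule measure_eqI)
  fix A assume "A \<in> sets (distr lborel borel \<tau>)"
  hence [measurable]: "A \<in> sets borel" by simp
  have [measurable]: "\<tau> \<in> borel_measurable borel" by (rule orthogonal_measurable[OF \<tau>])
  \<comment> \<open>A symmetric set whose measure is positive, finite and preserved by \<open>\<tau>\<close>.\<close>
  define B where "B = cball (0::'a) 1"
  have [measurable]: "B \<in> sets borel" unfolding B_def by simp
  define e where "e C = (\<integral>\<^sup>+x. indicator C (\<tau> x) \<partial>lborel)" for C :: "'a set"
  have e_distr: "emeasure (distr lborel borel \<tau>) C = e C" if [measurable]: "C \<in> sets borel" for C
  proof -
    have "e C = (\<integral>\<^sup>+x. indicator (\<tau> -` C) x \<partial>lborel)" unfolding e_def by (simp add: indicator_def)
    also have "\<dots> = emeasure lborel (\<tau> -` C)" using measurable_sets[of \<tau> borel borel C] by (simp add: vimage_def)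
    finally show ?thesis by (simp add: emeasure_distr)
  qed
  have shift: "(\<integral>\<^sup>+x. indicator C (\<tau> x + y) \<partial>lborel) = e C" if [measurable]: "C \<in> sets borel" for C y
  proof -
    obtain a where a: "\<tau> a = y" using orthogonal_transformation_surj[OF \<tau>] by (metis surjD)
    have "\<tau> x + y = \<tau> (x + a)" for x
      using a orthogonal_transformation_linear[OF \<tau>] by (simp add: linear_add)
    thus ?thesis unfolding e_def
      using nn_integral_lborel_translate[of "\<lambda>x. indicator C (\<tau> x)" a] by simp
  qed
  have "(\<integral>\<^sup>+x. \<integral>\<^sup>+y. indicator A (\<tau> x + y) * indicator B y \<partial>lborel \<partial>lborel)
      = (\<integral>\<^sup>+y. \<integral>\<^sup>+x. indicator A (\<tau> x + y) * indicator B y \<partial>lborel \<partial>lborel)"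
    by (rule lborel_pair.Fubini'[symmetric]) measurable
  also have "\<dots> = (\<integral>\<^sup>+y. e A * indicator B y \<partial>lborel)"
    by (intro nn_integral_cong) (simp add: nn_integral_multc shift)
  also have "\<dots> = e A * emeasure lborel B" by (simp add: nn_integral_cmult)
  finally have 1: "(\<integral>\<^sup>+x. \<integral>\<^sup>+y. indicator A (\<tau> x + y) * indicator B y \<partial>lborel \<partial>lborel) = e A * emeasure lborel B" .
  have "(\<integral>\<^sup>+x. \<integral>\<^sup>+y. indicator A (\<tau> x + y) * indicator B y \<partial>lborel \<partial>lborel)
     = (\<integral>\<^sup>+x. \<integral>\<^sup>+y. indicator A y * indicator B (\<tau> x + (- y)) \<partial>lborel \<partial>lborel)"
  proof (rule nn_integral_cong)
    fix x
    have "(\<integral>\<^sup>+y. indicator A (\<tau> x + y) * indicator B y \<partial>lborel) =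
       (\<integral>\<^sup>+y. indicator A (\<tau> x + (y + (- \<tau> x))) * indicator B (y + (- \<tau> x)) \<partial>lborel)"
      by (rule nn_integral_lborel_translate[symmetric, of "\<lambda>y. indicator A (\<tau> x + y) * indicator B y"]) measurable
    also have "\<dots> = (\<integral>\<^sup>+y. indicator A y * indicator B (\<tau> x + (- y)) \<partial>lborel)"
      by (intro nn_integral_cong) (auto simp: B_def indicator_def norm_minus_commute)
    finally show "(\<integral>\<^sup>+y. indicator A (\<tau> x + y) * indicator B y \<partial>lborel) = (\<integral>\<^sup>+y. indicator A y * indicator B (\<tau> x + (- y)) \<partial>lborel)" .
  qed
  also have "\<dots> = (\<integral>\<^sup>+y. \<integral>\<^sup>+x. indicator A y * indicator B (\<tau> x + (- y)) \<partial>lborel \<partial>lborel)"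
    by (rule lborel_pair.Fubini'[symmetric]) measurable
  also have "\<dots> = (\<integral>\<^sup>+y. indicator A y * e B \<partial>lborel)"
    by (intro nn_integral_cong, subst nn_integral_cmult, measurable, subst shift) auto
  also have "\<dots> = emeasure lborel A * e B" by (simp add: nn_integral_multc)
  finally have 2: "e A * emeasure lborel B = emeasure lborel A * e B" using 1 by simp
  have "e B = emeasure lborel B"
  proof -
    have "indicator B (\<tau> x) = (indicator B x :: ennreal)" for x
      unfolding B_def using orthogonal_transformation_norm[OF \<tau>] by (auto simp: indicator_def)
    thus ?thesis unfolding e_def by simp
  qed
  moreover have "emeasure lborel B = ennreal (unit_ball_vol (DIM('a)))"
    unfolding B_def using emeasure_cball[of 1 "0::'a"] by simp
  moreover have "ennreal (unit_ball_vol (DIM('a))) \<noteq> 0" "ennreal (unit_ball_vol (DIM('a))) \<noteq> \<infinity>"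
    using unit_ball_vol_pos[of "DIM('a)"] by (auto simp: ennreal_eq_0_iff not_le)
  ultimately have "e A = emeasure lborel A"
    using 2 ennreal_mult_divide_eq[of "emeasure lborel B"] by (metis infinity_ennreal_def)
  thus "emeasure (distr lborel borel \<tau>) A = emeasure lborel A" using e_distr by simp
qed simp

text \<open>Both sides are determined by the volumes of balls.\<close>
lemma distr_norm_lborel:
  "distr lborel borel (norm :: 'a::euclidean_space \<Rightarrow> real) =
   density lborel (\<lambda>r. ennreal (DIM('a) * unit_ball_vol (DIM('a)) * r ^ (DIM('a) - 1) * indicator {0<..} r))"
  (is "?L = density lborel ?f")
proof (rule measure_eqI_generator_eq[where E="range (\<lambda>a::real. {..a})" and \<Omega>=UNIV and A="\<lambda>k. {..real k}"])
  define D where "D = DIM('a)"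
  define U where "U = unit_ball_vol D"
  have D: "D > 0" unfolding D_def by simp
  have U: "U > 0" unfolding U_def by simp
  show "Int_stable (range (\<lambda>a::real. {..a}))"
    by (auto simp: Int_stable_def)
  have L: "emeasure ?L {..r} = ennreal (if r < 0 then 0 else U * r ^ D)" for r
  proof -
    have "emeasure ?L {..r} = emeasure lborel {x::'a. norm x \<le> r}"
      by (subst emeasure_distr) (auto simp: vimage_def)
    also have "{x::'a. norm x \<le> r} = cball 0 r" by auto
    also have "emeasure lborel \<dots> = ennreal (if r < 0 then 0 else U * r ^ D)"
      using emeasure_cball[of r "0::'a"] unfolding U_def D_def by auto
    finally show ?thesis .
  qed
  show eq: "emeasure ?L X = emeasure (density lborel ?f) X" if "X \<in> range (\<lambda>a::real. {..a})" for X
  proof -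
    from that obtain r where X: "X = {..r}" by (rule imageE)
    have "emeasure (density lborel ?f) {..r} = (\<integral>\<^sup>+x. ?f x * indicator {..r} x \<partial>lborel)"
      by (subst emeasure_density) auto
    also have "\<dots> = ennreal (if r < 0 then 0 else U * r ^ D)"
    proof (cases "r < 0")
      case True
      hence "?f x * indicator {..r} x = 0" for x by (auto simp: indicator_def)
      hence "(\<integral>\<^sup>+x. ?f x * indicator {..r} x \<partial>lborel) = (\<integral>\<^sup>+x. 0 \<partial>(lborel :: real measure))"
        by (intro nn_integral_cong)
      thus ?thesis using True by simp
    next
      case False
      have "(\<integral>\<^sup>+x. ?f x * indicator {..r} x \<partial>lborel) = (\<integral>\<^sup>+x. ennreal (D * U * x ^ (D - 1)) * indicator {0..r} x \<partial>lborel)"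
      proof (rule nn_integral_cong_AE)
        show "AE x in lborel. ?f x * indicator {..r} x = ennreal (D * U * x ^ (D - 1)) * indicator {0..r} x"
          using AE_lborel_singleton[of 0] by eventually_elim (auto simp: indicator_def D_def U_def)
      qed
      also have "\<dots> = ennreal (U * r ^ D - U * 0 ^ D)"
      proof (rule nn_integral_FTC_Icc)
        show "((\<lambda>x. U * x ^ D) has_real_derivative D * U * x ^ (D - 1)) (at x)" for x
          by (auto intro!: derivative_eq_intros)
      qed (use False U in auto)
      also have "U * r ^ D - U * 0 ^ D = U * r ^ D" using D by (simp add: zero_power)
      finally show ?thesis using False by simp
    qed
    finally show ?thesis unfolding X L ..
  qed
  show "emeasure ?L {..real i} \<noteq> \<infinity>" for i unfolding L by simp
  show "sets ?L = sigma_sets UNIV (range (\<lambda>a::real. {..a}))"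
    "sets (density lborel ?f) = sigma_sets UNIV (range (\<lambda>a::real. {..a}))"
    by (simp_all add: borel_eq_atMost)
  show "(\<Union>i. {..real i}) = UNIV" using real_arch_simple by auto
qed auto

lemma distr_norm_radial:
  fixes V :: "real^'n \<Rightarrow> real" and v :: "real \<Rightarrow> real"
  assumes V: "\<And>x. V x = v (norm x)" and [measurable]: "v \<in> borel_measurable borel"
  shows "distr (mu V) borel norm = density lborel
    (\<lambda>r. ennreal (CARD('n) * unit_ball_vol CARD('n) * r ^ (CARD('n) - 1) * exp (- v r) * indicator {0<..} r))"
proof -
  have "mu V = density lborel (\<lambda>x. ennreal (exp (- v (norm x))))" unfolding mu_def V ..
  hence "distr (mu V) borel norm = density (distr lborel borel (norm :: real^'n \<Rightarrow> real)) (\<lambda>r. ennreal (exp (- v r)))"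
    by (simp add: density_distr)
  also have "\<dots> = density lborel (\<lambda>r. ennreal (CARD('n) * unit_ball_vol CARD('n) * r ^ (CARD('n) - 1) * indicator {0<..} r) * ennreal (exp (- v r)))"
    unfolding distr_norm_lborel by (simp add: density_density_eq)
  also have "\<dots> = density lborel (\<lambda>r. ennreal (CARD('n) * unit_ball_vol CARD('n) * r ^ (CARD('n) - 1) * exp (- v r) * indicator {0<..} r))"
    by (intro density_cong) (auto simp: indicator_def ennreal_mult'[symmetric])
  finally show ?thesis .
qed

lemma radial_eq:
  fixes h :: "real^'n \<Rightarrow> real"
  assumes "radial h" "norm x = norm y"
  shows "h x = h y"
proof -
  obtain \<tau> where "orthogonal_transformation \<tau>" "\<tau> x = y"
    using orthogonal_transformation_exists[OF assms(2)] by blast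
  thus ?thesis using assms(1) unfolding radial_def by metis
qed

lemma strong_convexity_1d:
  fixes f f' f'' :: "real \<Rightarrow> real"
  assumes f: "\<And>x. (f has_real_derivative f' x) (at x)"
    and f': "\<And>x. (f' has_real_derivative f'' x) (at x)"
    and ge: "\<And>x. c \<le> f'' x"
  shows "f r + f' r * (s - r) + c / 2 * (s - r)\<^sup>2 \<le> f s"
proof -
  define k where "k x = f x - c / 2 * x\<^sup>2" for x
  define k' where "k' x = f' x - c * x" for x
  have k: "(k has_real_derivative k' x) (at x)" for x
    unfolding k_def k'_def by (auto intro!: derivative_eq_intros f)
  have k': "(k' has_real_derivative (f'' x - c)) (at x)" for x
    unfolding k'_def by (auto intro!: derivative_eq_intros f')
  have "convex_on UNIV k"
    by (rule f''_ge0_imp_convex[OF _ k k']) (use ge in auto)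
  hence "k s - k r \<ge> k' r * (s - r)"
    by (rule convex_on_imp_above_tangent) (use k in auto)
  thus ?thesis unfolding k_def k'_def by (simp add: power2_eq_square algebra_simps)
qed

lemma grad_has_derivative:
  fixes f :: "real^'n \<Rightarrow> real"
  assumes "f differentiable (at x)"
  shows "(f has_derivative (\<lambda>h. grad f x \<bullet> h)) (at x)"
proof -
  let ?f' = "frechet_derivative f (at x)"
  have d: "(f has_derivative ?f') (at x)" using assms frechet_derivative_works by blast
  have lin: "linear ?f'" using d has_derivative_linear by blast
  have "?f' h = grad f x \<bullet> h" for h
  proof -
    have "?f' h = ?f' (\<Sum>i\<in>UNIV. h $ i *\<^sub>R axis i 1)"
      by (simp add: basis_expansion scalar_mult_eq_scaleR[symmetric])
    also have "\<dots> = (\<Sum>i\<in>UNIV. h $ i * ?f' (axis i 1))"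
      by (simp add: linear_sum[OF lin] linear_cmul[OF lin])
    also have "\<dots> = grad f x \<bullet> h" unfolding grad_def inner_vec_def by (simp add: mult.commute)
    finally show ?thesis .
  qed
  hence "?f' = (\<lambda>h. grad f x \<bullet> h)" by auto
  thus ?thesis using d by simp
qed

text \<open>A radial function is determined by its restriction \<open>v r = V (r e)\<close> to a line through the origin,
  which is a \<open>c\<close>-convex function of one variable: it has the second derivative \<open>e \<bullet> hessian V (r e) e \<ge> c\<close>, and \<open>v' 0 = 0\<close> since \<open>v\<close> is even.\<close>
lemma radial_profile:
  fixes V :: "real^'n \<Rightarrow> real"
  assumes V: "C2 V" "radial V" and H: "\<And>x. psd (hessian V x - c *\<^sub>R mat 1)"
  obtains v v' :: "real \<Rightarrow> real" where "\<And>x. V x = v (norm x)"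
    "\<And>r. (v has_real_derivative v' r) (at r)" "continuous_on UNIV v'"
    "\<And>r s. v r + v' r * (s - r) + c / 2 * (s - r)\<^sup>2 \<le> v s" "v' 0 = 0"
proof -
  define e :: "real^'n" where "e = axis (SOME i. True) 1"
  have e: "norm e = 1" unfolding e_def by simp
  define v where "v r = V (r *\<^sub>R e)" for r
  define v' where "v' r = grad V (r *\<^sub>R e) \<bullet> e" for r
  define v'' where "v'' r = e \<bullet> (hessian V (r *\<^sub>R e) *v e)" for r
  have line: "((\<lambda>r. r *\<^sub>R e) has_derivative (\<lambda>h. h *\<^sub>R e)) (at r)" for r :: real
    by (auto intro!: derivative_eq_intros)
  have v: "(v has_real_derivative v' r) (at r)" for r
  proof -
    have "V differentiable (at (r *\<^sub>R e))" using V(1) unfolding C2_def by blast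
    from has_derivative_compose[OF line grad_has_derivative[OF this]]
    show ?thesis unfolding v_def v'_def has_field_derivative_def by (simp add: mult_commute_abs)
  qed
  have v'_der: "(v' has_real_derivative v'' r) (at r)" for r
  proof -
    have "grad V differentiable (at (r *\<^sub>R e))" using V(1) unfolding C2_def by blast
    hence g: "(grad V has_derivative (\<lambda>h. hessian V (r *\<^sub>R e) *v h)) (at (r *\<^sub>R e))"
      unfolding hessian_def using jacobian_works by blast
    have "((\<lambda>x. grad V (x *\<^sub>R e) \<bullet> e) has_derivative (\<lambda>h. (hessian V (r *\<^sub>R e) *v (h *\<^sub>R e)) \<bullet> e)) (at r)"
      by (rule has_derivative_inner_left[OF has_derivative_compose[OF line g]])
    thus ?thesis unfolding v'_def v''_def has_field_derivative_def
      by (simp add: matrix_vector_mult_scaleR inner_commute mult_commute_abs)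
  qed
  have v''_ge: "c \<le> v'' r" for r
  proof -
    have "0 \<le> e \<bullet> ((hessian V (r *\<^sub>R e) - c *\<^sub>R mat 1) *v e)" using H unfolding psd_def by blast
    also have "\<dots> = v'' r - c * (e \<bullet> e)" unfolding v''_def
      by (simp add: matrix_vector_mult_diff_rdistrib scaleR_matrix_vector_assoc[symmetric] inner_diff_right)
    finally show ?thesis using e by (simp add: dot_square_norm)
  qed
  have "v (- r) = v r" for r unfolding v_def by (rule radial_eq[OF V(2)]) simp
  hence "v = (\<lambda>r. v (- r))" by auto
  moreover have "((\<lambda>r. v (- r)) has_real_derivative - v' 0) (at 0)"
  proof -
    have "(uminus has_real_derivative - 1) (at (0::real))" by (auto intro!: derivative_eq_intros)
    from DERIV_chain2[of v "v' 0" uminus 0, OF _ this] show ?thesis using v[of 0] by simp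
  qed
  ultimately have "v' 0 = - v' 0" using v[of 0] DERIV_unique by metis
  hence v'0: "v' 0 = 0" by simp
  have Vv: "V x = v (norm x)" for x
    unfolding v_def by (rule radial_eq[OF V(2)]) (use e in simp)
  have cont: "continuous_on UNIV v'"
    using DERIV_isCont[OF v'_der] by (simp add: continuous_at_imp_continuous_on)
  show ?thesis
    by (rule that[OF Vv v cont strong_convexity_1d[OF v v'_der v''_ge] v'0])
qed

section \<open>Convex functions and inf-convolutions\<close>

lemma convex_above_tangent:
  fixes \<phi> :: "'a::real_normed_vector \<Rightarrow> real"
  assumes "convex_on UNIV \<phi>" "(\<phi> has_derivative D) (at x)"
  shows "\<phi> x + D (z - x) \<le> \<phi> z"
proof -
  define k where "k t = \<phi> (x + t *\<^sub>R (z - x))" for t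
  have lin: "linear D" using assms(2) has_derivative_linear by blast
  have "convex_on UNIV k"
  proof (rule convex_onI)
    fix t a b :: real assume "0 < t" "t < 1"
    have "x + ((1 - t) *\<^sub>R a + t *\<^sub>R b) *\<^sub>R (z - x) = (1 - t) *\<^sub>R (x + a *\<^sub>R (z - x)) + t *\<^sub>R (x + b *\<^sub>R (z - x))"
      by (simp add: algebra_simps)
    thus "k ((1 - t) *\<^sub>R a + t *\<^sub>R b) \<le> (1 - t) * k a + t * k b"
      unfolding k_def using convex_onD[OF assms(1), of t "x + a *\<^sub>R (z - x)" "x + b *\<^sub>R (z - x)"] \<open>0 < t\<close> \<open>t < 1\<close> by simp
  qed simp
  moreover have "(k has_real_derivative D (z - x)) (at 0)"
  proof -
    have "((\<lambda>t. x + t *\<^sub>R (z - x)) has_derivative (\<lambda>h. h *\<^sub>R (z - x))) (at 0)"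
      by (auto intro!: derivative_eq_intros)
    moreover have "(\<phi> has_derivative D) (at (x + 0 *\<^sub>R (z - x)))" using assms(2) by simp
    ultimately have "(k has_derivative (\<lambda>h. D (h *\<^sub>R (z - x)))) (at 0)"
      unfolding k_def by (rule has_derivative_compose)
    thus ?thesis unfolding has_field_derivative_def by (simp add: linear_cmul[OF lin] mult_commute_abs)
  qed
  ultimately have "D (z - x) * (1 - 0) \<le> k 1 - k 0"
    by (intro convex_on_imp_above_tangent[of UNIV k 0 1]) auto
  thus ?thesis unfolding k_def by simp
qed

lemma AE_lborel_translate:
  fixes a :: "'a::euclidean_space"
  assumes "AE x in lborel. Q x"
  shows "AE x in lborel. Q (x + a)"
proof -
  have "AE x in distr lborel borel ((+) a). Q x" by (subst lborel_distr_plus) (rule assms)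
  hence "AE x in lborel. Q (a + x)" by (rule AE_distrD[rotated]) simp
  thus ?thesis by (simp add: add.commute)
qed

lemma continuous_AE_zero:
  fixes w :: "'a::euclidean_space \<Rightarrow> real"
  assumes "continuous_on UNIV w" "AE x in lborel. w x = 0"
  shows "w x = 0"
proof -
  define U where "U = {x. w x \<noteq> 0}"
  have U: "open U" unfolding U_def using assms(1)
    by (intro open_Collect_neq) auto
  have "U \<in> null_sets lborel"
    using AE_iff_null[of lborel "\<lambda>x. w x = 0"] assms(2) borel_open[OF U] by (simp add: U_def)
  hence "negligible U" by (simp add: negligible_iff_null_sets null_sets_completionI)
  hence "U = {}" using U open_not_negligible by blast
  thus ?thesis unfolding U_def by auto
qed

text \<open>Divide the segment from \<open>x\<close> to \<open>x + e\<close> into \<open>N\<close> equal parts. For almost every \<open>x\<close> all division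
  points, for all \<open>N\<close>, carry a common subgradient \<open>p\<close>. On each part the increments of \<open>\<phi>\<close> and \<open>\<psi>\<close> lie
  in the same interval of length \<open>(p\<^sub>i\<^sub>+\<^sub>1 - p\<^sub>i) \<bullet> e / N\<close>. These lengths telescope to
  \<open>(p (x + e) - p x) \<bullet> e / N\<close>, which tends to \<open>0\<close>.\<close>
lemma common_subgradients_imp_diff_const:
  fixes \<phi> \<psi> :: "'a::euclidean_space \<Rightarrow> real" and p :: "'a \<Rightarrow> 'a"
  assumes cont: "continuous_on UNIV \<phi>" "continuous_on UNIV \<psi>"
    and sub: "AE x in lborel. (\<forall>z. \<phi> x + p x \<bullet> (z - x) \<le> \<phi> z) \<and> (\<forall>z. \<psi> x + p x \<bullet> (z - x) \<le> \<psi> z)"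
  shows "\<phi> e - \<psi> e = \<phi> 0 - \<psi> 0"
proof -
  define S where "S = {x. (\<forall>z. \<phi> x + p x \<bullet> (z - x) \<le> \<phi> z) \<and> (\<forall>z. \<psi> x + p x \<bullet> (z - x) \<le> \<psi> z)}"
  define w where "w x = \<phi> x - \<psi> x" for x
  have step: "\<bar>w (x + h) - w x\<bar> \<le> (p (x + h) - p x) \<bullet> h" if "x \<in> S" "x + h \<in> S" for x h
  proof -
    have "\<phi> x + p x \<bullet> h \<le> \<phi> (x + h)" "\<psi> x + p x \<bullet> h \<le> \<psi> (x + h)"
      using that(1) unfolding S_def by (auto dest!: spec[of _ "x + h"])
    moreover have "\<phi> (x + h) + p (x + h) \<bullet> (x - (x + h)) \<le> \<phi> x" "\<psi> (x + h) + p (x + h) \<bullet> (x - (x + h)) \<le> \<psi> x"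
      using that(2) unfolding S_def by blast+
    ultimately show ?thesis unfolding w_def by (simp add: inner_diff_left inner_minus_right)
  qed
  have "AE x in lborel. x \<in> S" using sub unfolding S_def by simp
  hence "AE x in lborel. \<forall>N i. x + (real i / real N) *\<^sub>R e \<in> S"
    by (intro AE_all_countable[THEN iffD2] allI AE_lborel_translate)
  hence "AE x in lborel. w (x + e) - w x = 0"
  proof eventually_elim
    case (elim x)
    have x: "x \<in> S" "x + e \<in> S" using elim[rule_format, of 0 1] elim[rule_format, of 1 1] by auto
    define K where "K = (p (x + e) - p x) \<bullet> e"
    have bound: "\<bar>w (x + e) - w x\<bar> \<le> K * inverse (real (Suc k))" for k
    proof -
      define N where "N = Suc k"
      define y where "y i = x + (real i / real N) *\<^sub>R e" for i
      define h where "h = (1 / real N) *\<^sub>R e"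
      have y: "y i \<in> S" for i unfolding y_def using elim by blast
      have ySuc: "y (Suc i) = y i + h" for i
        unfolding y_def h_def by (simp add: add_divide_distrib scaleR_add_left)
      have y0: "y 0 = x" and yN: "y N = x + e" unfolding y_def N_def by simp_all
      have "\<bar>w (x + e) - w x\<bar> = \<bar>\<Sum>i<N. w (y (Suc i)) - w (y i)\<bar>"
        by (subst sum_lessThan_telescope) (simp add: y0 yN)
      also have "\<dots> \<le> (\<Sum>i<N. \<bar>w (y (Suc i)) - w (y i)\<bar>)" by (rule sum_abs)
      also have "\<dots> \<le> (\<Sum>i<N. (p (y (Suc i)) - p (y i)) \<bullet> h)"
        unfolding ySuc by (intro sum_mono step) (use y ySuc in \<open>auto simp flip: ySuc\<close>)
      also have "\<dots> = (\<Sum>i<N. p (y (Suc i)) - p (y i)) \<bullet> h" by (simp add: inner_sum_left)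
      also have "(\<Sum>i<N. p (y (Suc i)) - p (y i)) = p (x + e) - p x"
        by (subst sum_lessThan_telescope) (simp add: y0 yN)
      also have "(p (x + e) - p x) \<bullet> h = K * inverse (real (Suc k))"
        unfolding h_def K_def N_def by (simp add: divide_inverse mult.commute)
      finally show ?thesis .
    qed
    have "(\<lambda>k. K * inverse (real (Suc k))) \<longlonglongrightarrow> K * 0"
      by (intro tendsto_intros LIMSEQ_inverse_real_of_nat)
    hence "\<bar>w (x + e) - w x\<bar> \<le> K * 0"
      by (rule LIMSEQ_le_const) (use bound in auto)
    thus ?case by simp
  qed
  moreover have "continuous_on UNIV (\<lambda>x. w (x + e) - w x)"
    unfolding w_def by (intro continuous_intros continuous_on_compose2[OF cont(1)] continuous_on_compose2[OF cont(2)] cont) auto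
  ultimately have "w (0 + e) - w 0 = 0" by (intro continuous_AE_zero[of "\<lambda>x. w (x + e) - w x"])
  thus ?thesis unfolding w_def by simp
qed

lemma inf_conv_le: "inf_conv c g y \<le> ereal (g x + c / 2 * (norm (x - y))\<^sup>2)"
  unfolding inf_conv_def by (rule INF_lower) simp

lemma inf_conv_measurable [measurable]: "inf_conv c g \<in> borel_measurable borel"
proof -
  have "inf_conv c g -` {..<a} \<in> sets borel" for a
  proof -
    have "inf_conv c g -` {..<a} = (\<Union>x. {y. ereal (g x + c / 2 * (norm (x - y))\<^sup>2) < a})"
      by (auto simp: inf_conv_def INF_less_iff)
    moreover have "open {y. ereal (g x + c / 2 * (norm (x - y))\<^sup>2) < a}" for x
      by (intro open_Collect_less continuous_on_ereal continuous_intros)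
    ultimately show ?thesis by (simp add: borel_open open_UN)
  qed
  thus ?thesis by (subst borel_measurable_ereal_iff_Iio) simp
qed

lemma exp_inf_conv_measurable [measurable]: "exp_inf_conv c g \<in> borel_measurable borel"
  unfolding exp_inf_conv_def[abs_def] by measurable

lemma inf_conv_finite_le:
  assumes "inf_conv c g y \<noteq> -\<infinity>"
  shows "inf_conv c g y = ereal (real_of_ereal (inf_conv c g y))"
    and "real_of_ereal (inf_conv c g y) \<le> g x + c / 2 * (norm (x - y))\<^sup>2"
proof -
  have "inf_conv c g y \<noteq> \<infinity>" using inf_conv_le[of c g y 0] by auto
  thus *: "inf_conv c g y = ereal (real_of_ereal (inf_conv c g y))"
    using assms by (cases "inf_conv c g y") auto
  show "real_of_ereal (inf_conv c g y) \<le> g x + c / 2 * (norm (x - y))\<^sup>2"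
    using inf_conv_le[of c g y x] * by (metis ereal_less_eq(3))
qed

lemma inf_conv_orthogonal:
  fixes g :: "real^'n \<Rightarrow> real"
  assumes "radial g" "orthogonal_transformation \<tau>"
  shows "inf_conv c g (\<tau> y) = inf_conv c g y"
proof -
  have s: "range \<tau> = UNIV" using orthogonal_transformation_surj[OF assms(2)] .
  have n: "norm (\<tau> x - \<tau> y) = norm (x - y)" for x
    using orthogonal_transformation_norm[OF assms(2), of "x - y"] orthogonal_transformation_linear[OF assms(2)]
    by (simp add: linear_diff)
  have "inf_conv c g (\<tau> y) = (INF x\<in>range \<tau>. ereal (g x + c / 2 * (norm (x - \<tau> y))\<^sup>2))"
    unfolding inf_conv_def s ..
  also have "\<dots> = (INF x. ereal (g (\<tau> x) + c / 2 * (norm (\<tau> x - \<tau> y))\<^sup>2))"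
    by (simp add: image_image)
  also have "\<dots> = inf_conv c g y"
    unfolding inf_conv_def n using assms unfolding radial_def by simp
  finally show ?thesis .
qed

text \<open>Up to the quadratic term, the inf-convolution is an infimum of affine functions. Concavity
  gives continuity inside the set \<open>D\<close> where it is finite.\<close>
lemma inf_conv_line_concave:
  fixes g :: "real^'n \<Rightarrow> real" and e :: "real^'n" and c :: real
  assumes e: "norm e = 1"
  defines "D \<equiv> {t. inf_conv c g (t *\<^sub>R e) \<noteq> -\<infinity>}"
    and "k \<equiv> \<lambda>t. c / 2 * t\<^sup>2 - real_of_ereal (inf_conv c g (t *\<^sub>R e))"
  shows "convex D" "convex_on D k"
proof -
  have aff: "g x + c / 2 * (norm (x - t *\<^sub>R e))\<^sup>2 = g x + c / 2 * (norm x)\<^sup>2 - c * t * (x \<bullet> e) + c / 2 * t\<^sup>2" for x t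
    using e by (simp add: power2_norm_eq_inner inner_diff_left inner_diff_right inner_commute
        algebra_simps power2_eq_square[of t] norm_eq_1)
  have key: "t \<in> D \<and> k t \<le> (1 - u) * k a + u * k b"
    if D: "a \<in> D" "b \<in> D" and u: "0 \<le> u" "u \<le> 1" and t: "t = (1 - u) * a + u * b" for a b u t
  proof -
    define q where "q x = g x + c / 2 * (norm x)\<^sup>2" for x
    have lo: "- k s \<le> q x - c * s * (x \<bullet> e)" if "s \<in> D" for s x
      using inf_conv_finite_le(2)[of c g "s *\<^sub>R e" x] that unfolding D_def k_def q_def aff by simp
    have ge: "ereal (c / 2 * t\<^sup>2 - ((1 - u) * k a + u * k b)) \<le> inf_conv c g (t *\<^sub>R e)"
      unfolding inf_conv_def
    proof (rule INF_greatest)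
      fix x
      have "(1 - u) * (- k a) + u * (- k b) \<le> (1 - u) * (q x - c * a * (x \<bullet> e)) + u * (q x - c * b * (x \<bullet> e))"
        using u by (intro add_mono mult_left_mono lo D) auto
      also have "\<dots> = q x - c * t * (x \<bullet> e)" unfolding t by (simp add: algebra_simps)
      finally show "ereal (c / 2 * t\<^sup>2 - ((1 - u) * k a + u * k b)) \<le> ereal (g x + c / 2 * (norm (x - t *\<^sub>R e))\<^sup>2)"
        unfolding aff q_def by simp
    qed
    hence tD: "inf_conv c g (t *\<^sub>R e) \<noteq> -\<infinity>" by auto
    have "ereal (c / 2 * t\<^sup>2 - ((1 - u) * k a + u * k b)) \<le> ereal (real_of_ereal (inf_conv c g (t *\<^sub>R e)))"
      by (subst inf_conv_finite_le(1)[OF tD, symmetric]) (rule ge)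
    hence "k t \<le> (1 - u) * k a + u * k b" unfolding k_def by simp
    thus ?thesis using tD unfolding D_def by simp
  qed
  show D: "convex D"
    unfolding convex_alt
  proof (intro ballI allI impI)
    fix a b u :: real assume "a \<in> D" "b \<in> D" "0 \<le> u \<and> u \<le> 1"
    thus "(1 - u) *\<^sub>R a + u *\<^sub>R b \<in> D"
      using key[of a b u "(1 - u) *\<^sub>R a + u *\<^sub>R b"] by simp
  qed
  show "convex_on D k"
  proof (rule convex_onI[OF _ D])
    fix u a b :: real assume "0 < u" "u < 1" "a \<in> D" "b \<in> D"
    thus "k ((1 - u) *\<^sub>R a + u *\<^sub>R b) \<le> (1 - u) * k a + u * k b"
      using key[of a b u "(1 - u) *\<^sub>R a + u *\<^sub>R b"] by simp
  qed
qed

section \<open>Gaussian integrals and entropy\<close>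

lemma gaussian_nn_integral_1d:
  fixes a :: real
  assumes "a > 0"
  shows "(\<integral>\<^sup>+x. ennreal (exp (- a * x\<^sup>2)) \<partial>lborel) = ennreal (sqrt (pi / a))"
proof -
  define \<sigma> where "\<sigma> = sqrt (1 / (2 * a))"
  have \<sigma>: "\<sigma>\<^sup>2 = 1 / (2 * a)" "\<sigma> > 0" unfolding \<sigma>_def using assms by simp_all
  have "exp (- a * x\<^sup>2) = sqrt (pi / a) * normal_density 0 \<sigma> x" for x
    unfolding normal_density_def \<sigma> using assms by (simp add: real_sqrt_divide)
  hence "(\<integral>\<^sup>+x. ennreal (exp (- a * x\<^sup>2)) \<partial>lborel) = (\<integral>\<^sup>+x. ennreal (sqrt (pi / a)) * ennreal (normal_density 0 \<sigma> x) \<partial>lborel)"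
    using assms by (simp add: ennreal_mult')
  also have "\<dots> = ennreal (sqrt (pi / a)) * (\<integral>\<^sup>+x. ennreal (normal_density 0 \<sigma> x) \<partial>lborel)"
    by (rule nn_integral_cmult) simp
  also have "(\<integral>\<^sup>+x. ennreal (normal_density 0 \<sigma> x) \<partial>lborel) = ennreal 1"
    by (subst nn_integral_eq_integral) (use \<sigma> in auto)
  finally show ?thesis by simp
qed

lemma exp_norm_sq_prod:
  fixes x :: "'a::euclidean_space"
  shows "exp (- a * (norm x)\<^sup>2) = (\<Prod>b\<in>Basis. exp (- a * (x \<bullet> b)\<^sup>2))"
proof -
  have "(norm x)\<^sup>2 = (\<Sum>b\<in>Basis. (x \<bullet> b)\<^sup>2)"
    using euclidean_inner[of x x] unfolding power2_norm_eq_inner by (simp add: power2_eq_square)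
  thus ?thesis by (simp add: exp_sum[symmetric] sum_distrib_left)
qed

lemma gaussian_nn_integral:
  fixes a :: real
  assumes "a > 0"
  shows "(\<integral>\<^sup>+(x::'a::euclidean_space). ennreal (exp (- a * (norm x)\<^sup>2)) \<partial>lborel) = ennreal (sqrt (pi / a) ^ DIM('a))"
proof -
  have "(\<integral>\<^sup>+(x::'a). ennreal (exp (- a * (norm x)\<^sup>2)) \<partial>lborel)
      = (\<integral>\<^sup>+(x::'a). (\<Prod>b\<in>Basis. ennreal (exp (- a * (x \<bullet> b)\<^sup>2))) \<partial>lborel)"
    unfolding exp_norm_sq_prod by (simp add: prod_ennreal)
  also have "\<dots> = (\<Prod>b\<in>(Basis::'a set). \<integral>\<^sup>+x. ennreal (exp (- a * x\<^sup>2)) \<partial>lborel)"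
    by (rule nn_integral_lborel_prod) auto
  also have "\<dots> = ennreal (sqrt (pi / a) ^ DIM('a))"
    unfolding gaussian_nn_integral_1d[OF assms] using assms by (simp add: ennreal_power)
  finally show ?thesis .
qed

lemma rel_entropy_density:
  assumes "prob_space \<mu>" and f [measurable]: "f \<in> borel_measurable \<mu>" and nn: "\<And>x. f x \<ge> 0"
  shows "rel_entropy (density \<mu> (\<lambda>x. ennreal (f x))) \<mu> =
    (if integrable \<mu> (\<lambda>x. f x * ln (f x)) then ereal (\<integral>x. f x * ln (f x) \<partial>\<mu>) else \<infinity>)"
proof -
  interpret prob_space \<mu> by fact
  define r where "r x = enn2real (RN_deriv \<mu> (density \<mu> (\<lambda>x. ennreal (f x))) x)" for x
  have [measurable]: "r \<in> borel_measurable \<mu>" unfolding r_def by measurable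
  have "AE x in \<mu>. ennreal (f x) = RN_deriv \<mu> (density \<mu> (\<lambda>x. ennreal (f x))) x"
    by (rule RN_deriv_unique) auto
  hence ae: "AE x in \<mu>. r x * ln (r x) = f x * ln (f x)"
  proof eventually_elim
    case (elim x)
    have "r x = f x" unfolding r_def elim[symmetric] by (rule enn2real_ennreal[OF nn])
    thus ?case by simp
  qed
  have 1: "integrable \<mu> (\<lambda>x. r x * ln (r x)) \<longleftrightarrow> integrable \<mu> (\<lambda>x. f x * ln (f x))"
    by (rule integrable_cong_AE[OF _ _ ae]) measurable
  have 2: "(\<integral>x. r x * ln (r x) \<partial>\<mu>) = (\<integral>x. f x * ln (f x) \<partial>\<mu>)"
    by (rule integral_cong_AE[OF _ _ ae]) measurable
  show ?thesis unfolding rel_entropy_def Let_def r_def[symmetric] 1 2 ..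
qed

text \<open>Young's inequality for the conjugate pair \<open>y ln y - y\<close> and \<open>exp a\<close>. It provides both the second
  moment of \<open>\<nu>\<close> and the Gibbs inequality.\<close>
lemma young_entropy:
  fixes a y :: real
  assumes "y \<ge> 0"
  shows "y * a \<le> y * ln y - y + exp a"
proof (cases "y = 0")
  case False
  have "1 + (a - ln y) \<le> exp (a - ln y)" by (rule exp_ge_add_one_self)
  hence "y * (1 + (a - ln y)) \<le> y * exp (a - ln y)" using assms by (intro mult_left_mono) auto
  also have "\<dots> = exp a" using False assms by (simp add: exp_diff)
  finally show ?thesis by (simp add: algebra_simps)
qed simp

section \<open>Brenier potentials between radial measures\<close>

text \<open>The data of the problem when the relative entropy is finite, with the potential \<open>V\<close> replaced by
  its profile \<open>v\<close> and the density of \<open>\<nu>\<close> by a radial version \<open>f\<close>.\<close>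
locale radial_brenier =
  fixes V :: "real^'n \<Rightarrow> real" and v v' :: "real \<Rightarrow> real" and c :: real
    and g :: "real^'n \<Rightarrow> real" and T :: "real^'n \<Rightarrow> real^'n" and f :: "real^'n \<Rightarrow> real"
  assumes c_pos: "c > 0" and V_eq: "\<And>x. V x = v (norm x)"
    and v_deriv: "\<And>r. (v has_real_derivative v' r) (at r)"
    and v'_cont: "continuous_on UNIV v'"
    and v_convex: "\<And>r s. v r + v' r * (s - r) + c / 2 * (s - r)\<^sup>2 \<le> v s"
    and v'0: "v' 0 = 0"
    and mu_prob: "prob_space (mu V)"
    and T_meas [measurable]: "T \<in> borel_measurable borel"
    and good: "AE x in mu V. g differentiable (at x) \<and> T x = x + (1 / c) *\<^sub>R grad g x"
    and f_meas [measurable]: "f \<in> borel_measurable borel" and f_nonneg: "\<And>x. f x \<ge> 0"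
    and f_radial: "radial f"
    and T_push: "distr (mu V) borel T = density (mu V) (\<lambda>x. ennreal (f x))"
    and convex: "convex_on UNIV (\<lambda>x. c / 2 * (norm x)\<^sup>2 + g x)"
    and entropy: "integrable (mu V) (\<lambda>x. f x * ln (f x))"
begin

sublocale prob_space "mu V" by (rule mu_prob)

definition \<nu> where "\<nu> = density (mu V) (\<lambda>x. ennreal (f x))"
definition \<phi> where "\<phi> x = c / 2 * (norm x)\<^sup>2 + g x"
definition \<Lambda> where "\<Lambda> y = real_of_ereal (inf_conv c g y)"

lemma sets_mu [simp, measurable_cong]: "sets (mu V) = sets borel"
  unfolding mu_def by simp

lemma space_mu [simp]: "space (mu V) = UNIV"
  unfolding mu_def by simp

lemma sets_nu [simp, measurable_cong]: "sets \<nu> = sets borel"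
  unfolding \<nu>_def by simp

lemma v_cont: "continuous_on A v"
  using DERIV_isCont[OF v_deriv] by (simp add: continuous_at_imp_continuous_on)

lemma v_meas [measurable]: "v \<in> borel_measurable borel"
  using v_cont by (rule borel_measurable_continuous_onI)

lemma V_meas [measurable]: "V \<in> borel_measurable borel"
  unfolding V_eq[abs_def] by measurable

lemma \<phi>_cont: "continuous_on UNIV \<phi>"
  unfolding \<phi>_def[abs_def] using convex by (intro convex_on_continuous) auto

lemma \<phi>_meas [measurable]: "\<phi> \<in> borel_measurable borel"
  using \<phi>_cont by (rule borel_measurable_continuous_onI)

lemma g_eq: "g x = \<phi> x - c / 2 * (norm x)\<^sup>2" unfolding \<phi>_def by simp

lemma g_meas [measurable]: "g \<in> borel_measurable borel"
  by (subst g_eq[abs_def]) measurable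

lemma \<Lambda>_meas [measurable]: "\<Lambda> \<in> borel_measurable borel"
  unfolding \<Lambda>_def[abs_def] by measurable

lemma AE_mu_iff: "(AE x in mu V. Q x) \<longleftrightarrow> (AE x in lborel. Q x)"
  unfolding mu_def by (subst AE_density) simp_all

text \<open>Expanding the squares turns minimisers of the transport cost into subgradients of the convex
  function attached to \<open>h\<close>. This is used for \<open>g\<close> and for its rotations.\<close>
lemma minimizer_iff_subgradient:
  fixes x y z :: "real^'n" and h :: "real^'n \<Rightarrow> real"
  shows
  "h x + c / 2 * (norm (x - y))\<^sup>2 \<le> h z + c / 2 * (norm (z - y))\<^sup>2 \<longleftrightarrow>
   (c / 2 * (norm x)\<^sup>2 + h x) + (c *\<^sub>R y) \<bullet> (z - x) \<le> c / 2 * (norm z)\<^sup>2 + h z"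
proof -
  have *: "c / 2 * (norm (x - y))\<^sup>2 = c / 2 * (norm x)\<^sup>2 - c * (x \<bullet> y) + c / 2 * (norm y)\<^sup>2" for x y :: "real^'n"
    by (simp add: power2_norm_eq_inner inner_diff_left inner_diff_right inner_commute[of y x] field_simps)
  have "(c *\<^sub>R y) \<bullet> (z - x) = c * (z \<bullet> y) - c * (x \<bullet> y)"
    by (simp add: inner_diff_right inner_commute right_diff_distrib)
  thus ?thesis unfolding *[of x y] *[of z y] by linarith
qed

lemma subgradient:
  assumes "g differentiable (at x)" "T x = x + (1 / c) *\<^sub>R grad g x"
  shows "\<phi> x + (c *\<^sub>R T x) \<bullet> (z - x) \<le> \<phi> z"
proof -
  have "(\<phi> has_derivative (\<lambda>h. c / 2 * (h \<bullet> x + x \<bullet> h) + grad g x \<bullet> h)) (at x)"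
    unfolding \<phi>_def[abs_def] power2_norm_eq_inner
    by (auto intro!: derivative_eq_intros grad_has_derivative[OF assms(1)])
  moreover have "(\<lambda>h. c / 2 * (h \<bullet> x + x \<bullet> h) + grad g x \<bullet> h) = (\<lambda>h. (c *\<^sub>R T x) \<bullet> h)"
    unfolding assms(2) using c_pos by (auto simp: inner_add_left inner_commute algebra_simps)
  ultimately have "(\<phi> has_derivative (\<lambda>h. (c *\<^sub>R T x) \<bullet> h)) (at x)" by simp
  moreover have "convex_on UNIV \<phi>" using convex unfolding \<phi>_def[abs_def] .
  ultimately show ?thesis by (rule convex_above_tangent[rotated])
qed

lemma AE_subgradient: "AE x in mu V. \<forall>z. \<phi> x + (c *\<^sub>R T x) \<bullet> (z - x) \<le> \<phi> z"
  using good by eventually_elim (use subgradient in blast)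

lemma AE_inf_conv_T: "AE x in mu V. inf_conv c g (T x) = ereal (g x + c / 2 * (norm (x - T x))\<^sup>2)"
  using AE_subgradient
proof eventually_elim
  case (elim x)
  show ?case
  proof (rule antisym)
    show "inf_conv c g (T x) \<le> ereal (g x + c / 2 * (norm (x - T x))\<^sup>2)" by (rule inf_conv_le)
    show "ereal (g x + c / 2 * (norm (x - T x))\<^sup>2) \<le> inf_conv c g (T x)"
      unfolding inf_conv_def
      by (intro INF_greatest) (use elim minimizer_iff_subgradient[of g x "T x"] in \<open>auto simp: \<phi>_def\<close>)
  qed
qed

lemma exp_norm_sq_integrable: "integrable (mu V) (\<lambda>x. exp (c / 4 * (norm x)\<^sup>2))"
proof (rule integrableI_nonneg)
  have "(\<integral>\<^sup>+x. ennreal (exp (c / 4 * (norm x)\<^sup>2)) \<partial>mu V) = (\<integral>\<^sup>+x. ennreal (exp (- V x)) * ennreal (exp (c / 4 * (norm x)\<^sup>2)) \<partial>lborel)"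
    unfolding mu_def by (rule nn_integral_density) auto
  also have "\<dots> \<le> (\<integral>\<^sup>+(x::real^'n). ennreal (exp (- v 0)) * ennreal (exp (- (c / 4) * (norm x)\<^sup>2)) \<partial>lborel)"
  proof (rule nn_integral_mono)
    fix x :: "real^'n"
    have "v 0 + c / 2 * (norm x)\<^sup>2 \<le> V x" using v_convex[of 0 "norm x"] v'0 V_eq by simp
    hence "exp (- V x + c / 4 * (norm x)\<^sup>2) \<le> exp (- v 0 + - (c / 4) * (norm x)\<^sup>2)"
      by (simp add: algebra_simps)
    thus "ennreal (exp (- V x)) * ennreal (exp (c / 4 * (norm x)\<^sup>2)) \<le> ennreal (exp (- v 0)) * ennreal (exp (- (c / 4) * (norm x)\<^sup>2))"
      by (simp add: ennreal_mult'[symmetric] exp_add[symmetric] ennreal_leI)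
  qed
  also have "\<dots> = ennreal (exp (- v 0)) * (\<integral>\<^sup>+(x::real^'n). ennreal (exp (- (c / 4) * (norm x)\<^sup>2)) \<partial>lborel)"
    by (rule nn_integral_cmult) measurable
  also have "\<dots> < \<infinity>"
    using gaussian_nn_integral[of "c / 4", where 'a="real^'n"] c_pos by (simp add: ennreal_mult_less_top)
  finally show "(\<integral>\<^sup>+x. ennreal (exp (c / 4 * (norm x)\<^sup>2)) \<partial>mu V) < \<infinity>" .
qed auto

lemma norm_sq_integrable: "integrable (mu V) (\<lambda>x. (norm x)\<^sup>2)"
proof (rule Bochner_Integration.integrable_bound[OF integrable_mult_right[OF exp_norm_sq_integrable, of "4 / c"]])
  show "AE x in mu V. norm ((norm x)\<^sup>2) \<le> norm (4 / c * exp (c / 4 * (norm x)\<^sup>2))"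
  proof (rule AE_I2)
    fix x :: "real^'n"
    have "c / 4 * (norm x)\<^sup>2 \<le> exp (c / 4 * (norm x)\<^sup>2)"
      using exp_ge_add_one_self[of "c / 4 * (norm x)\<^sup>2"] by linarith
    thus "norm ((norm x)\<^sup>2) \<le> norm (4 / c * exp (c / 4 * (norm x)\<^sup>2))"
      using c_pos by (simp add: field_simps)
  qed
qed auto

lemma f_integrable: "integrable (mu V) f" and f_integral: "(\<integral>x. f x \<partial>mu V) = 1"
proof -
  have "prob_space (distr (mu V) borel T)" by (rule prob_space_distr) simp
  hence "emeasure (density (mu V) (\<lambda>x. ennreal (f x))) UNIV = 1"
    using T_push prob_space.emeasure_space_1[of "density (mu V) (\<lambda>x. ennreal (f x))"] by simp
  hence 1: "(\<integral>\<^sup>+x. ennreal (f x) \<partial>mu V) = 1" by (simp add: emeasure_density)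
  show i: "integrable (mu V) f" by (rule integrableI_nonneg) (use f_nonneg 1 in auto)
  show "(\<integral>x. f x \<partial>mu V) = 1"
    using nn_integral_eq_integral[OF i] f_nonneg 1 Bochner_Integration.integral_nonneg[of "mu V" f] by simp
qed

lemma integral_T:
  fixes h :: "real^'n \<Rightarrow> real"
  assumes [measurable]: "h \<in> borel_measurable borel"
  shows "integrable (mu V) (\<lambda>x. h (T x)) \<longleftrightarrow> integrable (mu V) (\<lambda>x. f x * h x)"
    and "(\<integral>x. h (T x) \<partial>mu V) = (\<integral>x. f x * h x \<partial>mu V)"
proof -
  have "integrable (mu V) (\<lambda>x. h (T x)) \<longleftrightarrow> integrable (distr (mu V) borel T) h"
    by (rule integrable_distr_eq[symmetric]) auto
  thus "integrable (mu V) (\<lambda>x. h (T x)) \<longleftrightarrow> integrable (mu V) (\<lambda>x. f x * h x)"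
    unfolding T_push using integrable_density[of h "mu V" f] f_nonneg by simp
  have "(\<integral>x. h (T x) \<partial>mu V) = integral\<^sup>L (distr (mu V) borel T) h"
    by (rule integral_distr[symmetric]) auto
  thus "(\<integral>x. h (T x) \<partial>mu V) = (\<integral>x. f x * h x \<partial>mu V)"
    unfolding T_push using integral_density[of h "mu V" f] f_nonneg by simp
qed

lemma T_norm_sq_integrable: "integrable (mu V) (\<lambda>x. (norm (T x))\<^sup>2)"
proof -
  have "integrable (mu V) (\<lambda>x. f x * ln (f x) - f x + exp (c / 4 * (norm x)\<^sup>2))"
    by (intro Bochner_Integration.integrable_add Bochner_Integration.integrable_diff entropy f_integrable exp_norm_sq_integrable)
  hence "integrable (mu V) (\<lambda>x. f x * (c / 4 * (norm x)\<^sup>2))"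
  proof (rule Bochner_Integration.integrable_bound)
    show "AE x in mu V. norm (f x * (c / 4 * (norm x)\<^sup>2)) \<le> norm (f x * ln (f x) - f x + exp (c / 4 * (norm x)\<^sup>2))"
    proof (rule AE_I2)
      fix x
      have "0 \<le> f x * (c / 4 * (norm x)\<^sup>2)" using f_nonneg c_pos by simp
      thus "norm (f x * (c / 4 * (norm x)\<^sup>2)) \<le> norm (f x * ln (f x) - f x + exp (c / 4 * (norm x)\<^sup>2))"
        using young_entropy[OF f_nonneg, of x "c / 4 * (norm x)\<^sup>2"] by simp
    qed
  qed auto
  hence "integrable (mu V) (\<lambda>x. 4 / c * (f x * (c / 4 * (norm x)\<^sup>2)))" by (rule integrable_mult_right)
  hence "integrable (mu V) (\<lambda>x. f x * (norm x)\<^sup>2)" using c_pos by (simp add: mult.left_commute)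
  thus ?thesis using integral_T(1)[of "\<lambda>x. (norm x)\<^sup>2"] by simp
qed

lemma cost_integrable: "integrable (mu V) (\<lambda>x. (norm (x - T x))\<^sup>2)"
proof (rule Bochner_Integration.integrable_bound)
  show "integrable (mu V) (\<lambda>x. 2 * (norm x)\<^sup>2 + 2 * (norm (T x))\<^sup>2)"
    by (intro Bochner_Integration.integrable_add integrable_mult_right norm_sq_integrable T_norm_sq_integrable)
  show "AE x in mu V. norm ((norm (x - T x))\<^sup>2) \<le> norm (2 * (norm x)\<^sup>2 + 2 * (norm (T x))\<^sup>2)"
  proof (rule AE_I2)
    fix x
    have "0 \<le> (norm (x + T x))\<^sup>2" by simp
    hence "(norm (x - T x))\<^sup>2 \<le> 2 * (norm x)\<^sup>2 + 2 * (norm (T x))\<^sup>2"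
      by (simp add: power2_norm_eq_inner inner_diff_left inner_diff_right inner_add_left inner_add_right inner_commute)
    thus "norm ((norm (x - T x))\<^sup>2) \<le> norm (2 * (norm x)\<^sup>2 + 2 * (norm (T x))\<^sup>2)" by simp
  qed
qed auto

text \<open>A convex function lies above any of its tangents, and the tangent at \<open>x\<close> evaluated at \<open>0\<close> bounds
  \<open>\<phi> x\<close> from above by \<open>\<phi> 0 + c T x \<bullet> x\<close>.\<close>
lemma \<phi>_integrable: "integrable (mu V) \<phi>"
proof -
  have "\<exists>x0. \<forall>z. \<phi> x0 + (c *\<^sub>R T x0) \<bullet> (z - x0) \<le> \<phi> z"
  proof (rule ccontr)
    assume no: "\<nexists>x0. \<forall>z. \<phi> x0 + (c *\<^sub>R T x0) \<bullet> (z - x0) \<le> \<phi> z"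
    have "AE x in mu V. False" using AE_subgradient
    proof eventually_elim
      case (elim x) thus ?case using no by blast
    qed
    thus False using AE_False by simp
  qed
  then obtain x0 where x0: "\<And>z. \<phi> x0 + (c *\<^sub>R T x0) \<bullet> (z - x0) \<le> \<phi> z" by blast
  define b where "b = \<bar>\<phi> x0\<bar> + \<bar>(c *\<^sub>R T x0) \<bullet> x0\<bar> + (norm (c *\<^sub>R T x0))\<^sup>2 + \<bar>\<phi> 0\<bar>"
  define B where "B x = b + (norm x)\<^sup>2 + c * (norm x)\<^sup>2 + c * (norm (T x))\<^sup>2" for x
  have ab: "\<bar>a \<bullet> b\<bar> \<le> (norm a)\<^sup>2 + (norm b)\<^sup>2" for a b :: "real^'n"
  proof -
    have "\<bar>a \<bullet> b\<bar> \<le> norm a * norm b" by (rule Cauchy_Schwarz_ineq2)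
    also have "\<dots> \<le> (norm a)\<^sup>2 + (norm b)\<^sup>2"
    proof -
      have "2 * (norm a * norm b) \<le> (norm a)\<^sup>2 + (norm b)\<^sup>2" "0 \<le> norm a * norm b"
        using sum_squares_bound[of "norm a" "norm b"] by (simp_all add: mult.assoc)
      thus ?thesis by linarith
    qed
    finally show ?thesis .
  qed
  have "integrable (mu V) B"
    unfolding B_def
    by (intro Bochner_Integration.integrable_add integrable_mult_right norm_sq_integrable T_norm_sq_integrable integrable_const)
  thus ?thesis
  proof (rule Bochner_Integration.integrable_bound)
    show "AE x in mu V. norm (\<phi> x) \<le> norm (B x)"
      using AE_subgradient
    proof eventually_elim
      case (elim x)
      have "\<phi> x - (c *\<^sub>R T x) \<bullet> x \<le> \<phi> 0" using elim[rule_format, of 0] by simp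
      moreover have "(c *\<^sub>R T x) \<bullet> x \<le> c * (norm (T x))\<^sup>2 + c * (norm x)\<^sup>2"
        using mult_left_mono[OF order_trans[OF abs_ge_self ab[of "T x" x]], of c] c_pos by (simp add: distrib_left)
      moreover have "\<phi> 0 \<le> b" using zero_le_power2[of "norm (c *\<^sub>R T x0)"] unfolding b_def by linarith
      moreover have "0 \<le> (norm x)\<^sup>2" by simp
      ultimately have up: "\<phi> x \<le> B x" unfolding B_def by linarith
      have "\<phi> x0 + (c *\<^sub>R T x0) \<bullet> x - (c *\<^sub>R T x0) \<bullet> x0 \<le> \<phi> x"
        using x0[of x] by (simp add: inner_diff_right)
      moreover have "\<bar>(c *\<^sub>R T x0) \<bullet> x\<bar> \<le> (norm (c *\<^sub>R T x0))\<^sup>2 + (norm x)\<^sup>2" by (rule ab)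
      moreover have "0 \<le> c * (norm x)\<^sup>2" "0 \<le> c * (norm (T x))\<^sup>2" using c_pos by auto
      ultimately have lo: "- B x \<le> \<phi> x" unfolding B_def b_def
        by linarith
      have "\<bar>\<phi> x\<bar> \<le> B x" using up lo by (simp add: abs_le_iff)
      thus ?case by simp
    qed
  qed auto
qed

lemma g_integrable: "integrable (mu V) g"
  by (subst g_eq[abs_def])
    (intro Bochner_Integration.integrable_diff integrable_mult_right \<phi>_integrable norm_sq_integrable)

end

context radial_brenier begin

lemma mu_orthogonal_invariant:
  assumes \<tau>: "orthogonal_transformation \<tau>"
  shows "distr (mu V) borel \<tau> = mu V"
proof -
  have [measurable]: "\<tau> \<in> borel_measurable borel" by (rule orthogonal_measurable[OF \<tau>])
  have V\<tau>: "V (\<tau> x) = V x" for x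
    unfolding V_eq using orthogonal_transformation_norm[OF \<tau>] by simp
  have "distr (density lborel (\<lambda>x. ennreal (exp (- V (\<tau> x))))) borel \<tau> = density (distr lborel borel \<tau>) (\<lambda>x. ennreal (exp (- V x)))"
    by (rule density_distr[symmetric]) auto
  thus ?thesis unfolding mu_def V\<tau> lborel_orthogonal_invariant[OF \<tau>] .
qed

lemma mu_orthogonal_integral:
  fixes h :: "real^'n \<Rightarrow> real"
  assumes \<tau>: "orthogonal_transformation \<tau>" and [measurable]: "h \<in> borel_measurable borel"
  shows "integrable (mu V) (\<lambda>x. h (\<tau> x)) \<longleftrightarrow> integrable (mu V) h"
    and "(\<integral>x. h (\<tau> x) \<partial>mu V) = (\<integral>x. h x \<partial>mu V)"
proof -
  have [measurable]: "\<tau> \<in> borel_measurable borel" by (rule orthogonal_measurable[OF \<tau>])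
  have "integrable (mu V) (\<lambda>x. h (\<tau> x)) \<longleftrightarrow> integrable (distr (mu V) borel \<tau>) h"
    by (rule integrable_distr_eq[symmetric]) auto
  thus "integrable (mu V) (\<lambda>x. h (\<tau> x)) \<longleftrightarrow> integrable (mu V) h"
    unfolding mu_orthogonal_invariant[OF \<tau>] .
  have "(\<integral>x. h (\<tau> x) \<partial>mu V) = integral\<^sup>L (distr (mu V) borel \<tau>) h"
    by (rule integral_distr[symmetric]) auto
  thus "(\<integral>x. h (\<tau> x) \<partial>mu V) = (\<integral>x. h x \<partial>mu V)"
    unfolding mu_orthogonal_invariant[OF \<tau>] .
qed

lemma AE_T_orthogonal:
  assumes \<tau>: "orthogonal_transformation \<tau>" and [measurable]: "Measurable.pred borel Q"
    and AE: "AE x in mu V. Q (T x)"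
  shows "AE x in mu V. Q (\<tau> (T x))"
proof -
  have [measurable]: "\<tau> \<in> borel_measurable borel" by (rule orthogonal_measurable[OF \<tau>])
  have Tdist: "(AE x in mu V. R (T x)) \<longleftrightarrow> (AE x in mu V. f x > 0 \<longrightarrow> R x)" if [measurable]: "Measurable.pred borel R" for R
  proof -
    have "(AE x in mu V. R (T x)) \<longleftrightarrow> (AE x in distr (mu V) borel T. R x)"
      by (subst AE_distr_iff) auto
    also have "\<dots> \<longleftrightarrow> (AE x in mu V. f x > 0 \<longrightarrow> R x)"
      unfolding T_push by (subst AE_density) auto
    finally show ?thesis .
  qed
  have "AE x in mu V. f x > 0 \<longrightarrow> Q x" using AE Tdist[of Q] by simp
  hence "AE x in distr (mu V) borel \<tau>. f x > 0 \<longrightarrow> Q x"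
    unfolding mu_orthogonal_invariant[OF \<tau>] .
  hence "AE x in mu V. f (\<tau> x) > 0 \<longrightarrow> Q (\<tau> x)"
    by (subst (asm) AE_distr_iff) auto
  moreover have "f (\<tau> x) = f x" for x using f_radial \<tau> unfolding radial_def by blast
  ultimately show ?thesis using Tdist[of "\<lambda>x. Q (\<tau> x)"] by simp
qed

text \<open>Almost everywhere the value of the inf-convolution at \<open>T x\<close>.\<close>
definition K where "K x = g x + c / 2 * (norm (x - T x))\<^sup>2"

lemma K_integrable: "integrable (mu V) K"
  unfolding K_def by (intro Bochner_Integration.integrable_add integrable_mult_right g_integrable cost_integrable)

lemma K_meas [measurable]: "K \<in> borel_measurable borel"
  unfolding K_def by measurable

lemma AE_\<Lambda>_T: "AE x in mu V. \<Lambda> (T x) = K x"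
  using AE_inf_conv_T by eventually_elim (simp add: \<Lambda>_def K_def)

lemma AE_inf_conv_finite: "AE x in mu V. inf_conv c g (T x) \<noteq> -\<infinity>"
  using AE_inf_conv_T by eventually_elim simp

lemma \<Lambda>_T_integrable: "integrable (mu V) (\<lambda>x. \<Lambda> (T x))"
  and \<Lambda>_T_integral: "(\<integral>x. \<Lambda> (T x) \<partial>mu V) = (\<integral>x. K x \<partial>mu V)"
proof -
  show "integrable (mu V) (\<lambda>x. \<Lambda> (T x))"
    using K_integrable AE_\<Lambda>_T by (subst integrable_cong_AE[of _ _ K]) auto
  show "(\<integral>x. \<Lambda> (T x) \<partial>mu V) = (\<integral>x. K x \<partial>mu V)"
    using AE_\<Lambda>_T by (intro integral_cong_AE) auto
qed

text \<open>The pair \<open>g \<circ> \<tau>\<close>, \<open>L g \<circ> \<tau>\<close> satisfies the inequality of duality at \<open>(x, T x)\<close>, and by rotation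
  invariance of \<open>\<mu>\<close> and \<open>\<nu>\<close> both sides have the same integral as for \<open>g\<close>, where equality holds. So
  equality holds almost everywhere for \<open>g \<circ> \<tau>\<close> as well, that is, \<open>c T x\<close> is a subgradient
  of both convex functions.\<close>
lemma g_orthogonal_invariant:
  assumes \<tau>: "orthogonal_transformation \<tau>"
  shows "g (\<tau> x) = g x"
proof -
  have \<tau>_meas [measurable]: "\<tau> \<in> borel_measurable borel" by (rule orthogonal_measurable[OF \<tau>])
  have lin: "linear \<tau>" by (rule orthogonal_transformation_linear[OF \<tau>])
  have norm_\<tau>: "norm (\<tau> z) = norm z" for z by (rule orthogonal_transformation_norm[OF \<tau>])
  have norm_diff: "norm (\<tau> a - \<tau> b) = norm (a - b)" for a b
    using norm_\<tau>[of "a - b"] lin by (simp add: linear_diff)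
  have f\<tau>: "f (\<tau> z) = f z" for z using f_radial \<tau> unfolding radial_def by blast
  have g\<tau>: "integrable (mu V) (\<lambda>x. g (\<tau> x))" "(\<integral>x. g (\<tau> x) \<partial>mu V) = (\<integral>x. g x \<partial>mu V)"
    using mu_orthogonal_integral[OF \<tau> g_meas] g_integrable by auto
  have \<Lambda>\<tau>: "integrable (mu V) (\<lambda>x. \<Lambda> (\<tau> (T x)))" "(\<integral>x. \<Lambda> (\<tau> (T x)) \<partial>mu V) = (\<integral>x. K x \<partial>mu V)"
    using integral_T[of "\<lambda>x. \<Lambda> (\<tau> x)"] integral_T[of \<Lambda>] \<Lambda>_T_integrable \<Lambda>_T_integral
      mu_orthogonal_integral[OF \<tau>, of "\<lambda>x. f x * \<Lambda> x"] by (auto simp: f\<tau>)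
  have fin: "AE x in mu V. inf_conv c g (\<tau> (T x)) \<noteq> -\<infinity>"
    by (rule AE_T_orthogonal[OF \<tau> _ AE_inf_conv_finite]) measurable
  define u where "u x = g (\<tau> x) + c / 2 * (norm (x - T x))\<^sup>2 - \<Lambda> (\<tau> (T x))" for x
  have u_nonneg: "AE x in mu V. 0 \<le> u x"
    using fin
  proof eventually_elim
    case (elim x)
    show ?case using inf_conv_finite_le(2)[OF elim, of "\<tau> x"] unfolding u_def \<Lambda>_def norm_diff by simp
  qed
  have c2: "integrable (mu V) (\<lambda>x. c / 2 * (norm (x - T x))\<^sup>2)"
    by (rule integrable_mult_right[OF cost_integrable])
  have u_int: "integrable (mu V) u"
    unfolding u_def by (intro Bochner_Integration.integrable_add Bochner_Integration.integrable_diff g\<tau> \<Lambda>\<tau> c2)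
  have "(\<integral>x. u x \<partial>mu V) = (\<integral>x. g x \<partial>mu V) + (\<integral>x. c / 2 * (norm (x - T x))\<^sup>2 \<partial>mu V) - (\<integral>x. K x \<partial>mu V)"
    unfolding u_def using g\<tau> \<Lambda>\<tau> c2 by simp
  also have "(\<integral>x. K x \<partial>mu V) = (\<integral>x. g x \<partial>mu V) + (\<integral>x. c / 2 * (norm (x - T x))\<^sup>2 \<partial>mu V)"
    unfolding K_def by (rule Bochner_Integration.integral_add[OF g_integrable c2])
  finally have "(\<integral>x. u x \<partial>mu V) = 0" by simp
  \<comment> \<open>The nonnegative duality gap \<open>u\<close> of the rotated potential has integral \<open>0\<close>.\<close>
  hence u0: "AE x in mu V. u x = 0"
    using integral_nonneg_eq_0_iff_AE[OF u_int u_nonneg] by simp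
  define \<phi>\<tau> where "\<phi>\<tau> x = c / 2 * (norm x)\<^sup>2 + g (\<tau> x)" for x
  have \<phi>\<tau>: "\<phi>\<tau> x = \<phi> (\<tau> x)" for x unfolding \<phi>\<tau>_def \<phi>_def norm_\<tau> ..
  have sub: "AE x in mu V. (\<forall>z. \<phi> x + (c *\<^sub>R T x) \<bullet> (z - x) \<le> \<phi> z) \<and> (\<forall>z. \<phi>\<tau> x + (c *\<^sub>R T x) \<bullet> (z - x) \<le> \<phi>\<tau> z)"
    using AE_subgradient u0 fin
  proof eventually_elim
    case (elim x)
    have "\<phi>\<tau> x + (c *\<^sub>R T x) \<bullet> (z - x) \<le> \<phi>\<tau> z" for z
    proof -
      have "g (\<tau> x) + c / 2 * (norm (x - T x))\<^sup>2 = \<Lambda> (\<tau> (T x))" using elim(2) unfolding u_def by simp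
      also have "\<dots> \<le> g (\<tau> z) + c / 2 * (norm (z - T x))\<^sup>2"
        using inf_conv_finite_le(2)[OF elim(3), of "\<tau> z"] unfolding \<Lambda>_def norm_diff .
      finally show ?thesis
        using minimizer_iff_subgradient[of "\<lambda>x. g (\<tau> x)" x "T x" z] unfolding \<phi>\<tau>_def by blast
    qed
    thus ?case using elim(1) by blast
  qed
  have cont\<tau>: "continuous_on UNIV \<phi>\<tau>"
    unfolding \<phi>\<tau>[abs_def]
    by (rule continuous_on_compose2[OF \<phi>_cont]) (use lin in \<open>auto intro: linear_continuous_on linear_conv_bounded_linear[THEN iffD1]\<close>)
  have "\<phi> x - \<phi>\<tau> x = \<phi> 0 - \<phi>\<tau> 0"
    by (rule common_subgradients_imp_diff_const[OF \<phi>_cont cont\<tau>]) (use sub in \<open>simp only: AE_mu_iff\<close>)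
  moreover have "\<phi>\<tau> 0 = \<phi> 0" unfolding \<phi>\<tau> using lin by (simp add: linear_0)
  ultimately show ?thesis unfolding \<phi>\<tau>_def \<phi>_def by simp
qed

lemma g_radial: "radial g"
  unfolding radial_def using g_orthogonal_invariant by blast

lemma W2_le: "(W2 \<nu> (mu V))\<^sup>2 \<le> ennreal (\<integral>x. (norm (x - T x))\<^sup>2 \<partial>mu V)"
proof -
  define I where "I = (\<integral>x. (norm (x - T x))\<^sup>2 \<partial>mu V)"
  have I: "I \<ge> 0" unfolding I_def by (rule Bochner_Integration.integral_nonneg) simp
  define \<pi> where "\<pi> = distr (mu V) (borel \<Otimes>\<^sub>M borel) (\<lambda>x. (T x, x))"
  have m: "(\<lambda>x. (T x, x)) \<in> mu V \<rightarrow>\<^sub>M borel \<Otimes>\<^sub>M borel" by measurable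
  have "distr \<pi> borel fst = \<nu>" unfolding \<pi>_def \<nu>_def T_push[symmetric]
    by (subst distr_distr) (auto simp: comp_def)
  moreover have "distr \<pi> borel snd = mu V" unfolding \<pi>_def
    by (subst distr_distr) (auto simp: comp_def intro: distr_cong[where g=id] distr_id2 )
  moreover have "prob_space \<pi>" unfolding \<pi>_def by (rule prob_space_distr[OF m])
  ultimately have c: "\<pi> \<in> couplings \<nu> (mu V)" unfolding couplings_def by (simp add: \<pi>_def)
  have "(\<integral>\<^sup>+p. ennreal ((norm (fst p - snd p))\<^sup>2) \<partial>\<pi>) = (\<integral>\<^sup>+x. ennreal ((norm (x - T x))\<^sup>2) \<partial>mu V)"
    unfolding \<pi>_def by (subst nn_integral_distr[OF m]) (auto simp: norm_minus_commute)
  also have "\<dots> = ennreal I" unfolding I_def by (rule nn_integral_eq_integral[OF cost_integrable]) simp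
  finally have "W2 \<nu> (mu V) \<le> ennpowr (ennreal I) (1/2)"
    unfolding W2_def using INF_lower[OF c, of "\<lambda>\<pi>. ennpowr (\<integral>\<^sup>+p. ennreal ((norm (fst p - snd p))\<^sup>2) \<partial>\<pi>) (1/2)"] by simp
  also have "\<dots> = ennreal (sqrt I)" unfolding ennpowr_def using I by (simp add: powr_half_sqrt)
  finally have "(W2 \<nu> (mu V))\<^sup>2 \<le> (ennreal (sqrt I))\<^sup>2" by (rule power_mono) simp
  also have "\<dots> = ennreal I" using I by (simp add: ennreal_power)
  finally show ?thesis unfolding I_def .
qed

text \<open>The Gibbs variational inequality for \<open>\<nu>\<close> and the probability density \<open>exp (L g) / Z\<close>.\<close>
lemma gibbs:
  assumes E: "integrable (mu V) (exp_inf_conv c g)" and Z: "Z = (\<integral>x. exp_inf_conv c g x \<partial>mu V)" "Z > 0"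
  shows "(\<integral>x. K x \<partial>mu V) - ln Z \<le> (\<integral>x. f x * ln (f x) \<partial>mu V)"
proof -
  have fin: "AE x in mu V. f x > 0 \<longrightarrow> inf_conv c g x \<noteq> -\<infinity>"
  proof -
    have "AE x in distr (mu V) borel T. inf_conv c g x \<noteq> -\<infinity>"
      by (subst AE_distr_iff) (use AE_inf_conv_finite in auto)
    thus ?thesis unfolding T_push by (subst (asm) AE_density) auto
  qed
  have f\<Lambda>: "integrable (mu V) (\<lambda>x. f x * \<Lambda> x)" "(\<integral>x. f x * \<Lambda> x \<partial>mu V) = (\<integral>x. K x \<partial>mu V)"
    using integral_T[of \<Lambda>] \<Lambda>_T_integrable \<Lambda>_T_integral by auto
  define rhs where "rhs x = f x * \<Lambda> x - ln Z * f x + (f x - exp_inf_conv c g x / Z)" for x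
  have "(\<integral>x. rhs x \<partial>mu V) \<le> (\<integral>x. f x * ln (f x) \<partial>mu V)"
  proof (rule integral_mono_AE[OF _ entropy])
    show "integrable (mu V) rhs" unfolding rhs_def
      by (intro Bochner_Integration.integrable_add Bochner_Integration.integrable_diff f\<Lambda> integrable_mult_right f_integrable integrable_divide_zero E)
    show "AE x in mu V. rhs x \<le> f x * ln (f x)"
      using fin
    proof eventually_elim
      case (elim x)
      have E0: "exp_inf_conv c g x \<ge> 0" unfolding exp_inf_conv_def by simp
      show ?case
      proof (cases "f x > 0")
        case True
        hence Ex: "exp_inf_conv c g x = exp (\<Lambda> x)" using elim unfolding exp_inf_conv_def \<Lambda>_def by simp
        have "f x * (\<Lambda> x - ln Z) \<le> f x * ln (f x) - f x + exp (\<Lambda> x - ln Z)"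
          by (rule young_entropy) (use True in simp)
        also have "exp (\<Lambda> x - ln Z) = exp_inf_conv c g x / Z" unfolding Ex using Z(2) by (simp add: exp_diff)
        finally show ?thesis unfolding rhs_def by (simp add: algebra_simps)
      next
        case False
        hence "f x = 0" using f_nonneg[of x] by simp
        thus ?thesis unfolding rhs_def using E0 Z(2) by simp
      qed
    qed
  qed
  also have "(\<integral>x. rhs x \<partial>mu V) = (\<integral>x. K x \<partial>mu V) - ln Z"
    unfolding rhs_def using f\<Lambda> f_integrable f_integral E Z by simp
  finally show ?thesis .
qed

lemma deficit_ge:
  assumes E: "integrable (mu V) (exp_inf_conv c g)" and Z: "Z = (\<integral>x. exp_inf_conv c g x \<partial>mu V)" "Z > 0"
  shows "ereal ((\<integral>x. g x \<partial>mu V) - ln Z) \<le> tal_deficit c (mu V) \<nu>"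
proof -
  define I where "I = (\<integral>x. (norm (x - T x))\<^sup>2 \<partial>mu V)"
  define H where "H = (\<integral>x. f x * ln (f x) \<partial>mu V)"
  have I: "I \<ge> 0" unfolding I_def by (rule Bochner_Integration.integral_nonneg) simp
  have H: "rel_entropy \<nu> (mu V) = ereal H"
    unfolding \<nu>_def H_def by (subst rel_entropy_density[OF mu_prob]) (use f_nonneg entropy in auto)
  obtain w where w: "(W2 \<nu> (mu V))\<^sup>2 = ennreal w" "w \<ge> 0" "w \<le> I"
  proof -
    have le: "(W2 \<nu> (mu V))\<^sup>2 \<le> ennreal I" using W2_le unfolding I_def .
    hence "(W2 \<nu> (mu V))\<^sup>2 < \<infinity>" using ennreal_less_top[of I] by (auto simp: order_le_less_trans)
    then obtain w where "w \<ge> 0" "(W2 \<nu> (mu V))\<^sup>2 = ennreal w" by (cases "(W2 \<nu> (mu V))\<^sup>2") auto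
    thus ?thesis using that le I by (auto simp: ennreal_le_iff)
  qed
  have "(\<integral>x. K x \<partial>mu V) = (\<integral>x. g x \<partial>mu V) + c / 2 * I"
    unfolding K_def I_def using g_integrable cost_integrable by simp
  hence "(\<integral>x. g x \<partial>mu V) - ln Z \<le> H - c / 2 * I" using gibbs[OF E Z] unfolding H_def by simp
  also have "\<dots> \<le> H - c / 2 * w" using w(3) c_pos by simp
  finally show ?thesis unfolding tal_deficit_def H w(1) using w(2) by simp
qed

end

section \<open>The stability estimate\<close>

context radial_brenier begin

text \<open>Passing to the distribution of \<open>|x|\<close> turns the claim into the estimate on the half-line.\<close>
lemma stability:
  "L1_discrepancy c (mu V) g \<le> ennreal (4 * (real CARD('n) + 2)) * ennpowr (e2ennreal (tal_deficit c (mu V) \<nu>)) (1/2)"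
proof -
  define d where "d = CARD('n) - 1"
  define N where "N = CARD('n) * unit_ball_vol CARD('n)"
  define e :: "real^'n" where "e = axis (SOME i. True) 1"
  have e: "norm e = 1" unfolding e_def by simp
  have N: "N > 0" unfolding N_def by simp
  define w where "w r = N * r ^ d * exp (- v r) * indicator {0<..} r" for r :: real
  have w_meas [measurable]: "w \<in> borel_measurable borel" unfolding w_def by measurable
  have w_nonneg: "w r \<ge> 0" for r unfolding w_def using N by (auto simp: indicator_def)
  have dist: "distr (mu V) borel norm = density lborel (\<lambda>r. ennreal (w r))"
    unfolding w_def N_def d_def by (rule distr_norm_radial[OF V_eq v_meas])
  interpret rd: radial_density d N c v v'
  proof
    have "prob_space (distr (mu V) borel norm)" by (rule prob_space_distr) simp
    hence "emeasure (density lborel (\<lambda>r. ennreal (w r))) UNIV = 1"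
      using prob_space.emeasure_space_1[of "distr (mu V) borel norm"] unfolding dist by simp
    thus "(\<integral>\<^sup>+r. ennreal (N * r ^ d * exp (- v r) * indicator {0<..} r) \<partial>lborel) = 1"
      by (simp add: emeasure_density w_def)
  qed (fact N c_pos v_deriv v'_cont v_convex v'0)+
  have w_m: "w r = rd.m r * indicator {0<..} r" for r unfolding w_def rd.m_def ..
  have tr_int: "integrable (mu V) (\<lambda>x. h (norm x)) \<longleftrightarrow> set_integrable lborel {0<..} (\<lambda>r. h r * rd.m r)"
    and tr_val: "(\<integral>x. h (norm x) \<partial>mu V) = (LINT r:{0<..}|lborel. h r * rd.m r)"
    if [measurable]: "h \<in> borel_measurable borel" for h :: "real \<Rightarrow> real"
  proof -
    have "integrable (mu V) (\<lambda>x. h (norm x)) \<longleftrightarrow> integrable (distr (mu V) borel norm) h"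
      by (rule integrable_distr_eq[symmetric]) auto
    thus "integrable (mu V) (\<lambda>x. h (norm x)) \<longleftrightarrow> set_integrable lborel {0<..} (\<lambda>r. h r * rd.m r)"
      unfolding dist using integrable_density[of h lborel w] w_nonneg
      by (simp add: set_integrable_def w_m mult_ac)
    have "(\<integral>x. h (norm x) \<partial>mu V) = integral\<^sup>L (distr (mu V) borel norm) h"
      by (rule integral_distr[symmetric]) auto
    thus "(\<integral>x. h (norm x) \<partial>mu V) = (LINT r:{0<..}|lborel. h r * rd.m r)"
      unfolding dist using integral_density[of h lborel w] w_nonneg
      by (simp add: set_lebesgue_integral_def w_m mult_ac)
  qed
  have tr_nn: "(\<integral>\<^sup>+x. ennreal (h (norm x)) \<partial>mu V) = (\<integral>\<^sup>+r. ennreal (h r * rd.m r * indicator {0<..} r) \<partial>lborel)"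
    if [measurable]: "h \<in> borel_measurable borel" and "\<And>r. h r \<ge> 0" for h :: "real \<Rightarrow> real"
  proof -
    have "(\<integral>\<^sup>+x. ennreal (h (norm x)) \<partial>mu V) = (\<integral>\<^sup>+r. ennreal (h r) \<partial>distr (mu V) borel norm)"
      by (rule nn_integral_distr[symmetric]) auto
    also have "\<dots> = (\<integral>\<^sup>+r. ennreal (w r) * ennreal (h r) \<partial>lborel)"
      unfolding dist by (rule nn_integral_density) auto
    also have "\<dots> = (\<integral>\<^sup>+r. ennreal (h r * rd.m r * indicator {0<..} r) \<partial>lborel)"
      using that(2) w_nonneg by (intro nn_integral_cong) (simp add: ennreal_mult'[symmetric] w_m mult_ac)
    finally show ?thesis .
  qed

  define \<gamma> where "\<gamma> r = g (r *\<^sub>R e)" for r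
  define D where "D = {t. inf_conv c g (t *\<^sub>R e) \<noteq> -\<infinity>}"
  define l where "l t = real_of_ereal (inf_conv c g (t *\<^sub>R e))" for t
  define E where "E t = exp_inf_conv c g (t *\<^sub>R e)" for t
  have g_\<gamma>: "g x = \<gamma> (norm x)" for x
    unfolding \<gamma>_def by (rule radial_eq[OF g_radial]) (simp add: e)
  have radE: "radial (exp_inf_conv c g)"
    unfolding radial_def exp_inf_conv_def using inf_conv_orthogonal[OF g_radial] by auto
  have E_eq: "exp_inf_conv c g x = E (norm x)" for x
    unfolding E_def by (rule radial_eq[OF radE]) (simp add: e)
  have [measurable]: "\<gamma> \<in> borel_measurable borel" unfolding \<gamma>_def by measurable
  have [measurable]: "E \<in> borel_measurable borel" unfolding E_def by measurable
  have E_l: "E t = (if t \<in> D then exp (l t) else 0)" for t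
    unfolding E_def D_def l_def exp_inf_conv_def by simp

  \<comment> \<open>The set \<open>D\<close> contains the norm of \<open>T x\<close> for almost every \<open>x\<close>, and \<open>\<nu>\<close> has no atom at the origin.\<close>
  obtain t0 where t0: "t0 \<in> D" "t0 > 0"
  proof -
    have "AE x in distr (mu V) borel T. x \<noteq> 0"
    proof -
      have "AE x in mu V. x \<noteq> 0" unfolding AE_mu_iff by (rule AE_lborel_singleton)
      thus ?thesis unfolding T_push by (subst AE_density) auto
    qed
    hence "AE x in mu V. T x \<noteq> 0" by (subst (asm) AE_distr_iff) auto
    hence ae: "AE x in mu V. T x \<noteq> 0 \<and> inf_conv c g (T x) \<noteq> -\<infinity>"
      using AE_inf_conv_finite by eventually_elim simp
    have "\<exists>y. y \<noteq> 0 \<and> inf_conv c g y \<noteq> -\<infinity>"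
    proof (rule ccontr)
      assume no: "\<nexists>y. y \<noteq> 0 \<and> inf_conv c g y \<noteq> -\<infinity>"
      have "AE x in mu V. False" using ae
      proof eventually_elim
        case (elim x) thus ?case using no by blast
      qed
      thus False using AE_False by simp
    qed
    then obtain y where y: "y \<noteq> 0" "inf_conv c g y \<noteq> -\<infinity>" by blast
    have ne: "norm y = norm (norm y *\<^sub>R e)" using e by simp
    obtain \<tau> where \<tau>: "orthogonal_transformation \<tau>" "\<tau> y = norm y *\<^sub>R e"
      using orthogonal_transformation_exists[OF ne] by blast
    have "norm y \<in> D" unfolding D_def using inf_conv_orthogonal[OF g_radial \<tau>(1), of c y] \<tau>(2) y(2) by simp
    thus ?thesis using that y(1) by simp
  qed

  have l_cont: "{0..R} \<subseteq> D \<and> continuous_on {0..R} l" if R: "0 < R" "R' \<in> D" "R < R'" for R R'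
  proof -
    define k where "k t = c / 2 * t\<^sup>2 - real_of_ereal (inf_conv c g (t *\<^sub>R e))" for t
    have conv: "convex D" "convex_on D k"
      using inf_conv_line_concave[OF e, of c g] unfolding D_def k_def by auto
    have "inf_conv c g (- (R' *\<^sub>R e)) = inf_conv c g (R' *\<^sub>R e)"
      by (rule inf_conv_orthogonal[OF g_radial]) (simp add: orthogonal_transformation_neg)
    hence "- R' \<in> D" using R(2) unfolding D_def by simp
    hence "closed_segment (- R') R' \<subseteq> D" using conv(1) R(2) by (simp add: convex_contains_segment)
    hence sub: "{- R'..R'} \<subseteq> D" using R by (simp add: closed_segment_eq_real_ivl)
    have "convex_on {- R'<..<R'} k"
      by (rule convex_on_subset[OF conv(2)]) (use sub in auto)
    hence "continuous_on {- R'<..<R'} k" by (intro convex_on_continuous) auto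
    hence "continuous_on {0..R} k" by (rule continuous_on_subset) (use R in auto)
    hence "continuous_on {0..R} (\<lambda>t. c / 2 * t\<^sup>2 - k t)" by (intro continuous_intros)
    hence "continuous_on {0..R} l" unfolding k_def l_def by simp
    thus ?thesis using sub R by auto
  qed
  have dual: "l t \<le> \<gamma> r + c / 2 * (t - r)\<^sup>2" if "r > 0" "t \<in> D" for r t
  proof -
    have "r *\<^sub>R e - t *\<^sub>R e = (r - t) *\<^sub>R e" by (simp add: scaleR_diff_left)
    hence "(norm (r *\<^sub>R e - t *\<^sub>R e))\<^sup>2 = (t - r)\<^sup>2" using e by (simp add: power2_commute)
    thus ?thesis using inf_conv_finite_le(2)[of c g "t *\<^sub>R e" "r *\<^sub>R e"] that(2)
      unfolding D_def l_def \<gamma>_def by simp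
  qed
  have \<gamma>_int: "set_integrable lborel {0<..} (\<lambda>r. \<gamma> r * rd.m r)"
    using tr_int[of \<gamma>] g_integrable unfolding g_\<gamma>[abs_def] by simp

  define Z where "Z = (\<integral>x. exp_inf_conv c g x \<partial>mu V)"
  have Z: "Z = (LINT t:{0<..}|lborel. E t * rd.m t)"
    unfolding Z_def E_eq by (rule tr_val) measurable
  have J: "(\<integral>x. g x \<partial>mu V) = (LINT r:{0<..}|lborel. \<gamma> r * rd.m r)"
    using tr_val[of \<gamma>] unfolding g_\<gamma>[symmetric] by simp
  note st = rd.stability_halfline[OF t0 l_cont \<gamma>_int dual E_l, folded Z J]
  have E_int: "integrable (mu V) (exp_inf_conv c g)"
    unfolding E_eq[abs_def] using tr_int[of E] st(1) by simp
  define \<delta> where "\<delta> = (\<integral>x. g x \<partial>mu V) - ln Z"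
  have \<delta>: "\<delta> \<ge> 0" "ereal \<delta> \<le> tal_deficit c (mu V) \<nu>"
    using st(3) deficit_ge[OF E_int Z_def] st(2) unfolding \<delta>_def by auto
  have "L1_discrepancy c (mu V) g = (\<integral>\<^sup>+r. ennreal (\<bar>1 - E r / Z\<bar> * rd.m r * indicator {0<..} r) \<partial>lborel)"
    unfolding L1_discrepancy_def Z_def[symmetric] E_eq by (rule tr_nn) auto
  also have "\<dots> \<le> ennreal (4 * (real d + 3) * sqrt \<delta>)" using st(4) unfolding \<delta>_def by simp
  also have "4 * (real d + 3) * sqrt \<delta> = 4 * (real CARD('n) + 2) * sqrt \<delta>" unfolding d_def by (simp add: of_nat_diff Suc_leI)
  also have "ennreal (4 * (real CARD('n) + 2) * sqrt \<delta>) = ennreal (4 * (real CARD('n) + 2)) * ennreal (sqrt \<delta>)"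
    by (simp add: ennreal_mult')
  also have "\<dots> \<le> ennreal (4 * (real CARD('n) + 2)) * ennpowr (e2ennreal (tal_deficit c (mu V) \<nu>)) (1/2)"
  proof (rule mult_left_mono)
    define t where "t = e2ennreal (tal_deficit c (mu V) \<nu>)"
    have t: "ennreal \<delta> \<le> t" unfolding t_def using e2ennreal_mono[OF \<delta>(2)] by (simp add: ennreal.abs_eq e2ennreal_ereal)
    show "ennreal (sqrt \<delta>) \<le> ennpowr t (1/2)"
    proof (cases t)
      case (real s)
      hence "\<delta> \<le> s" using t \<delta> by (simp add: ennreal_le_iff)
      thus ?thesis using real unfolding ennpowr_def by (simp add: powr_half_sqrt ennreal_leI)
    qed (simp add: ennpowr_def)
  qed simp
  finally show ?thesis .
qed

end

lemma stability_of_talagrand: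
  fixes V :: "real^'n \<Rightarrow> real"
  assumes adm: "admissible V c \<nu>" and br: "brenier_potential c (mu V) \<nu> g"
  shows "stability_estimate (4 * (real CARD('n) + 2)) (1/2) c (mu V) \<nu> g"
proof -
  have V: "c > 0" "C2 V" "radial V" "\<And>x. psd (hessian V x - c *\<^sub>R mat 1)" "prob_space (mu V)"
    using adm unfolding admissible_def by auto
  obtain f where f: "f \<in> borel_measurable borel" "\<And>x. f x \<ge> 0" "radial f" "\<nu> = density (mu V) (\<lambda>x. ennreal (f x))"
    using adm unfolding admissible_def by blast
  obtain T where T: "T \<in> borel_measurable borel"
    "AE x in mu V. g differentiable (at x) \<and> T x = x + (1 / c) *\<^sub>R grad g x" "distr (mu V) borel T = \<nu>"
    and conv: "convex_on UNIV (\<lambda>x. c / 2 * (norm x)\<^sup>2 + g x)"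
    using br unfolding brenier_potential_def by blast
  obtain v v' :: "real \<Rightarrow> real" where v: "\<And>x. V x = v (norm x)"
    "\<And>r. (v has_real_derivative v' r) (at r)" "continuous_on UNIV v'"
    "\<And>r s. v r + v' r * (s - r) + c / 2 * (s - r)\<^sup>2 \<le> v s" "v' 0 = 0"
    using radial_profile[OF V(2,3,4)] by blast
  have ent: "rel_entropy \<nu> (mu V) = (if integrable (mu V) (\<lambda>x. f x * ln (f x)) then ereal (\<integral>x. f x * ln (f x) \<partial>mu V) else \<infinity>)"
    unfolding f(4) by (rule rel_entropy_density[OF V(5)]) (use f in \<open>auto simp: mu_def\<close>)
  show ?thesis
  proof (cases "integrable (mu V) (\<lambda>x. f x * ln (f x))")
    case True
    interpret radial_brenier V v v' c g T f
      by (rule radial_brenier.intro) (fact V v T(1,2) f conv True T(3)[unfolded f(4)])+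
    show ?thesis using stability unfolding stability_estimate_def \<nu>_def f(4) .
  next
    case False
    hence "tal_deficit c (mu V) \<nu> = \<infinity>" unfolding tal_deficit_def using ent by simp
    hence "ennreal (4 * (real CARD('n) + 2)) * ennpowr (e2ennreal (tal_deficit c (mu V) \<nu>)) (1/2) = \<infinity>"
      by (simp add: ennpowr_def ennreal_mult_eq_top_iff)
    thus ?thesis unfolding stability_estimate_def by simp
  qed
qed

section \<open>Gaussian dilations and the optimal exponent\<close>

lemma has_derivative_scaled_norm_sq:
  fixes x :: "'a::real_inner"
  shows "((\<lambda>x. a * (norm x)\<^sup>2) has_derivative (\<lambda>h. (2 * a) *\<^sub>R x \<bullet> h)) (at x)"
  unfolding power2_norm_eq_inner
  by (auto intro!: derivative_eq_intros simp: inner_commute)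

lemma grad_scaled_norm_sq:
  fixes x :: "real^'n"
  shows "grad (\<lambda>x. a * (norm x)\<^sup>2) x = (2 * a) *\<^sub>R x"
proof -
  have "frechet_derivative (\<lambda>x. a * (norm x)\<^sup>2) (at x) = (\<lambda>h. (2 * a) *\<^sub>R x \<bullet> h)"
    by (rule frechet_derivative_at[symmetric, OF has_derivative_scaled_norm_sq])
  thus ?thesis unfolding grad_def by (simp add: vec_eq_iff inner_axis)
qed

lemma differentiable_scaled_norm_sq:
  fixes x :: "'a::real_inner"
  shows "(\<lambda>x. a * (norm x)\<^sup>2) differentiable (at x)"
  using has_derivative_scaled_norm_sq unfolding differentiable_def by blast

lemma grad_scaled_norm_sq_fun: "grad (\<lambda>x::real^'n. a * (norm x)\<^sup>2) = (\<lambda>x. (2 * a) *\<^sub>R x)"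
  using grad_scaled_norm_sq by auto

lemma hessian_scaled_norm_sq:
  fixes x :: "real^'n"
  shows "hessian (\<lambda>x. a * (norm x)\<^sup>2) x = (2 * a) *\<^sub>R mat 1"
proof -
  have d: "((\<lambda>x::real^'n. (2 * a) *\<^sub>R x) has_derivative (\<lambda>h. (2 * a) *\<^sub>R h)) (at x)"
    by (auto intro!: derivative_eq_intros)
  have "frechet_derivative (\<lambda>x::real^'n. (2 * a) *\<^sub>R x) (at x) = (\<lambda>h. (2 * a) *\<^sub>R h)"
    by (rule frechet_derivative_at[symmetric, OF d])
  thus ?thesis unfolding hessian_def jacobian_def grad_scaled_norm_sq_fun
    by (simp add: matrix_def mat_def vec_eq_iff axis_def)
qed

lemma convex_on_scaled_norm_sq:
  assumes "a \<ge> 0"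
  shows "convex_on UNIV (\<lambda>x::'a::real_inner. a * (norm x)\<^sup>2)"
proof (rule convex_onI)
  fix t :: real and x y :: 'a
  assume t: "0 < t" "t < 1"
  have "(1 - t) * (norm x)\<^sup>2 + t * (norm y)\<^sup>2 - (norm ((1 - t) *\<^sub>R x + t *\<^sub>R y))\<^sup>2 = t * (1 - t) * (norm (x - y))\<^sup>2"
    by (simp add: power2_norm_eq_inner inner_diff_left inner_diff_right inner_add_left inner_add_right inner_commute algebra_simps)
  moreover have "0 \<le> t * (1 - t) * (norm (x - y))\<^sup>2" using t by simp
  ultimately have "(norm ((1 - t) *\<^sub>R x + t *\<^sub>R y))\<^sup>2 \<le> (1 - t) * (norm x)\<^sup>2 + t * (norm y)\<^sup>2" by linarith
  hence "a * (norm ((1 - t) *\<^sub>R x + t *\<^sub>R y))\<^sup>2 \<le> a * ((1 - t) * (norm x)\<^sup>2 + t * (norm y)\<^sup>2)"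
    using assms by (rule mult_left_mono)
  thus "a * (norm ((1 - t) *\<^sub>R x + t *\<^sub>R y))\<^sup>2 \<le> (1 - t) * (a * (norm x)\<^sup>2) + t * (a * (norm y)\<^sup>2)"
    by (simp add: algebra_simps)
qed simp

lemma norm_sq_diff_scaled:
  fixes x y :: "'a::real_inner"
  shows "(norm (x - a *\<^sub>R y))\<^sup>2 = (norm x)\<^sup>2 - 2 * a * (x \<bullet> y) + a\<^sup>2 * (norm y)\<^sup>2"
  unfolding power2_norm_eq_inner power2_eq_square[of a]
  by (simp add: inner_diff_left inner_diff_right inner_commute[of y x] algebra_simps)

text \<open>With this normalisation \<open>exp (- gauss x)\<close> has integral \<open>1\<close> in every dimension, and the convexity
  constant is \<open>c = 2 \<pi>\<close>.\<close>
definition gauss :: "real^'n \<Rightarrow> real" where "gauss x = pi * (norm x)\<^sup>2"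

lemma gauss_meas [measurable]: "gauss \<in> borel_measurable borel"
  unfolding gauss_def[abs_def] by measurable

lemma gauss_mu_nn:
  assumes [measurable]: "h \<in> borel_measurable borel" and "\<And>x. h x \<ge> 0"
  shows "(\<integral>\<^sup>+x. ennreal (h x) \<partial>mu (gauss :: real^'n \<Rightarrow> real)) = (\<integral>\<^sup>+x. ennreal (exp (- pi * (norm x)\<^sup>2) * h x) \<partial>lborel)"
  unfolding mu_def gauss_def using assms by (subst nn_integral_density) (auto simp: ennreal_mult)

lemma gauss_mu_exp:
  assumes "a < pi"
  shows "integrable (mu (gauss :: real^'n \<Rightarrow> real)) (\<lambda>x. exp (a * (norm x)\<^sup>2))"
    and "(\<integral>x. exp (a * (norm x)\<^sup>2) \<partial>mu (gauss :: real^'n \<Rightarrow> real)) = sqrt (pi / (pi - a)) ^ CARD('n)"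
proof -
  have "(\<integral>\<^sup>+x. ennreal (exp (a * (norm x)\<^sup>2)) \<partial>mu (gauss :: real^'n \<Rightarrow> real)) = (\<integral>\<^sup>+(x::real^'n). ennreal (exp (- (pi - a) * (norm x)\<^sup>2)) \<partial>lborel)"
    by (subst gauss_mu_nn) (auto simp: exp_add[symmetric] algebra_simps)
  also have "\<dots> = ennreal (sqrt (pi / (pi - a)) ^ CARD('n))"
    using gaussian_nn_integral[of "pi - a", where 'a="real^'n"] assms by simp
  finally have 1: "(\<integral>\<^sup>+x. ennreal (exp (a * (norm x)\<^sup>2)) \<partial>mu (gauss :: real^'n \<Rightarrow> real)) = ennreal (sqrt (pi / (pi - a)) ^ CARD('n))" .
  show i: "integrable (mu (gauss :: real^'n \<Rightarrow> real)) (\<lambda>x. exp (a * (norm x)\<^sup>2))"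
    by (rule integrableI_nonneg) (use 1 in \<open>auto simp: mu_def\<close>)
  have "ennreal (\<integral>x. exp (a * (norm x)\<^sup>2) \<partial>mu (gauss :: real^'n \<Rightarrow> real)) = ennreal (sqrt (pi / (pi - a)) ^ CARD('n))"
    using nn_integral_eq_integral[OF i] 1 by simp
  thus "(\<integral>x. exp (a * (norm x)\<^sup>2) \<partial>mu (gauss :: real^'n \<Rightarrow> real)) = sqrt (pi / (pi - a)) ^ CARD('n)"
    using assms by (subst (asm) ennreal_inj) (auto intro: Bochner_Integration.integral_nonneg)
qed

lemma gauss_prob: "prob_space (mu (gauss :: real^'n \<Rightarrow> real))"
proof
  have "emeasure (mu (gauss :: real^'n \<Rightarrow> real)) (space (mu (gauss :: real^'n \<Rightarrow> real))) = (\<integral>\<^sup>+x. ennreal 1 \<partial>mu (gauss :: real^'n \<Rightarrow> real))"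
    by simp
  also have "\<dots> = (\<integral>\<^sup>+(x::real^'n). ennreal (exp (- pi * (norm x)\<^sup>2)) \<partial>lborel)"
    by (subst gauss_mu_nn) auto
  also have "\<dots> = 1" using gaussian_nn_integral[of pi, where 'a="real^'n"] by simp
  finally show "emeasure (mu (gauss :: real^'n \<Rightarrow> real)) (space (mu (gauss :: real^'n \<Rightarrow> real))) = 1" .
qed

text \<open>The bound results from differentiating the exponential moments \<open>\<integral> exp (t \<pi> |x|\<^sup>2) d\<mu>\<close> at \<open>t = 0\<close>, using \<open>1 + u \<le> exp u\<close>.\<close>
lemma gauss_second_moment:
  "integrable (mu (gauss :: real^'n \<Rightarrow> real)) (\<lambda>x. (norm x)\<^sup>2)"
  "pi * (\<integral>x. (norm x)\<^sup>2 \<partial>mu (gauss :: real^'n \<Rightarrow> real)) \<le> CARD('n) / 2"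
proof -
  interpret prob_space "mu (gauss :: real^'n \<Rightarrow> real)" by (rule gauss_prob)
  let ?\<mu> = "mu (gauss :: real^'n \<Rightarrow> real)"
  have ineq: "t * (pi * (norm x)\<^sup>2) \<le> exp (t * pi * (norm x)\<^sup>2) - 1" for t and x :: "real^'n"
    using exp_ge_add_one_self[of "t * pi * (norm x)\<^sup>2"] unfolding mult.assoc by linarith
  have eint: "integrable ?\<mu> (\<lambda>x. exp (t * pi * (norm x)\<^sup>2) - 1)"
    and eval: "(\<integral>x. exp (t * pi * (norm x)\<^sup>2) - 1 \<partial>?\<mu>) = sqrt (1 / (1 - t)) ^ CARD('n) - 1" if "t < 1" for t
  proof -
    have tp: "t * pi < pi" using that by simp
    have "pi - t * pi = pi * (1 - t)" by (simp add: algebra_simps)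
    hence "pi / (pi - t * pi) = 1 / (1 - t)" by simp
    thus "integrable ?\<mu> (\<lambda>x. exp (t * pi * (norm x)\<^sup>2) - 1)"
      "(\<integral>x. exp (t * pi * (norm x)\<^sup>2) - 1 \<partial>?\<mu>) = sqrt (1 / (1 - t)) ^ CARD('n) - 1"
      using gauss_mu_exp[OF tp, where 'n='n] prob_space by auto
  qed
  have "integrable ?\<mu> (\<lambda>x. 1/2 * (pi * (norm x)\<^sup>2))"
  proof (rule Bochner_Integration.integrable_bound[OF eint[of "1/2"]])
    show "AE x in ?\<mu>. norm (1/2 * (pi * (norm x)\<^sup>2)) \<le> norm (exp (1/2 * pi * (norm x)\<^sup>2) - 1)"
      using ineq[of "1/2"] by (intro AE_I2) (simp add: abs_of_nonneg)
  qed (auto simp: mu_def)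
  hence "integrable ?\<mu> (\<lambda>x. 2 / pi * (1/2 * (pi * (norm x)\<^sup>2)))" by (rule integrable_mult_right)
  thus int: "integrable ?\<mu> (\<lambda>x. (norm x)\<^sup>2)" by simp
  define M where "M = (\<integral>x. (norm x)\<^sup>2 \<partial>?\<mu>)"
  define F where "F t = sqrt (1 / (1 - t)) ^ CARD('n)" for t :: real
  \<comment> \<open>The difference quotient of the exponential moment \<open>F\<close> at \<open>0\<close>; its limit is \<open>n / 2\<close>.\<close>
  have bound: "pi * M \<le> (F t - F 0) / (t - 0)" if "0 < t" "t < 1" for t
  proof -
    have "(\<integral>x. t * (pi * (norm x)\<^sup>2) \<partial>?\<mu>) \<le> (\<integral>x. exp (t * pi * (norm x)\<^sup>2) - 1 \<partial>?\<mu>)"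
      by (rule integral_mono) (use int eint ineq that in auto)
    hence "t * (pi * M) \<le> F t - F 0" using eval[of t] that unfolding M_def F_def by simp
    thus ?thesis using that by (simp add: field_simps)
  qed
  have "(F has_real_derivative CARD('n) / 2) (at 0)"
    unfolding F_def by (auto intro!: derivative_eq_intros simp: field_simps)
  hence "((\<lambda>t. (F t - F 0) / (t - 0)) \<longlongrightarrow> CARD('n) / 2) (at 0)"
    unfolding has_field_derivative_iff .
  hence "((\<lambda>t. (F t - F 0) / (t - 0)) \<longlongrightarrow> CARD('n) / 2) (at_right 0)"
    by (rule filterlim_mono) (auto simp: at_within_le_at)
  moreover have "\<forall>\<^sub>F t in at_right 0. pi * M \<le> (F t - F 0) / (t - 0)"
    by (rule eventually_at_rightI[of 0 1]) (rule bound, auto)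
  ultimately have "pi * M \<le> CARD('n) / 2"
    by (rule tendsto_lowerbound) simp
  thus "pi * (\<integral>x. (norm x)\<^sup>2 \<partial>?\<mu>) \<le> CARD('n) / 2" unfolding M_def .
qed

text \<open>The parameter of type \<open>'n itself\<close> only fixes the dimension.\<close>
locale gauss_dilation =
  fixes K :: real and dummy :: "'n::finite itself"
  assumes K: "K > 1"
begin

abbreviation "\<mu> \<equiv> mu (gauss :: real^'n \<Rightarrow> real)"
definition f :: "real^'n \<Rightarrow> real" where "f x = (1 / K) ^ CARD('n) * exp (pi * (1 - 1 / K\<^sup>2) * (norm x)\<^sup>2)"
definition \<nu> :: "(real^'n) measure" where "\<nu> = density \<mu> (\<lambda>x. ennreal (f x))"
definition g :: "real^'n \<Rightarrow> real" where "g x = pi * (K - 1) * (norm x)\<^sup>2"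
definition M where "M = (\<integral>x. (norm x)\<^sup>2 \<partial>\<mu>)"

lemma f_meas [measurable]: "f \<in> borel_measurable borel"
  unfolding f_def[abs_def] by measurable

lemma f_pos: "f x > 0" unfolding f_def using K by simp

lemma push: "distr \<mu> borel (\<lambda>x. K *\<^sub>R x) = \<nu>"
proof -
  let ?T = "\<lambda>x::real^'n. K *\<^sub>R x"
  let ?n = "CARD('n)"
  define h where "h y = exp (- pi / K\<^sup>2 * (norm y)\<^sup>2)" for y :: "real^'n"
  have hT: "exp (- gauss x) = h (?T x)" for x
    unfolding h_def gauss_def using K by (simp add: power_mult_distrib)
  have [measurable]: "h \<in> borel_measurable borel" unfolding h_def by measurable
  have lb: "(lborel :: (real^'n) measure) = density (distr lborel borel ?T) (\<lambda>_. ennreal (K ^ ?n))"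
    using lborel_affine[of K "0::real^'n"] K by simp
  have "density (lborel :: (real^'n) measure) (\<lambda>_. ennreal ((1/K) ^ ?n)) = density (density (distr lborel borel ?T) (\<lambda>_. ennreal (K ^ ?n))) (\<lambda>_. ennreal ((1/K) ^ ?n))"
    by (subst lb) (rule refl)
  also have "\<dots> = density (distr lborel borel ?T) (\<lambda>_. ennreal (K ^ ?n) * ennreal ((1/K) ^ ?n))"
    by (rule density_density_eq) auto
  also have "(\<lambda>_. ennreal (K ^ ?n) * ennreal ((1/K) ^ ?n)) = (\<lambda>_::real^'n. 1)"
    using K by (simp add: ennreal_mult'[symmetric] power_mult_distrib[symmetric])
  finally have d: "distr lborel borel ?T = density lborel (\<lambda>_. ennreal ((1/K) ^ ?n))"
    by (simp add: density_1)
  have "distr \<mu> borel ?T = distr (density lborel (\<lambda>x. ennreal (h (?T x)))) borel ?T"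
    unfolding mu_def hT ..
  also have "\<dots> = density (distr lborel borel ?T) (\<lambda>y. ennreal (h y))"
    by (rule density_distr[symmetric]) auto
  also have "\<dots> = density lborel (\<lambda>y. ennreal ((1/K) ^ ?n) * ennreal (h y))"
    unfolding d by (rule density_density_eq) auto
  also have "\<dots> = density lborel (\<lambda>y. ennreal (exp (- gauss y)) * ennreal (f y))"
  proof (rule density_cong)
    have "(1/K) ^ ?n * h y = exp (- gauss y) * f y" for y
      unfolding h_def f_def gauss_def using K by (simp add: exp_add[symmetric] field_simps)
    thus "AE y in lborel. ennreal ((1/K) ^ ?n) * ennreal (h y) = ennreal (exp (- gauss y)) * ennreal (f y)"
      using K f_pos by (intro AE_I2) (simp add: ennreal_mult'[symmetric] h_def)
  qed auto
  also have "\<dots> = \<nu>" unfolding \<nu>_def mu_def by (rule density_density_eq[symmetric]) auto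
  finally show ?thesis .
qed

lemma radial_norm_fun: "radial (\<lambda>x::real^'n. k (norm x))"
  unfolding radial_def using orthogonal_transformation_norm by metis

lemma admissible: "admissible gauss (2 * pi) \<nu>"
proof -
  interpret prob_space \<mu> by (rule gauss_prob)
  have gf: "gauss = (\<lambda>x::real^'n. pi * (norm x)\<^sup>2)" by (auto simp: gauss_def)
  have "C2 (gauss :: real^'n \<Rightarrow> real)"
    unfolding C2_def gf grad_scaled_norm_sq_fun hessian_scaled_norm_sq[abs_def]
    by (auto intro: differentiable_scaled_norm_sq)
  moreover have "psd (hessian gauss x - (2 * pi) *\<^sub>R mat 1)" for x :: "real^'n"
    unfolding gf hessian_scaled_norm_sq psd_def by (simp add: transpose_def vec_eq_iff)
  moreover have "radial (gauss :: real^'n \<Rightarrow> real)" unfolding gf by (rule radial_norm_fun)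
  moreover have "prob_space \<nu>" unfolding push[symmetric] by (rule prob_space_distr) (simp add: mu_def)
  moreover have "absolutely_continuous \<mu> \<nu>" unfolding \<nu>_def
    by (rule absolutely_continuousI_density) (simp add: mu_def)
  moreover have "radial f" unfolding f_def[abs_def] by (rule radial_norm_fun)
  moreover have "sets \<nu> = sets borel" unfolding \<nu>_def mu_def by simp
  ultimately show ?thesis unfolding admissible_def using gauss_prob f_pos \<nu>_def
    by (auto intro!: bexI[of _ f] less_imp_le)
qed

lemma brenier: "brenier_potential (2 * pi) \<mu> \<nu> g"
proof -
  have "(\<lambda>x::real^'n. 2 * pi / 2 * (norm x)\<^sup>2 + g x) = (\<lambda>x. (pi * K) * (norm x)\<^sup>2)"
    unfolding g_def by (auto simp: algebra_simps)
  moreover have "convex_on UNIV (\<lambda>x::real^'n. (pi * K) * (norm x)\<^sup>2)"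
    using K by (intro convex_on_scaled_norm_sq) simp
  moreover have "g differentiable (at x) \<and> K *\<^sub>R x = x + (1 / (2 * pi)) *\<^sub>R grad g x" for x
  proof -
    have "grad g x = (2 * (pi * (K - 1))) *\<^sub>R x" unfolding g_def by (rule grad_scaled_norm_sq)
    moreover have "x + (1 / (2 * pi)) *\<^sub>R (2 * (pi * (K - 1))) *\<^sub>R x = K *\<^sub>R x"
      by (simp add: scaleR_left_diff_distrib)
    ultimately show ?thesis unfolding g_def by (simp add: differentiable_scaled_norm_sq)
  qed
  hence "AE x in \<mu>. g differentiable (at x) \<and> K *\<^sub>R x = x + (1 / (2 * pi)) *\<^sub>R grad g x"
    by (intro AE_I2) blast
  moreover have "(\<lambda>x::real^'n. K *\<^sub>R x) \<in> borel_measurable borel" by measurable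
  ultimately show ?thesis unfolding brenier_potential_def
    using push by (intro conjI bexI[of _ "\<lambda>x. K *\<^sub>R x"]) simp_all
qed

lemma inf_conv_eq: "inf_conv (2 * pi) g y = ereal (pi * (1 - 1 / K) * (norm y)\<^sup>2)"
proof -
  have id: "g x + 2 * pi / 2 * (norm (x - y))\<^sup>2 = pi * (1 - 1 / K) * (norm y)\<^sup>2 + pi * K * (norm (x - (1 / K) *\<^sub>R y))\<^sup>2" for x
    unfolding g_def norm_sq_diff_scaled norm_sq_diff_scaled[of x 1 y, simplified] using K
    by (simp add: field_simps power2_eq_square)
  show ?thesis
  proof (rule antisym)
    show "inf_conv (2 * pi) g y \<le> ereal (pi * (1 - 1 / K) * (norm y)\<^sup>2)"
      using inf_conv_le[of "2 * pi" g y "(1 / K) *\<^sub>R y"] unfolding id by simp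
    show "ereal (pi * (1 - 1 / K) * (norm y)\<^sup>2) \<le> inf_conv (2 * pi) g y"
      unfolding inf_conv_def id using K by (intro INF_greatest) simp
  qed
qed

lemma exp_inf_conv_eq: "exp_inf_conv (2 * pi) g y = exp (pi * (1 - 1 / K) * (norm y)\<^sup>2)"
  unfolding exp_inf_conv_def inf_conv_eq by simp

text \<open>Testing with the function \<open>exp (- \<pi> |x|\<^sup>2)\<close>, which is at most \<open>1\<close>, reduces the bound to explicit
  Gaussian integrals.\<close>
lemma discrepancy_ge:
  "ennreal (sqrt (1 / 2) ^ CARD('n) - sqrt (1 / (K + 1)) ^ CARD('n)) \<le> L1_discrepancy (2 * pi) \<mu> g"
proof -
  define Z where "Z = (\<integral>y. exp_inf_conv (2 * pi) g y \<partial>\<mu>)"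
  have a: "pi * (1 - 1 / K) < pi" using K by simp
  have "pi / (pi - pi * (1 - 1 / K)) = K" using K by (simp add: field_simps)
  hence Z: "Z = sqrt K ^ CARD('n)"
    unfolding Z_def exp_inf_conv_eq using gauss_mu_exp(2)[OF a, where 'n='n] by simp
  hence Zpos: "Z > 0" using K by simp
  have 1: "integrable \<mu> (\<lambda>x. exp (- pi * (norm x)\<^sup>2))" "(\<integral>x. exp (- pi * (norm x)\<^sup>2) \<partial>\<mu>) = sqrt (1 / 2) ^ CARD('n)"
    using gauss_mu_exp[of "- pi", where 'n='n] by auto
  have b: "- pi / K < pi" using K by (simp add: field_simps) (smt (verit) pi_gt_zero mult_pos_pos)
  have "pi - (- pi / K) = pi * ((K + 1) / K)" using K by (simp add: field_simps)
  hence bb: "pi / (pi - (- pi / K)) = K / (K + 1)" by simp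
  have 2: "integrable \<mu> (\<lambda>x. exp (- pi / K * (norm x)\<^sup>2))" "(\<integral>x. exp (- pi / K * (norm x)\<^sup>2) \<partial>\<mu>) = sqrt (K / (K + 1)) ^ CARD('n)"
    using gauss_mu_exp[OF b, where 'n='n] unfolding bb by auto
  define \<psi> where "\<psi> x = exp (- pi * (norm x)\<^sup>2) - exp (- pi / K * (norm x)\<^sup>2) / Z" for x :: "real^'n"
  have \<psi>_int: "integrable \<mu> \<psi>" unfolding \<psi>_def by (intro Bochner_Integration.integrable_diff 1 integrable_divide_zero 2)
  have "(\<integral>x. \<psi> x \<partial>\<mu>) = sqrt (1 / 2) ^ CARD('n) - sqrt (K / (K + 1)) ^ CARD('n) / Z"
    unfolding \<psi>_def using 1 2 by simp
  also have "sqrt (K / (K + 1)) ^ CARD('n) / Z = sqrt (1 / (K + 1)) ^ CARD('n)"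
    unfolding Z power_divide[symmetric] using K by (simp add: real_sqrt_divide)
  finally have \<psi>_val: "(\<integral>x. \<psi> x \<partial>\<mu>) = sqrt (1 / 2) ^ CARD('n) - sqrt (1 / (K + 1)) ^ CARD('n)" .
  have le: "ennreal (\<psi> x) \<le> ennreal \<bar>1 - exp_inf_conv (2 * pi) g x / Z\<bar>" for x
  proof (rule ennreal_leI)
    have "\<psi> x = exp (- pi * (norm x)\<^sup>2) * (1 - exp_inf_conv (2 * pi) g x / Z)"
      unfolding \<psi>_def exp_inf_conv_eq by (simp add: right_diff_distrib exp_add[symmetric] algebra_simps)
    also have "\<dots> \<le> exp (- pi * (norm x)\<^sup>2) * \<bar>1 - exp_inf_conv (2 * pi) g x / Z\<bar>"
      by (intro mult_left_mono) auto
    also have "\<dots> \<le> 1 * \<bar>1 - exp_inf_conv (2 * pi) g x / Z\<bar>"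
      by (intro mult_right_mono) auto
    finally show "\<psi> x \<le> \<bar>1 - exp_inf_conv (2 * pi) g x / Z\<bar>" by simp
  qed
  have "ennreal (\<integral>x. \<psi> x \<partial>\<mu>) \<le> (\<integral>\<^sup>+x. ennreal (\<psi> x) \<partial>\<mu>)"
  proof -
    have "(\<integral>x. \<psi> x \<partial>\<mu>) \<le> (\<integral>x. max 0 (\<psi> x) \<partial>\<mu>)"
      by (intro integral_mono integrable_max \<psi>_int) auto
    hence "ennreal (\<integral>x. \<psi> x \<partial>\<mu>) \<le> ennreal (\<integral>x. max 0 (\<psi> x) \<partial>\<mu>)" by (rule ennreal_leI)
    also have "\<dots> = (\<integral>\<^sup>+x. ennreal (max 0 (\<psi> x)) \<partial>\<mu>)"
      by (rule nn_integral_eq_integral[symmetric]) (auto intro: integrable_max \<psi>_int)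
    also have "\<dots> = (\<integral>\<^sup>+x. ennreal (\<psi> x) \<partial>\<mu>)"
      by (intro nn_integral_cong) (auto simp: max_def ennreal_neg)
    finally show ?thesis .
  qed
  also have "\<dots> \<le> L1_discrepancy (2 * pi) \<mu> g"
    unfolding L1_discrepancy_def Z_def[symmetric] by (intro nn_integral_mono le)
  finally show ?thesis unfolding \<psi>_val .
qed

lemma M_nonneg: "M \<ge> 0" unfolding M_def by (rule Bochner_Integration.integral_nonneg) simp

lemma M_nn: "(\<integral>\<^sup>+x. ennreal ((norm x)\<^sup>2) \<partial>\<mu>) = ennreal M"
  unfolding M_def by (rule nn_integral_eq_integral[OF gauss_second_moment(1)]) simp

lemma nu_second_moment:
  "integrable \<mu> (\<lambda>x. f x * (norm x)\<^sup>2)" "(\<integral>x. f x * (norm x)\<^sup>2 \<partial>\<mu>) = K\<^sup>2 * M"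
  "(\<integral>\<^sup>+x. ennreal ((norm x)\<^sup>2) \<partial>\<nu>) = ennreal (K\<^sup>2 * M)"
proof -
  have nn: "(\<integral>\<^sup>+x. ennreal ((norm x)\<^sup>2) \<partial>\<nu>) = ennreal (K\<^sup>2 * M)"
  proof -
    have "(\<integral>\<^sup>+x. ennreal ((norm x)\<^sup>2) \<partial>\<nu>) = (\<integral>\<^sup>+x. ennreal (K\<^sup>2) * ennreal ((norm x)\<^sup>2) \<partial>\<mu>)"
      unfolding push[symmetric] by (subst nn_integral_distr) (auto simp: mu_def power_mult_distrib ennreal_mult)
    also have "\<dots> = ennreal (K\<^sup>2) * ennreal M"
      by (subst nn_integral_cmult) (auto simp: mu_def M_nn[unfolded mu_def])
    finally show ?thesis using M_nonneg by (simp add: ennreal_mult)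
  qed
  thus "(\<integral>\<^sup>+x. ennreal ((norm x)\<^sup>2) \<partial>\<nu>) = ennreal (K\<^sup>2 * M)" .
  have nnf: "(\<integral>\<^sup>+x. ennreal (f x * (norm x)\<^sup>2) \<partial>\<mu>) = ennreal (K\<^sup>2 * M)"
    unfolding nn[symmetric] \<nu>_def using f_pos
    by (subst nn_integral_density) (auto simp: mu_def ennreal_mult less_imp_le)
  have fnn: "0 \<le> f x * (norm x)\<^sup>2" for x using f_pos[of x] by simp
  show i: "integrable \<mu> (\<lambda>x. f x * (norm x)\<^sup>2)"
    by (rule integrableI_nonneg) (use nnf fnn in \<open>auto simp: mu_def\<close>)
  have "ennreal (\<integral>x. f x * (norm x)\<^sup>2 \<partial>\<mu>) = ennreal (K\<^sup>2 * M)"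
    using nn_integral_eq_integral[OF i] nnf fnn by simp
  thus "(\<integral>x. f x * (norm x)\<^sup>2 \<partial>\<mu>) = K\<^sup>2 * M"
    using M_nonneg fnn by (subst (asm) ennreal_inj) (auto intro: Bochner_Integration.integral_nonneg)
qed

lemma f_integral: "integrable \<mu> f" "(\<integral>x. f x \<partial>\<mu>) = 1"
proof -
  have a: "pi * (1 - 1 / K\<^sup>2) < pi" using K by simp
  have "pi / (pi - pi * (1 - 1 / K\<^sup>2)) = K\<^sup>2" using K by (simp add: field_simps)
  hence "integrable \<mu> (\<lambda>x. exp (pi * (1 - 1 / K\<^sup>2) * (norm x)\<^sup>2))"
    "(\<integral>x. exp (pi * (1 - 1 / K\<^sup>2) * (norm x)\<^sup>2) \<partial>\<mu>) = K ^ CARD('n)"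
    using gauss_mu_exp[OF a, where 'n='n] K by auto
  thus "integrable \<mu> f" "(\<integral>x. f x \<partial>\<mu>) = 1"
    unfolding f_def using K by (auto simp: power_mult_distrib[symmetric])
qed

lemma entropy_eq: "rel_entropy \<nu> \<mu> = ereal (pi * (K\<^sup>2 - 1) * M - CARD('n) * ln K)"
proof -
  have ln_f: "f x * ln (f x) = pi * (1 - 1 / K\<^sup>2) * (f x * (norm x)\<^sup>2) - CARD('n) * ln K * f x" for x
  proof -
    have "ln (f x) = pi * (1 - 1 / K\<^sup>2) * (norm x)\<^sup>2 - CARD('n) * ln K"
      unfolding f_def using K by (simp add: ln_mult ln_realpow ln_div)
    thus ?thesis by (simp only: right_diff_distrib mult_ac)
  qed
  have int: "integrable \<mu> (\<lambda>x. f x * ln (f x))"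
    unfolding ln_f by (intro Bochner_Integration.integrable_diff integrable_mult_right nu_second_moment f_integral)
  have "(\<integral>x. f x * ln (f x) \<partial>\<mu>) = pi * (1 - 1 / K\<^sup>2) * (K\<^sup>2 * M) - CARD('n) * ln K"
    unfolding ln_f using nu_second_moment f_integral by simp
  also have "pi * (1 - 1 / K\<^sup>2) * (K\<^sup>2 * M) = pi * (K\<^sup>2 - 1) * M" using K by (simp add: field_simps)
  finally have "(\<integral>x. f x * ln (f x) \<partial>\<mu>) = pi * (K\<^sup>2 - 1) * M - CARD('n) * ln K" .
  thus ?thesis unfolding \<nu>_def using int f_pos
    by (subst rel_entropy_density[OF gauss_prob]) (auto simp: mu_def less_imp_le)
qed

text \<open>For every coupling, \<open>|a - b|\<^sup>2 + (K - 1) |b|\<^sup>2 \<ge> (1 - 1/K) |a|\<^sup>2\<close> with equality when \<open>a = K b\<close>;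
  integrating shows that the dilation is an optimal transport.\<close>
lemma W2_ge: "ennreal ((K - 1)\<^sup>2 * M) \<le> (W2 \<nu> \<mu>)\<^sup>2"
proof -
  have "ennreal ((K - 1) * sqrt M) \<le> W2 \<nu> \<mu>"
    unfolding W2_def
  proof (rule INF_greatest)
    fix \<pi> assume "\<pi> \<in> couplings \<nu> \<mu>"
    hence \<pi>: "sets \<pi> = sets (borel \<Otimes>\<^sub>M borel)" "distr \<pi> borel fst = \<nu>" "distr \<pi> borel snd = \<mu>"
      unfolding couplings_def by auto
    note [measurable_cong] = \<pi>(1)
    define I where "I = (\<integral>\<^sup>+p. ennreal ((norm (fst p - snd p))\<^sup>2) \<partial>\<pi>)"
    have x: "(\<integral>\<^sup>+p. ennreal ((norm (fst p))\<^sup>2) \<partial>\<pi>) = ennreal (K\<^sup>2 * M)"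
      unfolding nu_second_moment(3)[symmetric] \<pi>(2)[symmetric] by (subst nn_integral_distr) auto
    have y: "(\<integral>\<^sup>+p. ennreal ((norm (snd p))\<^sup>2) \<partial>\<pi>) = ennreal M"
      unfolding M_nn[symmetric] \<pi>(3)[symmetric] by (subst nn_integral_distr) auto
    have pt: "(1 - 1 / K) * (norm a)\<^sup>2 \<le> (norm (a - b))\<^sup>2 + (K - 1) * (norm b)\<^sup>2" for a b :: "real^'n"
    proof -
      have "(norm (a - b))\<^sup>2 + (K - 1) * (norm b)\<^sup>2 - (1 - 1 / K) * (norm a)\<^sup>2 = K * (norm (b - (1 / K) *\<^sub>R a))\<^sup>2"
        unfolding norm_sq_diff_scaled norm_sq_diff_scaled[of a 1 b, simplified] using K
        by (simp add: inner_commute[of b a] field_simps power2_eq_square)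
      moreover have "0 \<le> K * (norm (b - (1 / K) *\<^sub>R a))\<^sup>2" using K by simp
      ultimately show ?thesis by linarith
    qed
    have "ennreal ((1 - 1 / K) * (K\<^sup>2 * M)) = (\<integral>\<^sup>+p. ennreal ((1 - 1 / K) * (norm (fst p))\<^sup>2) \<partial>\<pi>)"
      using K M_nonneg by (simp add: ennreal_mult nn_integral_cmult x)
    also have "\<dots> \<le> (\<integral>\<^sup>+p. ennreal ((norm (fst p - snd p))\<^sup>2) + ennreal ((K - 1) * (norm (snd p))\<^sup>2) \<partial>\<pi>)"
      using pt K by (intro nn_integral_mono) (simp add: ennreal_plus[symmetric] ennreal_leI del: ennreal_plus)
    also have "\<dots> = I + (\<integral>\<^sup>+p. ennreal ((K - 1) * (norm (snd p))\<^sup>2) \<partial>\<pi>)"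
      unfolding I_def by (rule nn_integral_add) measurable
    also have "(\<integral>\<^sup>+p. ennreal ((K - 1) * (norm (snd p))\<^sup>2) \<partial>\<pi>) = ennreal ((K - 1) * M)"
      using K M_nonneg by (simp add: ennreal_mult nn_integral_cmult y)
    finally have le: "ennreal ((1 - 1 / K) * (K\<^sup>2 * M)) \<le> I + ennreal ((K - 1) * M)" .
    show "ennreal ((K - 1) * sqrt M) \<le> ennpowr (\<integral>\<^sup>+p. ennreal ((norm (fst p - snd p))\<^sup>2) \<partial>\<pi>) (1 / 2)"
      unfolding I_def[symmetric]
    proof (cases I)
      case (real i)
      have "(1 - 1 / K) * (K\<^sup>2 * M) \<le> i + (K - 1) * M"
        using le real K M_nonneg by (simp add: ennreal_plus[symmetric] ennreal_le_iff del: ennreal_plus)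
      moreover have "(1 - 1 / K) * (K\<^sup>2 * M) = K\<^sup>2 * M - K * M" using K by (simp add: field_simps power2_eq_square)
      moreover have "(K - 1)\<^sup>2 * M = K\<^sup>2 * M - K * M - (K - 1) * M" by (simp add: power2_eq_square algebra_simps)
      ultimately have "(K - 1)\<^sup>2 * M \<le> i" by linarith
      hence "sqrt ((K - 1)\<^sup>2 * M) \<le> sqrt i" by simp
      hence "(K - 1) * sqrt M \<le> sqrt i" using K by (simp add: real_sqrt_mult)
      thus "ennreal ((K - 1) * sqrt M) \<le> ennpowr I (1 / 2)"
        using real unfolding ennpowr_def by (simp add: powr_half_sqrt ennreal_leI)
    qed (simp add: ennpowr_def)
  qed
  hence "(ennreal ((K - 1) * sqrt M))\<^sup>2 \<le> (W2 \<nu> \<mu>)\<^sup>2" by (rule power_mono) simp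
  thus ?thesis using K M_nonneg by (simp add: ennreal_power power_mult_distrib)
qed

text \<open>The exact value is \<open>n (K - 1 - ln K)\<close>, and \<open>ln K \<ge> 1 - 1/K\<close>.\<close>
lemma deficit_le: "tal_deficit (2 * pi) \<mu> \<nu> \<le> ereal (CARD('n) * (K - 1)\<^sup>2)"
proof -
  have "ereal ((K - 1)\<^sup>2 * M) \<le> enn2ereal ((W2 \<nu> \<mu>)\<^sup>2)"
    using W2_ge M_nonneg by (metis enn2ereal_ennreal less_eq_ennreal.rep_eq zero_le_mult_iff zero_le_power2)
  hence "ereal pi * ereal ((K - 1)\<^sup>2 * M) \<le> ereal pi * enn2ereal ((W2 \<nu> \<mu>)\<^sup>2)"
    by (intro ereal_mult_left_mono) auto
  hence "tal_deficit (2 * pi) \<mu> \<nu> \<le> ereal (pi * (K\<^sup>2 - 1) * M - CARD('n) * ln K) - ereal pi * ereal ((K - 1)\<^sup>2 * M)"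
    unfolding tal_deficit_def entropy_eq by (auto intro!: ereal_minus_mono simp del: times_ereal.simps ereal_minus)
  also have "\<dots> = ereal (2 * (K - 1) * (pi * M) - CARD('n) * ln K)"
    by (simp add: power2_eq_square algebra_simps)
  also have "\<dots> \<le> ereal (CARD('n) * (K - 1)\<^sup>2)"
  proof -
    have "2 * (K - 1) * (pi * M) \<le> 2 * (K - 1) * (CARD('n) / 2)"
      using gauss_second_moment(2)[where 'n='n] K unfolding M_def by (intro mult_left_mono) auto
    moreover have "1 - 1 / K \<le> ln K"
      using ln_le_minus_one[of "1 / K"] K by (simp add: ln_div)
    hence "CARD('n) * (1 - 1 / K) \<le> CARD('n) * ln K" by (intro mult_left_mono) auto
    moreover have "(K - 1) - (1 - 1 / K) \<le> (K - 1)\<^sup>2"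
    proof -
      have "(K - 1) - (1 - 1 / K) = (K - 1)\<^sup>2 / K" using K by (simp add: field_simps power2_eq_square)
      also have "\<dots> \<le> (K - 1)\<^sup>2" using K by (simp add: divide_le_eq mult_le_cancel_left1)
      finally show ?thesis .
    qed
    hence "CARD('n) * ((K - 1) - (1 - 1 / K)) \<le> CARD('n) * (K - 1)\<^sup>2" by (intro mult_left_mono) auto
    ultimately show ?thesis by (simp add: algebra_simps)
  qed
  finally show ?thesis .
qed

end

lemma dilation_gap:
  fixes \<epsilon> :: real
  assumes "0 < \<epsilon>" "\<epsilon> \<le> 1" "n > 0"
  shows "(1/2) ^ (n - 1) / 12 * \<epsilon> \<le> sqrt (1 / 2) ^ n - sqrt (1 / (1 + \<epsilon> + 1)) ^ n"
proof -
  define p q where "p = (1/2 :: real)" and "q = 1 / (2 + \<epsilon>)"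
  have pq: "0 < q" "q \<le> p" "p \<le> 1" using assms unfolding p_def q_def by (auto simp: field_simps)
  define A B where "A = sqrt p ^ n" and "B = sqrt q ^ n"
  have sq: "A * A = p ^ n" "B * B = q ^ n" unfolding A_def B_def using pq
    by (simp_all add: power_mult_distrib[symmetric])
  have "sqrt p \<le> 1" "sqrt q \<le> 1" "0 \<le> sqrt q" "sqrt q \<le> sqrt p" using pq by auto
  hence AB: "A \<le> 1" "B \<le> 1" "0 \<le> B" "B \<le> A" unfolding A_def B_def
    by (auto intro: power_le_one power_mono order_trans)
  have "p - q = \<epsilon> / (2 * (2 + \<epsilon>))" unfolding p_def q_def using assms by (simp add: field_simps)
  also have "\<dots> \<ge> \<epsilon> / 6" using assms by (intro divide_left_mono) auto
  finally have d: "\<epsilon> / 6 \<le> p - q" .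
  have "p ^ (n - 1) * (\<epsilon> / 6) \<le> p ^ (n - 1) * (p - q)" using d pq by (intro mult_left_mono) auto
  also have "\<dots> = p ^ n - p ^ (n - 1) * q" using assms(3) by (cases n) (auto simp: algebra_simps)
  also have "\<dots> \<le> p ^ n - q ^ (n - 1) * q" using pq by (intro diff_left_mono mult_right_mono power_mono) auto
  also have "q ^ (n - 1) * q = q ^ n" using assms(3) by (cases n) auto
  also have "p ^ n - q ^ n = (A - B) * (A + B)" unfolding sq[symmetric] by (simp add: algebra_simps)
  also have "\<dots> \<le> (A - B) * 2" using AB by (intro mult_left_mono) auto
  finally have "p ^ (n - 1) / 12 * \<epsilon> \<le> A - B" by simp
  moreover have "1 + \<epsilon> + 1 = 2 + \<epsilon>" by simp
  ultimately show ?thesis unfolding A_def B_def p_def q_def by simp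
qed

text \<open>For \<open>K = 1 + \<epsilon>\<close> an estimate with exponent \<open>\<eta>\<close> would give
  \<open>\<kappa> \<epsilon> \<le> C (n \<epsilon>\<^sup>2)\<close> to the power \<open>\<eta>\<close>, which fails as \<open>\<epsilon> \<rightarrow> 0\<close> if \<open>2 \<eta> > 1\<close>.\<close>
lemma exponent_optimal:
  "\<not> (\<exists>\<eta>>1/2. \<exists>C>0. \<forall>(V :: real^'n \<Rightarrow> real) c \<nu> g.
        admissible V c \<nu> \<longrightarrow> brenier_potential c (mu V) \<nu> g \<longrightarrow> stability_estimate C \<eta> c (mu V) \<nu> g)"
proof
  assume "\<exists>\<eta>>1/2. \<exists>C>0. \<forall>(V :: real^'n \<Rightarrow> real) c \<nu> g.
        admissible V c \<nu> \<longrightarrow> brenier_potential c (mu V) \<nu> g \<longrightarrow> stability_estimate C \<eta> c (mu V) \<nu> g"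
  then obtain \<eta> C where \<eta>: "\<eta> > 1/2" and C: "C > 0" and
    est: "\<And>(V :: real^'n \<Rightarrow> real) c \<nu> g. admissible V c \<nu> \<Longrightarrow> brenier_potential c (mu V) \<nu> g \<Longrightarrow> stability_estimate C \<eta> c (mu V) \<nu> g"
    by blast
  define n where "n = CARD('n)"
  have n: "n > 0" unfolding n_def by simp
  define \<kappa> where "\<kappa> = (1/2 :: real) ^ (n - 1) / 12"
  have \<kappa>: "\<kappa> > 0" unfolding \<kappa>_def by simp
  have main: "\<kappa> \<le> C * real n powr \<eta> * \<epsilon> powr (2 * \<eta> - 1)" if \<epsilon>: "0 < \<epsilon>" "\<epsilon> \<le> 1" for \<epsilon>
  proof -
    interpret gauss_dilation "1 + \<epsilon>" "TYPE('n)" by unfold_locales (use \<epsilon> in simp)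
    have "ennreal (\<kappa> * \<epsilon>) \<le> ennreal (sqrt (1 / 2) ^ n - sqrt (1 / (1 + \<epsilon> + 1)) ^ n)"
      unfolding \<kappa>_def by (intro ennreal_leI dilation_gap \<epsilon> n)
    also have "\<dots> \<le> L1_discrepancy (2 * pi) \<mu> g" using discrepancy_ge unfolding n_def .
    also have "\<dots> \<le> ennreal C * ennpowr (e2ennreal (tal_deficit (2 * pi) \<mu> \<nu>)) \<eta>"
      using est[OF admissible brenier] unfolding stability_estimate_def .
    also have "\<dots> \<le> ennreal C * ennreal ((real n * \<epsilon>\<^sup>2) powr \<eta>)"
    proof (rule mult_left_mono)
      define t where "t = e2ennreal (tal_deficit (2 * pi) \<mu> \<nu>)"
      have "t \<le> e2ennreal (ereal (real n * \<epsilon>\<^sup>2))"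
        unfolding t_def using deficit_le unfolding n_def by (intro e2ennreal_mono) simp
      hence t: "t \<le> ennreal (real n * \<epsilon>\<^sup>2)" by (simp add: e2ennreal_ereal)
      show "ennpowr t \<eta> \<le> ennreal ((real n * \<epsilon>\<^sup>2) powr \<eta>)"
      proof (cases t)
        case (real s)
        hence "s \<le> real n * \<epsilon>\<^sup>2" using t by (simp add: ennreal_le_iff)
        thus ?thesis using real \<eta> unfolding ennpowr_def by (auto intro!: ennreal_leI powr_mono2)
      next
        case top
        thus ?thesis using t by (simp add: top_unique)
      qed
    qed simp
    also have "\<dots> = ennreal (C * (real n * \<epsilon>\<^sup>2) powr \<eta>)" using C by (simp add: ennreal_mult)
    finally have "\<kappa> * \<epsilon> \<le> C * (real n * \<epsilon>\<^sup>2) powr \<eta>" using C by (simp add: ennreal_le_iff)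
    also have "(real n * \<epsilon>\<^sup>2) powr \<eta> = real n powr \<eta> * (\<epsilon> powr (2 * \<eta> - 1) * \<epsilon>)"
    proof -
      have "(\<epsilon>\<^sup>2) powr \<eta> = \<epsilon> powr (2 * \<eta>)" using \<epsilon> by (simp add: powr_powr flip: powr_numeral)
      also have "\<dots> = \<epsilon> powr (2 * \<eta> - 1) * \<epsilon>" using \<epsilon> by (simp add: powr_diff)
      finally show ?thesis using \<epsilon> by (simp add: powr_mult)
    qed
    finally have "\<kappa> * \<epsilon> \<le> (C * real n powr \<eta> * \<epsilon> powr (2 * \<eta> - 1)) * \<epsilon>" by (simp add: mult_ac)
    thus ?thesis using \<epsilon> by simp
  qed
  have "((\<lambda>\<epsilon>. C * real n powr \<eta> * \<epsilon> powr (2 * \<eta> - 1)) \<longlongrightarrow> C * real n powr \<eta> * 0 powr (2 * \<eta> - 1)) (at_right 0)"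
    using \<eta> by (intro tendsto_intros tendsto_powr') (auto intro!: eventually_at_rightI[of 0 1])
  hence "((\<lambda>\<epsilon>. C * real n powr \<eta> * \<epsilon> powr (2 * \<eta> - 1)) \<longlongrightarrow> 0) (at_right 0)" by simp
  hence "\<kappa> \<le> 0"
    by (rule tendsto_lowerbound) (auto intro!: eventually_at_rightI[of 0 1] main)
  thus False using \<kappa> by simp
qed

section \<open>Stability and optimality\<close>

theorem theorem1p4:
  shows "(\<exists>C>0. \<forall>(V :: real^('n::finite) \<Rightarrow> real) c \<nu> g.
            admissible V c \<nu> \<longrightarrow> brenier_potential c (mu V) \<nu> g \<longrightarrow>
            stability_estimate C (1/2) c (mu V) \<nu> g)
       \<and> \<not> (\<exists>\<eta>>1/2. \<exists>C>0. \<forall>(V :: real^'n \<Rightarrow> real) c \<nu> g.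
            admissible V c \<nu> \<longrightarrow> brenier_potential c (mu V) \<nu> g \<longrightarrow>
            stability_estimate C \<eta> c (mu V) \<nu> g)"
proof (intro conjI exI[of _ "4 * (real CARD('n) + 2)"] allI impI)
  show "(0 :: real) < 4 * (real CARD('n) + 2)" by simp
qed (rule stability_of_talagrand, assumption+, rule exponent_optimal)

end
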